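(* Let $d$ be an integer. 1. If $2\le d<50$, then $\mathcal{G}_{(d+3)}\subset\overline{\mathcal{G}_{(d,4)}}$. 2. If $2\le d<20$, then $\mathcal{G}_{(d+4)}\subset\overline{\mathcal{G}_{(d,5)}}$. 3. If $2\le d\le 12$, then $\mathcal{G}_{(d+5)}\subset\overline{\mathcal{G}_{(d,6)}}$.
   Context: $\mathcal{G}$ is the group of polynomial automorphisms of the affine plane $\mathbb{C}^2$, written as pairs $(F_1,F_2)\in\mathbb{C}[X,Y]^2$, with group law the composition of maps. $\mathcal{A}\subset\mathcal{G}$ is the subgroup of affine (degree one) automorphisms, and $\mathcal{B}\subset\mathcal{G}$ is the triangular subgroup of automorphisms $(aX+P(Y),bY+c)$ with $a,b\in\mathbb{C}^*$, $c\in\mathbb{C}$, $P\in\mathbb{C}[Y]$. By the Jung-van der Kulk theorem every $\theta\in\mathcal{G}$ can be written $\theta=\alpha_0\tau_1\alpha_1\cdots\tau_k\alpha_k$ with $\alpha_i\in\mathcal{A}$, and $\tau_i\in\mathcal{B}\setminus\mathcal{A}$, reduced in the sense of the amalgamated free product $\mathcal{A}*_{\mathcal{A}\cap\mathcal{B}}\mathcal{B}$ (that is, $\alpha_i\notin\mathcal{B}$ for $0<i<k$); then the sequence $(\deg\tau_1,\ldots,\deg\tau_k)$ depends only on $\theta$ and is called the polydegree of $\theta$ (degree of an automorphism = maximum of the degrees of its components). $\mathcal{G}_{(d_1,\ldots,d_k)}$ is the set of automorphisms of polydegree $(d_1,\ldots,d_k)$. $\mathcal{G}$ is an ind-variety: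 $\mathcal{G}=\bigcup_n\mathcal{G}_{\le n}$, where $\mathcal{G}_{\le n}$ is the set of automorphisms of degree at most $n$, a locally closed subset of the finite-dimensional space of pairs of polynomials of degree at most $n$. A subset of $\mathcal{G}$ is closed iff its intersection with every $\mathcal{G}_{\le n}$ is Zariski closed in $\mathcal{G}_{\le n}$. $\overline{A}$ denotes the closure of $A\subset\mathcal{G}$ in this topology. *)

theory Defs
  imports
    "HOL-Computational_Algebra.Polynomial"
    "HOL-Analysis.Abstract_Topology"
begin

section \<open>Polynomials in two variables\<close>

text \<open>
  Elements of \<open>\<complex>[X,Y]\<close> are represented as elements of \<open>\<complex>[X][Y]\<close>: the outer variable is \<open>Y\<close>
  and the coefficients are polynomials in \<open>X\<close>.
\<close>

type_synonym poly2 = "complex poly poly"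

definition const2 :: "complex \<Rightarrow> poly2" where
  "const2 c = [:[:c:]:]"

definition varX :: poly2 where
  "varX = [:[:0, 1:]:]"

definition varY :: poly2 where
  "varY = [:0, 1:]"

definition coeff2 :: "poly2 \<Rightarrow> nat \<Rightarrow> nat \<Rightarrow> complex" where
  "coeff2 p i j = coeff (coeff p j) i"

text \<open>The total degree; by convention it is \<open>0\<close> for the zero polynomial.\<close>

definition total_degree :: "poly2 \<Rightarrow> nat" where
  "total_degree p = Max (insert 0 {i + j |i j. coeff2 p i j \<noteq> 0})"

definition eval2 :: "poly2 \<Rightarrow> complex \<times> complex \<Rightarrow> complex" where
  "eval2 p v = poly (poly p [:snd v:]) (fst v)"

text \<open>\<open>subst2 p G\<close> is \<open>p(G\<^sub>1, G\<^sub>2)\<close>.\<close>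

definition subst2 :: "poly2 \<Rightarrow> poly2 \<times> poly2 \<Rightarrow> poly2" where
  "subst2 p G = poly (map_poly (\<lambda>q. poly (map_poly const2 q) (fst G)) p) (snd G)"

lemma const2_0 [simp]: "const2 0 = 0"
  by (simp add: const2_def)

lemma finite_support2: "finite {i + j |i j. coeff2 p i j \<noteq> 0}"
proof -
  have "{i + j |i j. coeff2 p i j \<noteq> 0}
      \<subseteq> (\<Union>j\<in>{..degree p}. (\<lambda>i. i + j) ` {..degree (coeff p j)})"
  proof
    fix m assume "m \<in> {i + j |i j. coeff2 p i j \<noteq> 0}"
    then obtain i j where m: "m = i + j" and nz: "coeff (coeff p j) i \<noteq> 0"
      by (auto simp: coeff2_def)
    from nz have "i \<le> degree (coeff p j)" by (rule le_degree)
    moreover from nz have "coeff p j \<noteq> 0" by auto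
    then have "j \<le> degree p" by (rule le_degree)
    ultimately show "m \<in> (\<Union>j\<in>{..degree p}. (\<lambda>i. i + j) ` {..degree (coeff p j)})"
      using m by auto
  qed
  then show ?thesis by (rule finite_subset) auto
qed

lemma total_degree_le_iff:
  "total_degree p \<le> n \<longleftrightarrow> (\<forall>i j. coeff2 p i j \<noteq> 0 \<longrightarrow> i + j \<le> n)"
  unfolding total_degree_def by (subst Max_le_iff) (auto simp: finite_support2)

lemma eval2_simps [simp]:
  "eval2 (const2 c) v = c" "eval2 varX v = fst v" "eval2 varY v = snd v"
  "eval2 0 v = 0" "eval2 (p + q) v = eval2 p v + eval2 q v" "eval2 (p * q) v = eval2 p v * eval2 q v"
  by (simp_all add: eval2_def const2_def varX_def varY_def)

lemma eval2_subst2: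
  "eval2 (subst2 p G) v = eval2 p (eval2 (fst G) v, eval2 (snd G) v)"
proof -
  have inner: "eval2 (poly (map_poly const2 q) g) v = poly q (eval2 g v)" for q g
    by (induction q) (simp_all add: map_poly_pCons)
  show ?thesis
  proof (induction p)
    case 0
    then show ?case by (simp add: subst2_def)
  next
    case (pCons a p)
    then show ?case
      by (simp add: subst2_def map_poly_pCons inner) (simp add: eval2_def)
  qed
qed


section \<open>Polynomial automorphisms of the affine plane\<close>

definition comp2 :: "poly2 \<times> poly2 \<Rightarrow> poly2 \<times> poly2 \<Rightarrow> poly2 \<times> poly2" where
  "comp2 F G = (subst2 (fst F) G, subst2 (snd F) G)"

definition id2 :: "poly2 \<times> poly2" where
  "id2 = (varX, varY)"

definition Aut2 :: "(poly2 \<times> poly2) set" where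
  "Aut2 = {F. \<exists>G. comp2 F G = id2 \<and> comp2 G F = id2}"

definition degree2 :: "poly2 \<times> poly2 \<Rightarrow> nat" where
  "degree2 F = max (total_degree (fst F)) (total_degree (snd F))"

definition Affine :: "(poly2 \<times> poly2) set" where
  "Affine = {F \<in> Aut2. degree2 F = 1}"

definition Triangular :: "(poly2 \<times> poly2) set" where
  "Triangular =
    {(const2 a * varX + poly (map_poly const2 P) varY, const2 b * varY + const2 c) |a b c P.
      a \<noteq> 0 \<and> b \<noteq> 0}"


section \<open>Polydegree\<close>

text \<open>
  The word \<open>\<alpha>\<^sub>0 \<tau>\<^sub>1 \<alpha>\<^sub>1 \<dots> \<tau>\<^sub>k \<alpha>\<^sub>k\<close> is encoded by its first letter \<open>\<alpha>\<^sub>0\<close> and the list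
  \<open>[(\<tau>\<^sub>1, \<alpha>\<^sub>1), \<dots>, (\<tau>\<^sub>k, \<alpha>\<^sub>k)]\<close>.
\<close>

fun word_prod ::
  "poly2 \<times> poly2 \<Rightarrow> ((poly2 \<times> poly2) \<times> (poly2 \<times> poly2)) list \<Rightarrow> poly2 \<times> poly2" where
  "word_prod \<alpha> [] = \<alpha>"
| "word_prod \<alpha> ((\<tau>, \<alpha>') # w) = comp2 \<alpha> (comp2 \<tau> (word_prod \<alpha>' w))"

text \<open>
  The use of \<open>butlast\<close> reflects that the condition \<open>\<alpha>\<^sub>i \<notin> Triangular\<close> is imposed for \<open>0 < i < k\<close>
  only.
\<close>

definition reduced_word ::
  "poly2 \<times> poly2 \<Rightarrow> ((poly2 \<times> poly2) \<times> (poly2 \<times> poly2)) list \<Rightarrow> bool" where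
  "reduced_word \<alpha> w \<longleftrightarrow>
    \<alpha> \<in> Affine \<and>
    (\<forall>(\<tau>, \<alpha>') \<in> set w. \<tau> \<in> Triangular - Affine \<and> \<alpha>' \<in> Affine) \<and>
    (\<forall>(\<tau>, \<alpha>') \<in> set (butlast w). \<alpha>' \<notin> Triangular)"

text \<open>
  The degree sequence of a reduced word depends only on its product, so an automorphism has
  polydegree \<open>ds\<close> iff some reduced word representing it has degree sequence \<open>ds\<close>.
\<close>

definition Aut2_polydegree :: "nat list \<Rightarrow> (poly2 \<times> poly2) set" where
  "Aut2_polydegree ds =
    {\<theta>. \<exists>\<alpha> w. reduced_word \<alpha> w \<and> word_prod \<alpha> w = \<theta> \<and> map (\<lambda>(\<tau>, _). degree2 \<tau>) w = ds}"


section \<open>The ind-variety topology\<close>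

definition poly_pairs :: "nat \<Rightarrow> (poly2 \<times> poly2) set" where
  "poly_pairs n = {F. total_degree (fst F) \<le> n \<and> total_degree (snd F) \<le> n}"

text \<open>
  Polynomial functions on the finite-dimensional vector space \<^term>\<open>poly_pairs n\<close>: the algebra
  of functions generated by the constants and the coefficients.
\<close>

inductive regular_fun :: "nat \<Rightarrow> (poly2 \<times> poly2 \<Rightarrow> complex) \<Rightarrow> bool" for n where
  const: "regular_fun n (\<lambda>F. c)"
| coord1: "i + j \<le> n \<Longrightarrow> regular_fun n (\<lambda>F. coeff2 (fst F) i j)"
| coord2: "i + j \<le> n \<Longrightarrow> regular_fun n (\<lambda>F. coeff2 (snd F) i j)"
| add: "regular_fun n f \<Longrightarrow> regular_fun n g \<Longrightarrow> regular_fun n (\<lambda>F. f F + g F)"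
| mult: "regular_fun n f \<Longrightarrow> regular_fun n g \<Longrightarrow> regular_fun n (\<lambda>F. f F * g F)"

definition zero_locus :: "nat \<Rightarrow> (poly2 \<times> poly2 \<Rightarrow> complex) set \<Rightarrow> (poly2 \<times> poly2) set" where
  "zero_locus n S = {F \<in> poly_pairs n. \<forall>f\<in>S. f F = 0}"

definition zariski :: "nat \<Rightarrow> (poly2 \<times> poly2) topology" where
  "zariski n = topology (\<lambda>U. \<exists>S \<subseteq> Collect (regular_fun n). U = poly_pairs n - zero_locus n S)"

definition Aut2_le :: "nat \<Rightarrow> (poly2 \<times> poly2) set" where
  "Aut2_le n = {F \<in> Aut2. degree2 F \<le> n}"

definition Aut2_topology :: "(poly2 \<times> poly2) topology" where
  "Aut2_topology = topology (\<lambda>U. U \<subseteq> Aut2 \<and>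
    (\<forall>n. openin (subtopology (zariski n) (Aut2_le n)) (U \<inter> Aut2_le n)))"

lemma istopology_zariski:
  "istopology (\<lambda>U. \<exists>S \<subseteq> Collect (regular_fun n). U = poly_pairs n - zero_locus n S)"
  unfolding istopology_def
proof (intro conjI allI impI)
  fix U V
  assume "\<exists>S \<subseteq> Collect (regular_fun n). U = poly_pairs n - zero_locus n S"
    and "\<exists>S \<subseteq> Collect (regular_fun n). V = poly_pairs n - zero_locus n S"
  then obtain S T where S: "S \<subseteq> Collect (regular_fun n)" "U = poly_pairs n - zero_locus n S"
    and T: "T \<subseteq> Collect (regular_fun n)" "V = poly_pairs n - zero_locus n T" by (elim exE conjE)
  define R where "R = (\<lambda>(f, g) F. f F * g F) ` (S \<times> T)"
  have R: "R \<subseteq> Collect (regular_fun n)"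
  proof
    fix h assume "h \<in> R"
    then obtain f g where h: "h = (\<lambda>F. f F * g F)" and "f \<in> S" "g \<in> T"
      unfolding R_def by force
    then have "regular_fun n f" "regular_fun n g" using S(1) T(1) by blast+
    then show "h \<in> Collect (regular_fun n)"
      unfolding h mem_Collect_eq by (rule regular_fun.mult)
  qed
  have "(\<forall>h\<in>R. h F = 0) \<longleftrightarrow> (\<forall>f\<in>S. f F = 0) \<or> (\<forall>g\<in>T. g F = 0)" for F
    by (auto simp: R_def)
  then have "U \<inter> V = poly_pairs n - zero_locus n R"
    unfolding S(2) T(2) zero_locus_def by simp blast
  with R show "\<exists>S \<subseteq> Collect (regular_fun n). U \<inter> V = poly_pairs n - zero_locus n S"
    by (intro exI[of _ R] conjI)
next
  fix K
  assume "\<forall>U\<in>K. \<exists>S \<subseteq> Collect (regular_fun n). U = poly_pairs n - zero_locus n S"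
  then obtain S where S: "\<forall>U\<in>K. S U \<subseteq> Collect (regular_fun n) \<and> U = poly_pairs n - zero_locus n (S U)"
    unfolding bchoice_iff by (elim exE)
  have "\<Union>K = (\<Union>U\<in>K. poly_pairs n - zero_locus n (S U))"
    using S by blast
  also have "\<dots> = poly_pairs n - zero_locus n (\<Union>U\<in>K. S U)"
    unfolding zero_locus_def by blast
  finally have "\<Union>K = poly_pairs n - zero_locus n (\<Union>U\<in>K. S U)" .
  moreover have "(\<Union>U\<in>K. S U) \<subseteq> Collect (regular_fun n)"
    using S by blast
  ultimately show "\<exists>S \<subseteq> Collect (regular_fun n). \<Union>K = poly_pairs n - zero_locus n S"
    by (intro exI[of _ "\<Union>U\<in>K. S U"] conjI)
qed

lemma openin_zariski:
  "openin (zariski n) U \<longleftrightarrow>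
    (\<exists>S \<subseteq> Collect (regular_fun n). U = poly_pairs n - zero_locus n S)"
  unfolding zariski_def using istopology_zariski[of n] by (simp add: topology_inverse')

lemma topspace_zariski [simp]: "topspace (zariski n) = poly_pairs n"
proof
  show "topspace (zariski n) \<subseteq> poly_pairs n"
    by (auto simp: topspace_def openin_zariski)
  have "zero_locus n {\<lambda>F. 1} = {}" by (simp add: zero_locus_def)
  then have "openin (zariski n) (poly_pairs n)"
    unfolding openin_zariski using regular_fun.const[of n 1]
    by (intro exI[of _ "{\<lambda>F. 1}"]) simp
  then show "poly_pairs n \<subseteq> topspace (zariski n)" by (rule openin_subset)
qed

lemma closedin_zariski:
  "closedin (zariski n) Z \<longleftrightarrow> (\<exists>S \<subseteq> Collect (regular_fun n). Z = zero_locus n S)"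
proof -
  have "Z \<subseteq> poly_pairs n \<Longrightarrow>
      poly_pairs n - Z = poly_pairs n - zero_locus n S \<longleftrightarrow> Z = zero_locus n S" for S
    by (auto simp: zero_locus_def)
  then show ?thesis
    unfolding closedin_def openin_zariski topspace_zariski
    by (auto simp: zero_locus_def)
qed

lemma Aut2_le_subset: "Aut2_le n \<subseteq> poly_pairs n"
  by (auto simp: Aut2_le_def poly_pairs_def degree2_def)

lemma istopology_Aut2:
  "istopology (\<lambda>U. U \<subseteq> Aut2 \<and>
    (\<forall>n. openin (subtopology (zariski n) (Aut2_le n)) (U \<inter> Aut2_le n)))"
proof -
  let ?O = "\<lambda>n. openin (subtopology (zariski n) (Aut2_le n))"
  have Int: "?O n (U \<inter> V \<inter> Aut2_le n)"
    if U: "?O n (U \<inter> Aut2_le n)" and V: "?O n (V \<inter> Aut2_le n)" for U V n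
  proof -
    have "(U \<inter> Aut2_le n) \<inter> (V \<inter> Aut2_le n) = U \<inter> V \<inter> Aut2_le n" by blast
    then show ?thesis using openin_Int[OF U V] by (rule subst)
  qed
  have Union: "?O n (\<Union>K \<inter> Aut2_le n)" if K: "\<And>U. U \<in> K \<Longrightarrow> ?O n (U \<inter> Aut2_le n)" for K n
  proof -
    have "?O n (\<Union>((\<lambda>U. U \<inter> Aut2_le n) ` K))"
    proof (rule openin_Union)
      fix W assume "W \<in> (\<lambda>U. U \<inter> Aut2_le n) ` K"
      then show "?O n W" by (rule imageE) (simp only: K)
    qed
    moreover have "\<Union>((\<lambda>U. U \<inter> Aut2_le n) ` K) = \<Union>K \<inter> Aut2_le n" by blast
    ultimately show ?thesis by (rule back_subst)
  qed
  show ?thesis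
    unfolding istopology_def
  proof (intro conjI allI impI; (elim conjE)?)
    fix U V n
    assume "\<forall>n. ?O n (U \<inter> Aut2_le n)" and "\<forall>n. ?O n (V \<inter> Aut2_le n)"
    then show "?O n (U \<inter> V \<inter> Aut2_le n)" by (intro Int) (elim allE, assumption)+
  next
    fix K n
    assume K: "\<forall>U\<in>K. U \<subseteq> Aut2 \<and> (\<forall>n. ?O n (U \<inter> Aut2_le n))"
    then show "\<Union>K \<subseteq> Aut2" by (intro Union_least) simp
    show "?O n (\<Union>K \<inter> Aut2_le n)" by (rule Union) (simp add: K)
  qed (rule le_infI1)
qed

lemma openin_Aut2:
  "openin Aut2_topology U \<longleftrightarrow>
    U \<subseteq> Aut2 \<and> (\<forall>n. openin (subtopology (zariski n) (Aut2_le n)) (U \<inter> Aut2_le n))"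
  unfolding Aut2_topology_def using istopology_Aut2 by (simp add: topology_inverse')

lemma topspace_subtopology_Aut2_le [simp]:
  "topspace (subtopology (zariski n) (Aut2_le n)) = Aut2_le n"
  using Aut2_le_subset[of n] by auto

lemma topspace_Aut2 [simp]: "topspace Aut2_topology = Aut2"
proof
  show "topspace Aut2_topology \<subseteq> Aut2"
    by (auto simp: topspace_def openin_Aut2)
  have "Aut2 \<inter> Aut2_le n = topspace (subtopology (zariski n) (Aut2_le n))" for n
    unfolding topspace_subtopology_Aut2_le by (auto simp: Aut2_le_def)
  then have "openin Aut2_topology Aut2"
    unfolding openin_Aut2 by (simp only: openin_topspace subset_refl simp_thms)
  then show "Aut2 \<subseteq> topspace Aut2_topology" by (rule openin_subset)
qed

lemma closedin_Aut2:
  "closedin Aut2_topology Z \<longleftrightarrow>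
    Z \<subseteq> Aut2 \<and> (\<forall>n. closedin (subtopology (zariski n) (Aut2_le n)) (Z \<inter> Aut2_le n))"
proof -
  have "Aut2_le n - Z \<inter> Aut2_le n = (Aut2 - Z) \<inter> Aut2_le n" for n
    by (auto simp: Aut2_le_def)
  then show ?thesis
    unfolding closedin_def openin_Aut2 topspace_Aut2 topspace_subtopology_Aut2_le
    by auto
qed

end

theory Submission
  imports Defs "HOL-Analysis.Analysis" "HOL-Computational_Algebra.Polynomial_FPS"
    "HOL-Library.Numeral_Type"
begin

text \<open>
  Put \<open>N = d + e - 1\<close>. Up to affine maps, an automorphism of polydegree \<open>(N)\<close> is \<open>(X + P(Y), Y)\<close>.
  If polynomials \<open>A\<close>, \<open>D\<close> of degrees \<open>e\<close>, \<open>d\<close> (depending on a small \<open>h\<close>) satisfy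
  \<open>D(A(t)) = t + \<Sum> g p\<^sub>k h\<^sup>N\<^sup>-\<^sup>k t\<^sup>k + O(t\<^sup>N\<^sup>+\<^sup>1)\<close>, where \<open>P = \<Sum> p\<^sub>k Y\<^sup>k\<close>, then with
  \<open>\<delta> = g h\<^sup>N\<^sup>-\<^sup>1\<close> and \<open>u = \<delta> X + A(h Y) / h\<close> the automorphism \<open>((D(h u) / h - Y) / \<delta>, u)\<close> has
  polydegree \<open>(d, e)\<close> and tends to \<open>(X + P(Y), Y)\<close> as \<open>h \<rightarrow> 0\<close>.

  By Lagrange inversion, \<open>D\<close> exists iff the coefficients of \<open>A = t B(t)\<close> satisfy \<open>e - 2\<close> equations,
  which for \<open>h = 0\<close> read \<open>[t\<^sup>j\<^sup>-\<^sup>1] B\<^sup>-\<^sup>j = 0\<close> for \<open>d < j < N\<close>. Brouwer's fixed point theorem,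
  applied to a Newton map near an approximate solution, solves these equations for all small \<open>h\<close>.
  For each pair \<open>(d, e)\<close> in question the required estimates are verified by integer arithmetic.
\<close>

section \<open>Automorphisms and coefficientwise limits\<close>

text \<open>The sum \<open>d + e - 1\<close> comes from a count. With linear coefficient 1,
  \<open>A\<close> has \<open>e - 1\<close> free coefficients. At \<open>h = 0\<close> the
  \<open>e - 2\<close> equations are weighted homogeneous under \<open>B(t) -> B(c t)\<close>, so
  the top coefficient of \<open>B\<close> can be kept fixed, which leaves as many equations as
  unknowns. The same scaling makes the coefficients of \<open>B - 1\<close> small enough for
  geometric series estimates. At \<open>h = 0\<close> the equations do not involve \<open>P\<close>,
  so one approximate solution serves every \<open>P\<close> of degree \<open>N\<close>. Two further
  numbers must be nonzero: the coefficient of \<open>t^(d-1)\<close> in \<open>B^-d\<close>, or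
  \<open>D\<close> drops in degree, and that of \<open>t^(N-1)\<close> in \<open>B^-N\<close>, or
  \<open>g\<close> tends to 0. The scalar \<open>g\<close> cannot be prescribed: the coefficient of
  \<open>D(A(t))\<close> at \<open>t^N\<close> is dictated by \<open>A\<close>, and \<open>g\<close>
  is that number (up to a vanishing error) divided by \<open>p_N\<close>. Brouwer's theorem asks
  only for an approximate zero with a strict margin. Dyadic data therefore suffice, and the margin
  absorbs the perturbation by \<open>h\<close>. The analytic part does not bound \<open>d\<close>;
  the ranges in the theorem are those of the certificate tables.\<close>

lemma poly_sum_le: "degree p \<le> n \<Longrightarrow> poly p x = (\<Sum>i\<le>n. coeff p i * x ^ i)"
  for p :: "'a :: comm_semiring_1 poly"
  by (simp add: poly_altdef) (intro sum.mono_neutral_left, auto simp: coeff_eq_0)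

section \<open>Values, substitution and total degree of bivariate polynomials\<close>

lemma total_degree_coeff: "coeff2 p i j \<noteq> 0 \<Longrightarrow> i + j \<le> total_degree p"
  using total_degree_le_iff by blast

lemma degree_le_total_degree: "degree p \<le> total_degree p" "degree (coeff p j) \<le> total_degree p"
proof -
  show "degree p \<le> total_degree p"
  proof (cases "p = 0")
    case False
    then have "coeff2 p (degree (lead_coeff p)) (degree p) \<noteq> 0"
      by (simp add: coeff2_def)
    then show ?thesis using total_degree_coeff by fastforce
  qed simp
  show "degree (coeff p j) \<le> total_degree p"
  proof (cases "coeff p j = 0")
    case False
    then have "coeff2 p (degree (coeff p j)) j \<noteq> 0"
      by (simp add: coeff2_def)
    then show ?thesis using total_degree_coeff by fastforce
  qed simp
qed

lemma eval2_eq_sum: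
  assumes "total_degree p \<le> n"
  shows "eval2 p v = (\<Sum>j\<le>n. \<Sum>i\<le>n. coeff2 p i j * fst v ^ i * snd v ^ j)"
proof -
  have 1: "degree p \<le> n" and 2: "degree (coeff p j) \<le> n" for j
    using degree_le_total_degree[of p] assms by (auto intro: order_trans)
  have "eval2 p v = (\<Sum>j\<le>n. poly (coeff p j) (fst v) * snd v ^ j)"
    unfolding eval2_def poly_sum_le[OF 1] by (simp add: poly_sum)
  also have "\<dots> = (\<Sum>j\<le>n. \<Sum>i\<le>n. coeff2 p i j * fst v ^ i * snd v ^ j)"
    by (simp add: poly_sum_le[OF 2] coeff2_def sum_distrib_right)
  finally show ?thesis .
qed

lemma eval2_inject: "(\<And>v. eval2 p v = eval2 q v) \<Longrightarrow> p = q"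
proof -
  assume eq: "\<And>v. eval2 p v = eval2 q v"
  have ev: "poly (map_poly (\<lambda>c. poly c x) r) y = eval2 r (x, y)" for x y r
    by (induction r) (auto simp: map_poly_pCons eval2_def)
  have "map_poly (\<lambda>c. poly c x) p = map_poly (\<lambda>c. poly c x) q" for x
    unfolding poly_eq_poly_eq_iff[symmetric] fun_eq_iff by (simp add: ev eq)
  then have "poly (coeff p j) x = poly (coeff q j) x" for x j
    by (metis coeff_map_poly poly_0)
  then have "coeff p j = coeff q j" for j
    by (simp add: poly_eq_poly_eq_iff[symmetric] fun_eq_iff)
  then show "p = q" by (simp add: poly_eq_iff)
qed

lemma eval2_more [simp]:
  "eval2 1 v = 1" "eval2 (p ^ k) v = eval2 p v ^ k" "eval2 (- p) v = - eval2 p v"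
  "eval2 (p - q) v = eval2 p v - eval2 q v"
  "eval2 (sum f A) v = (\<Sum>x\<in>A. eval2 (f x) v)"
proof -
  show "eval2 1 v = 1" by (simp add: eval2_def)
  then show "eval2 (p ^ k) v = eval2 p v ^ k" by (induction k) auto
  show "eval2 (- p) v = - eval2 p v" "eval2 (p - q) v = eval2 p v - eval2 q v"
    by (simp_all add: eval2_def)
  show "eval2 (sum f A) v = (\<Sum>x\<in>A. eval2 (f x) v)"
    by (induction A rule: infinite_finite_induct) auto
qed

lemma subst2_eq_sum:
  assumes "total_degree p \<le> n"
  shows "subst2 p G = (\<Sum>j\<le>n. \<Sum>i\<le>n. const2 (coeff2 p i j) * fst G ^ i * snd G ^ j)"
  by (rule eval2_inject) (simp add: eval2_subst2 eval2_eq_sum[OF assms])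

text \<open>Over an infinite field a pair is determined by its values, so identities between
  compositions reduce to identities between maps of the plane.\<close>

definition eval_map :: "poly2 \<times> poly2 \<Rightarrow> complex \<times> complex \<Rightarrow> complex \<times> complex" where
  "eval_map F v = (eval2 (fst F) v, eval2 (snd F) v)"

lemma eval_map_inject: "(\<And>v. eval_map F v = eval_map G v) \<Longrightarrow> F = G"
  by (rule prod_eqI; rule eval2_inject) (simp_all add: eval_map_def)

lemma eval_map_comp2 [simp]: "eval_map (comp2 F G) v = eval_map F (eval_map G v)"
  by (simp add: eval_map_def comp2_def eval2_subst2)

lemma eval_map_id2 [simp]: "eval_map id2 v = v"
  by (simp add: eval_map_def id2_def)

lemma comp2_assoc: "comp2 (comp2 F G) H = comp2 F (comp2 G H)"
  by (rule eval_map_inject) simp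

lemma Aut2I:
  assumes "\<And>v. eval_map F (eval_map G v) = v" "\<And>v. eval_map G (eval_map F v) = v"
  shows "F \<in> Aut2"
  unfolding Aut2_def mem_Collect_eq
  by (rule exI[of _ G], intro conjI; rule eval_map_inject; simp add: assms)

lemma comp2_Aut2:
  assumes "F \<in> Aut2" "G \<in> Aut2" shows "comp2 F G \<in> Aut2"
proof -
  obtain F' G' where inv: "comp2 F F' = id2" "comp2 F' F = id2" "comp2 G G' = id2" "comp2 G' G = id2"
    using assms unfolding Aut2_def by blast
  have "eval_map F (eval_map F' v) = v" "eval_map F' (eval_map F v) = v"
    "eval_map G (eval_map G' v) = v" "eval_map G' (eval_map G v) = v" for v
    by (metis inv eval_map_comp2 eval_map_id2)+
  then show ?thesis by (intro Aut2I[of _ "comp2 G' F'"]) simp_all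
qed

lemma coeff2_simps [simp]:
  "coeff2 0 i j = 0"
  "coeff2 (p + q) i j = coeff2 p i j + coeff2 q i j"
  "coeff2 (p - q) i j = coeff2 p i j - coeff2 q i j"
  "coeff2 (sum f A) i j = (\<Sum>x\<in>A. coeff2 (f x) i j)"
  "coeff2 (const2 c * p) i j = c * coeff2 p i j"
  "coeff2 varX i j = (if i = 1 \<and> j = 0 then 1 else 0)"
  "coeff2 varY i j = (if i = 0 \<and> j = 1 then 1 else 0)"
  "coeff2 (const2 c) i j = (if i = 0 \<and> j = 0 then c else 0)"
  "coeff2 1 i j = (if i = 0 \<and> j = 0 then 1 else 0)"
  by (auto simp: coeff2_def coeff_sum const2_def varX_def varY_def coeff_pCons split: nat.splits)

lemma coeff2_mult:
  "coeff2 (p * q) i j = (\<Sum>l\<le>j. \<Sum>k\<le>i. coeff2 p k l * coeff2 q (i - k) (j - l))"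
  by (simp add: coeff2_def coeff_mult coeff_sum)

lemma total_degree_add: "total_degree p \<le> n \<Longrightarrow> total_degree q \<le> n \<Longrightarrow> total_degree (p + q) \<le> n"
  unfolding total_degree_le_iff by (metis add_cancel_right_left coeff2_simps(2))

lemma total_degree_sum: "(\<And>x. x \<in> A \<Longrightarrow> total_degree (f x) \<le> n) \<Longrightarrow> total_degree (sum f A) \<le> n"
  by (induction A rule: infinite_finite_induct)
     (auto simp: total_degree_le_iff[of 0] intro: total_degree_add)

lemma total_degree_const2_mult: "total_degree (const2 c * p) \<le> total_degree p"
  unfolding total_degree_le_iff by (auto intro: total_degree_coeff)

lemma total_degree_mult:
  assumes "total_degree p \<le> m" "total_degree q \<le> n" shows "total_degree (p * q) \<le> m + n"
  unfolding total_degree_le_iff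
proof (intro allI impI)
  fix i j assume "coeff2 (p * q) i j \<noteq> 0"
  then obtain l k where lk: "l \<le> j" "k \<le> i" "coeff2 p k l * coeff2 q (i - k) (j - l) \<noteq> 0"
    unfolding coeff2_mult by (metis (no_types, lifting) atMost_iff sum.neutral)
  then have "k + l \<le> m" "(i - k) + (j - l) \<le> n"
    using assms total_degree_coeff[of p k l] total_degree_coeff[of q "i - k" "j - l"] by auto
  then show "i + j \<le> m + n" using lk(1,2) by linarith
qed

lemma total_degree_power:
  assumes "total_degree p \<le> m" shows "total_degree (p ^ k) \<le> k * m"
proof (induction k)
  case 0
  have "total_degree 1 \<le> 0" unfolding total_degree_le_iff by simp
  then show ?case by simp
next
  case (Suc k)
  then show ?case using total_degree_mult[OF assms Suc] by simp
qed

lemma total_degree_subst2: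
  assumes "total_degree p \<le> m" "degree2 G \<le> n"
  shows "total_degree (subst2 p G) \<le> m * n"
  unfolding subst2_eq_sum[OF assms(1)]
proof (intro total_degree_sum)
  fix i j assume "j \<in> {..m}" "i \<in> {..m}"
  have G: "total_degree (fst G) \<le> n" "total_degree (snd G) \<le> n"
    using assms(2) by (auto simp: degree2_def)
  show "total_degree (const2 (coeff2 p i j) * fst G ^ i * snd G ^ j) \<le> m * n"
  proof (cases "coeff2 p i j = 0")
    case True
    then show ?thesis by (simp add: total_degree_le_iff)
  next
    case False
    then have "i + j \<le> m" using assms(1) total_degree_coeff by (meson order_trans)
    then have "(i + j) * n \<le> m * n" by simp
    have "total_degree (fst G ^ i * snd G ^ j) \<le> i * n + j * n"
      by (intro total_degree_mult total_degree_power G)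
    then have "total_degree (const2 (coeff2 p i j) * (fst G ^ i * snd G ^ j)) \<le> i * n + j * n"
      using total_degree_const2_mult order_trans by blast
    then show ?thesis using \<open>(i + j) * n \<le> m * n\<close> by (simp add: algebra_simps)
  qed
qed

lemma degree2_comp2:
  assumes "degree2 F \<le> m" "degree2 G \<le> n" shows "degree2 (comp2 F G) \<le> m * n"
  using assms total_degree_subst2[OF _ assms(2)] by (simp add: comp2_def degree2_def)

lemma Aut2_degree2_pos:
  assumes "F \<in> Aut2" shows "degree2 F \<ge> 1"
proof (rule ccontr)
  assume "\<not> ?thesis"
  then have "total_degree (fst F) \<le> 0" "total_degree (snd F) \<le> 0" by (auto simp: degree2_def)
  then have "eval_map F v = eval_map F w" for v w
    by (simp add: eval_map_def eval2_eq_sum[where n = 0])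
  moreover obtain G where "comp2 G F = id2" using assms by (auto simp: Aut2_def)
  ultimately have "v = w" for v w :: "complex \<times> complex" by (metis eval_map_comp2 eval_map_id2)
  then have "(0, 0) = (1 :: complex, 0 :: complex)" .
  then show False by simp
qed

lemma AffineI: "F \<in> Aut2 \<Longrightarrow> degree2 F \<le> 1 \<Longrightarrow> F \<in> Affine"
  using Aut2_degree2_pos by (fastforce simp: Affine_def)

lemma comp2_Affine: "F \<in> Affine \<Longrightarrow> G \<in> Affine \<Longrightarrow> comp2 F G \<in> Affine"
  by (rule AffineI) (use comp2_Aut2 degree2_comp2[of F 1 G 1] in \<open>auto simp: Affine_def\<close>)

abbreviation polyY :: "complex poly \<Rightarrow> poly2" where
  "polyY P \<equiv> poly (map_poly const2 P) varY"

lemma eval2_polyY [simp]: "eval2 (polyY P) v = poly P (snd v)"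
  by (induction P) (simp_all add: map_poly_pCons)

lemma coeff2_polyY [simp]: "coeff2 (polyY P) i j = (if i = 0 then coeff P j else 0)"
proof -
  have "polyY P = map_poly (\<lambda>c. [:c:]) P"
    by (rule eval2_inject) (simp, induction P, auto simp: map_poly_pCons eval2_def)
  then show ?thesis by (auto simp: coeff2_def coeff_map_poly coeff_pCons split: nat.splits)
qed

section \<open>Triangular maps and words with one or two triangular letters\<close>

definition triangular :: "complex \<Rightarrow> complex poly \<Rightarrow> complex \<Rightarrow> complex \<Rightarrow> poly2 \<times> poly2" where
  "triangular a P b c = (const2 a * varX + polyY P, const2 b * varY + const2 c)"

lemma Triangular_eq: "Triangular = {triangular a P b c |a b c P. a \<noteq> 0 \<and> b \<noteq> 0}"
  by (simp add: Triangular_def triangular_def)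

lemma eval_map_triangular [simp]:
  "eval_map (triangular a P b c) v = (a * fst v + poly P (snd v), b * snd v + c)"
  by (simp add: eval_map_def triangular_def)

lemma triangular_Aut2:
  assumes "a \<noteq> 0" "b \<noteq> 0" shows "triangular a P b c \<in> Aut2"
  by (rule Aut2I[of _ "triangular (1 / a) (smult (- 1 / a) (pcompose P [:- c / b, 1 / b:])) (1 /
      b) (- c / b)"])
     (use assms in \<open>auto simp: poly_pcompose field_simps\<close>)

lemma degree2_triangular:
  assumes "a \<noteq> 0" "b \<noteq> 0" shows "degree2 (triangular a P b c) = max 1 (degree P)"
proof (rule antisym)
  show "degree2 (triangular a P b c) \<le> max 1 (degree P)"
    by (auto simp: triangular_def degree2_def total_degree_le_iff le_max_iff_disj
        dest: le_degree split: if_splits)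
  have "coeff2 (fst (triangular a P b c)) 0 (degree P) = lead_coeff P"
    by (simp add: triangular_def)
  then have "degree P \<le> total_degree (fst (triangular a P b c))"
    using total_degree_coeff[of "fst (triangular a P b c)" 0 "degree P"] by (cases "P = 0") auto
  moreover have "1 \<le> total_degree (snd (triangular a P b c))"
    using total_degree_coeff[of "snd (triangular a P b c)" 0 1] assms by (simp add: triangular_def)
  ultimately show "max 1 (degree P) \<le> degree2 (triangular a P b c)"
    by (auto simp: degree2_def)
qed

lemma triangular_Affine:
  assumes "a \<noteq> 0" "b \<noteq> 0" shows "triangular a P b c \<in> Affine \<longleftrightarrow> degree P \<le> 1"
  using triangular_Aut2[OF assms] degree2_triangular[OF assms] by (simp add: Affine_def max_def)

definition swap2 :: "poly2 \<times> poly2" where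
  "swap2 = (varY, varX)"

lemma eval_map_swap2 [simp]: "eval_map swap2 v = (snd v, fst v)"
  by (simp add: eval_map_def swap2_def)

lemma swap2_Affine: "swap2 \<in> Affine"
proof (rule AffineI)
  show "swap2 \<in> Aut2" by (rule Aut2I[of _ swap2]) simp_all
qed (auto simp: degree2_def swap2_def total_degree_le_iff)

lemma swap2_not_Triangular: "swap2 \<notin> Triangular"
proof
  assume "swap2 \<in> Triangular"
  then obtain a b c P where "b \<noteq> 0" and eq: "swap2 = triangular a P b c"
    unfolding Triangular_eq by blast
  have "eval_map (triangular a P b c) (0, 1) = (1, 0)"
    "eval_map (triangular a P b c) (0, 0) = (0, 0)"
    unfolding eq[symmetric] by simp_all
  then show False using \<open>b \<noteq> 0\<close> by simp
qed

text \<open>Reducedness constrains only the affine letter between the two triangular ones, and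
  \<open>swap2\<close> is affine without being triangular.\<close>

lemma polydegree_two_I:
  assumes "\<alpha> \<in> Affine" "\<beta> \<in> Affine" "a \<noteq> 0" "b \<noteq> 0" "degree P \<ge> 2" "degree Q \<ge> 2"
  shows "comp2 \<alpha> (comp2 (triangular a P 1 0) (comp2 swap2 (comp2 (triangular b Q 1 0) \<beta>)))
    \<in> Aut2_polydegree [degree P, degree Q]"
  unfolding Aut2_polydegree_def mem_Collect_eq
proof (intro exI conjI)
  have "triangular c R 1 0 \<in> Triangular" if "c \<noteq> 0" for c R
    unfolding Triangular_eq mem_Collect_eq
    by (intro exI[of _ c] exI[of _ 1] exI[of _ 0] exI[of _ R]) (simp add: that)
  then show "reduced_word \<alpha> [(triangular a P 1 0, swap2), (triangular b Q 1 0, \<beta>)]"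
    using assms swap2_Affine swap2_not_Triangular
    by (auto simp: reduced_word_def triangular_Affine)
qed (use assms in \<open>simp_all add: degree2_triangular\<close>)

lemma polydegree_one_D:
  assumes "\<theta> \<in> Aut2_polydegree [N]" "N \<ge> 2"
  obtains \<alpha> \<beta> a b c P where "\<alpha> \<in> Affine" "\<beta> \<in> Affine" "a \<noteq> 0" "b \<noteq> 0" "degree P = N"
    "\<theta> = comp2 \<alpha> (comp2 (triangular a P b c) \<beta>)"
proof -
  obtain \<alpha> w where w: "reduced_word \<alpha> w" "word_prod \<alpha> w = \<theta>" "map (\<lambda>(\<tau>, _). degree2 \<tau>) w = [N]"
    using assms(1) by (auto simp: Aut2_polydegree_def)
  then obtain \<tau> \<beta> where w': "w = [(\<tau>, \<beta>)]" "degree2 \<tau> = N" by auto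
  have "\<tau> \<in> Triangular" and \<alpha>\<beta>: "\<alpha> \<in> Affine" "\<beta> \<in> Affine"
    using w(1) unfolding w' by (auto simp: reduced_word_def)
  then obtain a b c P where \<tau>: "a \<noteq> 0" "b \<noteq> 0" "\<tau> = triangular a P b c"
    unfolding Triangular_eq by blast
  have "degree P = N"
    using w'(2) assms(2) degree2_triangular[OF \<tau>(1,2)] unfolding \<tau>(3) by (simp add: max_def split:
        if_splits)
  then show ?thesis
    using that[OF \<alpha>\<beta> \<tau>(1,2), of P c] w(2) unfolding w' \<tau>(3) by simp
qed

text \<open>The affine change of \<open>Y\<close>, the scaling of \<open>X\<close> and the linear
  part of the polynomial are themselves affine maps and move into the outer letters. Removing the
  coefficients 0 and 1 is what later matches \<open>target\<close>, whose corrections to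
  \<open>t\<close> start in degree 2.\<close>

lemma polydegree_one_normal_form:
  assumes "\<theta> \<in> Aut2_polydegree [N]" "N \<ge> 2"
  obtains \<alpha> \<beta> P where "\<alpha> \<in> Affine" "\<beta> \<in> Affine" "degree P = N" "coeff P 0 = 0" "coeff P 1 = 0"
    "\<theta> = comp2 \<alpha> (comp2 (triangular 1 P 1 0) \<beta>)"
proof -
  obtain \<alpha> \<beta> a b c P where 1: "\<alpha> \<in> Affine" "\<beta> \<in> Affine" "a \<noteq> 0" "b \<noteq> 0" "degree P = N"
    "\<theta> = comp2 \<alpha> (comp2 (triangular a P b c) \<beta>)"
    using polydegree_one_D[OF assms] by metis
  define P1 where "P1 = pcompose P [:- c / b, 1 / b:]"
  define L where "L = [:coeff P1 0, coeff P1 1:]"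
  have "degree P1 = N" using 1 by (simp add: P1_def degree_pcompose)
  have "degree L \<le> 1" by (simp add: L_def)
  have deg: "degree (P1 - L) = N"
    using degree_add_eq_left[of "- L" P1] \<open>degree P1 = N\<close> \<open>degree L \<le> 1\<close> assms(2) by simp
  have "triangular 1 L 1 0 \<in> Affine" "triangular a 0 b c \<in> Affine"
    using \<open>degree L \<le> 1\<close> 1 by (simp_all add: triangular_Affine)
  then have aff: "comp2 \<alpha> (triangular 1 L 1 0) \<in> Affine" "comp2 (triangular a 0 b c) \<beta> \<in> Affine"
    using 1(1,2) by (auto intro: comp2_Affine)
  have P1: "poly P1 (c + b * y) = poly P y" for y
    using 1(4) by (simp add: P1_def poly_pcompose field_simps)
  have "\<theta> = comp2 (comp2 \<alpha> (triangular 1 L 1 0)) (comp2 (triangular 1 (P1 - L) 1 0)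
      (comp2 (triangular a 0 b c) \<beta>))"
    unfolding 1(6) by (rule eval_map_inject) (simp add: P1 add.commute)
  moreover have "coeff (P1 - L) 0 = 0" "coeff (P1 - L) 1 = 0"
    by (simp_all add: L_def)
  ultimately show ?thesis using that[OF aff deg] by blast
qed

section \<open>Limits of coefficients and the closure in the ind-variety\<close>

definition coeff_tendsto :: "(nat \<Rightarrow> poly2) \<Rightarrow> poly2 \<Rightarrow> bool" where
  "coeff_tendsto p q \<longleftrightarrow> (\<forall>i j. (\<lambda>k. coeff2 (p k) i j) \<longlonglongrightarrow> coeff2 q i j)"

lemma coeff_tendsto_const: "coeff_tendsto (\<lambda>k. q) q"
  by (simp add: coeff_tendsto_def)

lemma coeff_tendsto_sum:
  "(\<And>x. x \<in> A \<Longrightarrow> coeff_tendsto (\<lambda>k. p x k) (q x)) \<Longrightarrow>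
    coeff_tendsto (\<lambda>k. \<Sum>x\<in>A. p x k) (\<Sum>x\<in>A. q x)"
  by (auto simp: coeff_tendsto_def intro!: tendsto_sum)

lemma coeff_tendsto_mult:
  "coeff_tendsto p q \<Longrightarrow> coeff_tendsto p' q' \<Longrightarrow> coeff_tendsto (\<lambda>k. p k * p' k) (q * q')"
  by (auto simp: coeff_tendsto_def coeff2_mult intro!: tendsto_sum tendsto_mult)

lemma coeff_tendsto_power: "coeff_tendsto p q \<Longrightarrow> coeff_tendsto (\<lambda>k. p k ^ m) (q ^ m)"
  by (induction m) (auto intro: coeff_tendsto_const coeff_tendsto_mult)

lemma coeff_tendsto_total_degree:
  assumes "coeff_tendsto p q" "\<And>k. total_degree (p k) \<le> n" shows "total_degree q \<le> n"
  unfolding total_degree_le_iff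
proof (intro allI impI, rule ccontr)
  fix i j assume nz: "coeff2 q i j \<noteq> 0" and "\<not> i + j \<le> n"
  then have "coeff2 (p k) i j = 0" for k
    using assms(2)[of k] unfolding total_degree_le_iff by blast
  then have "(\<lambda>k. coeff2 (p k) i j) = (\<lambda>k. 0)" by (simp add: fun_eq_iff)
  moreover have "(\<lambda>k. coeff2 (p k) i j) \<longlonglongrightarrow> coeff2 q i j"
    using assms(1) unfolding coeff_tendsto_def by (elim allE)
  ultimately show False using nz by (simp add: LIMSEQ_const_iff)
qed

lemma coeff_tendsto_subst2:
  assumes "coeff_tendsto p q" "\<And>k. total_degree (p k) \<le> n"
    and "coeff_tendsto (\<lambda>k. fst (F k)) (fst G)" "coeff_tendsto (\<lambda>k. snd (F k)) (snd G)"
  shows "coeff_tendsto (\<lambda>k. subst2 (p k) (F k)) (subst2 q G)"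
proof -
  note q = coeff_tendsto_total_degree[OF assms(1,2)]
  have "coeff_tendsto (\<lambda>k. const2 (coeff2 (p k) i j)) (const2 (coeff2 q i j))" for i j
    using assms(1) by (simp add: coeff_tendsto_def)
  then have "coeff_tendsto (\<lambda>k. const2 (coeff2 (p k) i j) * fst (F k) ^ i * snd (F k) ^ j)
      (const2 (coeff2 q i j) * fst G ^ i * snd G ^ j)" for i j
    using coeff_tendsto_mult coeff_tendsto_power[OF assms(3)] coeff_tendsto_power[OF assms(4)] by blast
  then have "coeff_tendsto (\<lambda>k. \<Sum>j\<le>n. \<Sum>i\<le>n. const2 (coeff2 (p k) i j) * fst (F k) ^ i * snd (F k) ^ j)
      (\<Sum>j\<le>n. \<Sum>i\<le>n. const2 (coeff2 q i j) * fst G ^ i * snd G ^ j)"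
    by (intro coeff_tendsto_sum)
  then show ?thesis
    by (simp only: subst2_eq_sum[OF assms(2)] subst2_eq_sum[OF q])
qed

text \<open>The common degree bound keeps the whole sequence inside one \<open>Aut2_le m\<close>,
  where the topology is given by polynomial functions of finitely many coefficients.\<close>

definition Aut2_tendsto :: "(nat \<Rightarrow> poly2 \<times> poly2) \<Rightarrow> poly2 \<times> poly2 \<Rightarrow> bool" where
  "Aut2_tendsto F G \<longleftrightarrow> (\<exists>n. \<forall>k. degree2 (F k) \<le> n) \<and>
    coeff_tendsto (\<lambda>k. fst (F k)) (fst G) \<and> coeff_tendsto (\<lambda>k. snd (F k)) (snd G)"

lemma Aut2_tendsto_const: "Aut2_tendsto (\<lambda>k. F) F"
  by (auto simp: Aut2_tendsto_def coeff_tendsto_const)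

lemma Aut2_tendsto_comp2:
  assumes "Aut2_tendsto F G" "Aut2_tendsto F' G'"
  shows "Aut2_tendsto (\<lambda>k. comp2 (F k) (F' k)) (comp2 G G')"
proof -
  obtain n n' where n: "\<And>k. degree2 (F k) \<le> n" "\<And>k. degree2 (F' k) \<le> n'"
    using assms unfolding Aut2_tendsto_def by blast
  have deg: "total_degree (fst (F k)) \<le> n" "total_degree (snd (F k)) \<le> n" for k
    using n(1)[of k] by (simp_all add: degree2_def)
  have F: "coeff_tendsto (\<lambda>k. fst (F k)) (fst G)" "coeff_tendsto (\<lambda>k. snd (F k)) (snd G)"
    and F': "coeff_tendsto (\<lambda>k. fst (F' k)) (fst G')" "coeff_tendsto (\<lambda>k. snd (F' k)) (snd G')"
    using assms unfolding Aut2_tendsto_def by blast+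
  show ?thesis
    unfolding Aut2_tendsto_def
  proof (intro conjI exI allI)
    show "degree2 (comp2 (F k) (F' k)) \<le> n * n'" for k
      by (rule degree2_comp2[OF n])
    show "coeff_tendsto (\<lambda>k. fst (comp2 (F k) (F' k))) (fst (comp2 G G'))"
      using coeff_tendsto_subst2[OF F(1) deg(1) F'] by (simp add: comp2_def)
    show "coeff_tendsto (\<lambda>k. snd (comp2 (F k) (F' k))) (snd (comp2 G G'))"
      using coeff_tendsto_subst2[OF F(2) deg(2) F'] by (simp add: comp2_def)
  qed
qed

lemma regular_fun_tendsto:
  assumes "regular_fun n f" "Aut2_tendsto F G" shows "(\<lambda>k. f (F k)) \<longlonglongrightarrow> f G"
  using assms
  by (induction rule: regular_fun.induct)
     (auto simp: Aut2_tendsto_def coeff_tendsto_def intro: tendsto_add tendsto_mult)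

text \<open>Regular functions are continuous in the coefficients. A Zariski neighbourhood of
  \<open>G\<close> contains a set where some regular function is nonzero, and this function stays
  nonzero along the tail of the sequence.\<close>

lemma closure_of_Aut2I:
  assumes "G \<in> Aut2" "Aut2_tendsto F G" "\<And>k. F k \<in> S" "\<And>k. F k \<in> Aut2"
  shows "G \<in> Aut2_topology closure_of S"
  unfolding in_closure_of
proof (intro conjI allI impI)
  show "G \<in> topspace Aut2_topology" using assms(1) by simp
  fix T assume T: "G \<in> T \<and> openin Aut2_topology T"
  obtain n where n: "\<And>k. degree2 (F k) \<le> n" using assms(2) by (auto simp: Aut2_tendsto_def)
  define m where "m = max n (degree2 G)"
  have F: "F k \<in> Aut2_le m" for k using n[of k] assms(4) by (auto simp: Aut2_le_def m_def)
  have G: "G \<in> Aut2_le m" using assms(1) by (auto simp: Aut2_le_def m_def)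
  have "openin (subtopology (zariski m) (Aut2_le m)) (T \<inter> Aut2_le m)"
    using T openin_Aut2 by blast
  then obtain U where U: "openin (zariski m) U" "T \<inter> Aut2_le m = U \<inter> Aut2_le m"
    unfolding openin_subtopology by (elim exE conjE)
  then obtain S' where S': "S' \<subseteq> Collect (regular_fun m)" "U = poly_pairs m - zero_locus m S'"
    unfolding openin_zariski by (elim exE conjE)
  obtain f where f: "f \<in> S'" "f G \<noteq> 0"
  proof -
    have "G \<in> poly_pairs m - zero_locus m S'" 
      using G T U(2) unfolding S'(2)[symmetric] by blast
    then show ?thesis using that unfolding zero_locus_def by blast
  qed
  then have "(\<lambda>k. f (F k)) \<longlonglongrightarrow> f G"
    using regular_fun_tendsto assms(2) S'(1) by blast
  then have "eventually (\<lambda>k. f (F k) \<noteq> 0) sequentially"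
    using f(2) by (rule tendsto_imp_eventually_ne)
  then obtain k where "f (F k) \<noteq> 0" by (auto simp: eventually_sequentially)
  then have "F k \<in> U"
    using F[of k] Aut2_le_subset[of m] f(1) unfolding S'(2) zero_locus_def by auto
  then have "F k \<in> T" using U(2) F[of k] by blast
  then show "\<exists>y. y \<in> S \<and> y \<in> T" using assms(3) by blast
qed

section \<open>Degeneration of length two automorphisms\<close>

lemma pcompose_eq_sum: "pcompose p q = (\<Sum>j\<le>degree p. smult (coeff p j) (q ^ j))"
  for p q :: "complex poly"
  unfolding poly_eq_poly_eq_iff[symmetric] fun_eq_iff
  by (simp add: poly_pcompose poly_sum poly_altdef[of p])

lemma coeff2_varX_mult: "coeff2 (varX * p) i j = (if i = 0 then 0 else coeff2 p (i - 1) j)"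
  by (simp add: coeff2_def varX_def coeff_pCons split: nat.splits)

lemma coeff2_varX_power_mult: "coeff2 (varX ^ m * p) i j = (if i < m then 0 else coeff2 p (i - m) j)"
  by (induction m arbitrary: i) (auto simp: coeff2_varX_mult mult.assoc)

lemma coeff_power_tendsto:
  fixes q :: "complex poly"
  assumes "\<And>i. (\<lambda>k. coeff (p k) i) \<longlonglongrightarrow> coeff q i"
  shows "(\<lambda>k. coeff (p k ^ m) i) \<longlonglongrightarrow> coeff (q ^ m) i"
  using assms
  by (induction m arbitrary: i) (auto simp: coeff_mult intro!: tendsto_sum tendsto_mult)

text \<open>The condition \<open>low\<close> is an exact identity because the coefficient of
  \<open>Y^b\<close> in \<open>D(A(h Y))\<close> is divided by \<open>h \<delta> = g h^N\<close>,
  which would magnify any error for \<open>b < N\<close>. At \<open>b = N\<close> the powers of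
  \<open>h\<close> cancel, so a limit suffices. For \<open>b > N\<close> the factor
  \<open>h^(b - N)\<close> sends everything to 0, given that \<open>A\<close>, \<open>D\<close> and
  \<open>g\<close> converge and the limit of \<open>g\<close> is nonzero.\<close>

locale two_step_sequence =
  fixes d e N :: nat and P A0 D0 :: "complex poly" and g0 :: complex
    and h g :: "nat \<Rightarrow> complex" and A D :: "nat \<Rightarrow> complex poly"
  assumes deg: "d \<ge> 2" "e \<ge> 2" "N \<ge> 2" "\<And>k. degree (A k) = e" "\<And>k. degree (D k) = d"
    and A: "\<And>i. (\<lambda>k. coeff (A k) i) \<longlonglongrightarrow> coeff A0 i" "\<And>k. coeff (A k) 0 = 0" "coeff A0 1 = 1"
    and D: "\<And>i. (\<lambda>k. coeff (D k) i) \<longlonglongrightarrow> coeff D0 i" "coeff D0 1 = 1"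
    and h: "h \<longlonglongrightarrow> 0" "\<And>k. h k \<noteq> 0"
    and g: "g \<longlonglongrightarrow> g0" "g0 \<noteq> 0" "\<And>k. g k \<noteq> 0"
    and low: "\<And>k b. b < N \<Longrightarrow> coeff (pcompose (D k) (A k)) b =
      (if b = 1 then 1 else 0) + g k * coeff P b * h k ^ (N - b)"
    and top: "(\<lambda>k. coeff (pcompose (D k) (A k)) N / g k) \<longlonglongrightarrow> coeff P N"
    and P: "degree P = N"
begin

definition "step_scale k = g k * h k ^ (N - 1)"

definition "inner_poly k = smult (1 / h k) (pcompose (A k) [:0, h k:])"

definition "outer_poly k = smult (1 / (h k * step_scale k)) (pcompose (D k) [:0, h k:])"

definition "two_step k =
  comp2 (triangular (- 1 / step_scale k) (outer_poly k) 1 0) (comp2 swap2 (triangular (step_scale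
      k) (inner_poly k) 1 0))"

lemma step_scale_nz: "step_scale k \<noteq> 0"
  using h g by (simp add: step_scale_def)

lemma h_step_scale: "h k * step_scale k = g k * h k ^ N"
  using deg(3) by (simp add: step_scale_def power_eq_if)

lemma degree_inner_poly: "degree (inner_poly k) = e"
  using h deg by (simp add: inner_poly_def degree_pcompose)

lemma degree_outer_poly: "degree (outer_poly k) = d"
  using h deg step_scale_nz by (simp add: outer_poly_def degree_pcompose)

lemma snd_two_step: "snd (two_step k) = const2 (step_scale k) * varX + polyY (inner_poly k)"
  by (rule eval2_inject)
     (simp add: two_step_def comp2_def eval2_subst2 triangular_def swap2_def)

lemma fst_two_step: "fst (two_step k) = const2 (- 1 / step_scale k) * varY +
  (\<Sum>j\<le>d. \<Sum>i\<le>j. const2 (coeff (D k) j * of_nat (j choose i) * (h k * step_scale k) ^ i / (h k *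
      step_scale k)) *
    (varX ^ i * polyY (pcompose (A k ^ (j - i)) [:0, h k:])))"
proof (rule eval2_inject)
  fix v :: "complex \<times> complex"
  obtain x y where v: "v = (x, y)" by force
  have "h k * (step_scale k * x + poly (inner_poly k) y) = h k * step_scale k * x + poly (A k) (h k * y)"
    using h by (simp add: inner_poly_def poly_pcompose algebra_simps)
  then have "poly (outer_poly k) (step_scale k * x + poly (inner_poly k) y) =
      (\<Sum>j\<le>d. coeff (D k) j * (h k * step_scale k * x + poly (A k) (h k * y)) ^ j) / (h k * step_scale k)"
    by (simp add: outer_poly_def poly_pcompose poly_altdef[of "D k"] deg mult.commute)
  also have "\<dots> = (\<Sum>j\<le>d. \<Sum>i\<le>j. coeff (D k) j * of_nat (j choose i) * (h k * step_scale k) ^ i / (h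
      k * step_scale k) *
      (x ^ i * poly (A k) (h k * y) ^ (j - i)))"
    unfolding binomial_ring sum_distrib_left sum_divide_distrib
    by (intro sum.cong refl) (simp add: power_mult_distrib)
  finally show "eval2 (fst (two_step k)) v = eval2 (const2 (- 1 / step_scale k) * varY +
    (\<Sum>j\<le>d. \<Sum>i\<le>j. const2 (coeff (D k) j * of_nat (j choose i) * (h k * step_scale k) ^ i / (h k *
        step_scale k)) *
    (varX ^ i * polyY (pcompose (A k ^ (j - i)) [:0, h k:])))) v"
    by (simp add: two_step_def comp2_def eval2_subst2 triangular_def swap2_def v poly_pcompose
        mult.commute)
qed

lemma coeff2_fst_two_step:
  "coeff2 (fst (two_step k)) a b = (if a = 0 \<and> b = 1 then - 1 / step_scale k else 0) +
    (h k * step_scale k) ^ a / (h k * step_scale k) * h k ^ b *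
      (\<Sum>j\<le>d. coeff (D k) j * of_nat (j choose a) * coeff (A k ^ (j - a)) b)"
proof -
  have "(\<Sum>i\<le>j. (coeff (D k) j * of_nat (j choose i) * (h k * step_scale k) ^ i / (h k * step_scale k)) *
      coeff2 (varX ^ i * polyY (pcompose (A k ^ (j - i)) [:0, h k:])) a b) =
    (h k * step_scale k) ^ a / (h k * step_scale k) * h k ^ b *
      (coeff (D k) j * of_nat (j choose a) * coeff (A k ^ (j - a)) b)" (is "?l j = ?r j") for j
  proof -
    have "?l j = (\<Sum>i\<le>j. if i = a then ?r j else 0)"
      by (intro sum.cong refl) (auto simp: coeff2_varX_power_mult coeff_pcompose_linear)
    also have "\<dots> = ?r j" by (simp add: sum.delta)
    finally show ?thesis .
  qed
  then show ?thesis unfolding fst_two_step coeff2_simps sum_distrib_left by simp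
qed

lemma h_power_tendsto: "(\<lambda>k. h k ^ b) \<longlonglongrightarrow> (if b = 0 then 1 else 0)"
  using tendsto_power[OF h(1), of b] by (cases "b = 0") (auto simp: power_0_left)

lemma h_step_scale_tendsto: "(\<lambda>k. h k * step_scale k) \<longlonglongrightarrow> 0"
  unfolding h_step_scale using tendsto_mult[OF g(1) h_power_tendsto[of N]] deg by simp

lemma coeff_A_power_tendsto: "(\<lambda>k. coeff (A k ^ m) b) \<longlonglongrightarrow> coeff (A0 ^ m) b"
  by (rule coeff_power_tendsto[OF A(1)])

text \<open>For \<open>a = 0\<close> this is the division by \<open>g h^N\<close> described at the
  locale; the term \<open>- Y / \<delta>\<close> cancels the \<open>t\<close> of
  \<open>D(A(t))\<close>. For \<open>a > 0\<close> the factor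
  \<open>(h \<delta>)^(a - 1) h^b\<close> tends to 0 except at \<open>X\<close> itself, where the
  limit is the derivative of \<open>D0\<close> at \<open>A0(0) = 0\<close>, that is 1.\<close>

lemma coeff2_fst_two_step_tendsto:
  "(\<lambda>k. coeff2 (fst (two_step k)) a b) \<longlonglongrightarrow> (if a = 1 \<and> b = 0 then 1 else 0) +
    (if a = 0 then coeff P b else 0)"
proof (cases "a = 0")
  case True
  define q where "q k = coeff (pcompose (D k) (A k)) b" for k
  have q: "q k = (\<Sum>j\<le>d. coeff (D k) j * coeff (A k ^ j) b)" for k
    by (simp add: q_def pcompose_eq_sum coeff_sum deg)
  have eq: "coeff2 (fst (two_step k)) a b =
      (if b = 1 then - 1 / step_scale k else 0) + h k ^ b * q k / (h k * step_scale k)" for k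
    unfolding coeff2_fst_two_step q using True by simp
  consider "b < N" | "b = N" | "b > N" by linarith
  then show ?thesis
  proof cases
    case 1
    have "h k ^ b * h k ^ (N - b) = h k ^ N" for k
      using 1 by (simp flip: power_add)
    then have low': "h k ^ b * (g k * coeff P b * h k ^ (N - b)) = h k * step_scale k * coeff P b" for k
      unfolding h_step_scale by (simp add: mult.left_commute)
    then have "h k ^ b * q k / (h k * step_scale k) = h k ^ b * (if b = 1 then 1 else 0) / (h k *
        step_scale k) + coeff P b" for k
      using step_scale_nz[of k] h(2)[of k] unfolding q_def low[OF 1] distrib_left low'
          add_divide_distrib by simp
    then have "coeff2 (fst (two_step k)) a b = coeff P b" for k
      unfolding eq using h step_scale_nz by auto
    then show ?thesis using True by simp
  next
    case 2
    have "coeff2 (fst (two_step k)) a b = q k / g k" for k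
      unfolding eq h_step_scale using 2 deg h g by simp
    then show ?thesis using top True 2 by (simp add: q_def)
  next
    case 3
    have "coeff2 (fst (two_step k)) a b = h k ^ (b - N) * q k / g k" for k
    proof -
      have "h k ^ b = h k ^ (b - N) * h k ^ N" using 3 by (simp flip: power_add)
      then show ?thesis unfolding eq h_step_scale using 3 deg h g by simp
    qed
    moreover have "(\<lambda>k. h k ^ (b - N) * q k / g k) \<longlonglongrightarrow> 0 * (\<Sum>j\<le>d. coeff D0 j * coeff (A0 ^ j) b) / g0"
      unfolding q using h_power_tendsto[of "b - N"] 3
      by (intro tendsto_intros D coeff_A_power_tendsto g) auto
    ultimately show ?thesis using True 3 P by (simp add: coeff_eq_0)
  qed
next
  case False
  have "coeff2 (fst (two_step k)) a b = (h k * step_scale k) ^ (a - 1) * h k ^ b *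
      (\<Sum>j\<le>d. coeff (D k) j * of_nat (j choose a) * coeff (A k ^ (j - a)) b)" for k
    unfolding coeff2_fst_two_step using False step_scale_nz h by (simp add: power_eq_if)
  moreover have "(\<lambda>k. (h k * step_scale k) ^ (a - 1)) \<longlonglongrightarrow> (if a = 1 then 1 else 0)"
    using tendsto_power[OF h_step_scale_tendsto, of "a - 1"] False by (cases "a = 1") (auto simp:
        power_0_left)
  then have "(\<lambda>k. (h k * step_scale k) ^ (a - 1) * h k ^ b *
      (\<Sum>j\<le>d. coeff (D k) j * of_nat (j choose a) * coeff (A k ^ (j - a)) b)) \<longlonglongrightarrow>
    (if a = 1 then 1 else 0) * (if b = 0 then 1 else 0) *
      (\<Sum>j\<le>d. coeff D0 j * of_nat (j choose a) * coeff (A0 ^ (j - a)) b)" (is "_ \<longlonglongrightarrow> ?L")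
    by (intro tendsto_mult h_power_tendsto tendsto_sum D coeff_A_power_tendsto tendsto_const)
  moreover have "?L = (if a = 1 \<and> b = 0 then 1 else 0)"
  proof (cases "a = 1 \<and> b = 0")
    case True
    have "coeff A0 0 = 0" using A(1)[of 0] by (simp add: A(2) LIMSEQ_const_iff)
    then have "(\<Sum>j\<le>d. coeff D0 j * of_nat (j choose 1) * coeff (A0 ^ (j - 1)) 0) =
        (\<Sum>j\<le>d. if j = 1 then 1 else 0 :: complex)"
      using D(2) by (intro sum.cong refl) (auto simp: coeff_0_power power_0_left)
    then show ?thesis using True deg by simp
  qed auto
  ultimately show ?thesis using False by simp
qed

lemma two_step_tendsto: "Aut2_tendsto two_step (triangular 1 P 1 0)"
  unfolding Aut2_tendsto_def
proof (intro conjI exI allI)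
  fix k
  have swap: "degree2 swap2 \<le> 1" using swap2_Affine by (simp add: Affine_def)
  have inner: "degree2 (comp2 swap2 (triangular (step_scale k) (inner_poly k) 1 0)) \<le> 1 * e"
    using deg(2) by (intro degree2_comp2[OF swap]) (simp add: degree2_triangular degree_inner_poly
        step_scale_nz)
  show "degree2 (two_step k) \<le> d * (1 * e)"
    unfolding two_step_def using deg(1)
    by (intro degree2_comp2[OF _ inner]) (simp add: degree2_triangular degree_outer_poly step_scale_nz)
next
  show "coeff_tendsto (\<lambda>k. fst (two_step k)) (fst (triangular 1 P 1 0))"
    unfolding coeff_tendsto_def
    using coeff2_fst_two_step_tendsto by (simp add: triangular_def)
  have inner: "(\<lambda>k. coeff (inner_poly k) b) \<longlonglongrightarrow> (if b = 1 then 1 else 0)" for b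
  proof (cases "b = 0")
    case True
    then show ?thesis by (simp add: inner_poly_def poly_0_coeff_0 A(2))
  next
    case False
    have "coeff (inner_poly k) b = h k ^ (b - 1) * coeff (A k) b" for k
      using False h by (simp add: inner_poly_def coeff_pcompose_linear power_eq_if)
    moreover have "(\<lambda>k. h k ^ (b - 1) * coeff (A k) b) \<longlonglongrightarrow> (if b - 1 = 0 then 1 else 0) * coeff A0 b"
      by (intro tendsto_mult A h_power_tendsto)
    ultimately show ?thesis using False A(3) by (cases "b = 1") auto
  qed
  have scale: "step_scale \<longlonglongrightarrow> 0"
    using tendsto_mult[OF g(1) h_power_tendsto[of "N - 1"]] deg by (simp add: step_scale_def[abs_def])
  have "(\<lambda>k. coeff2 (snd (two_step k)) i j) \<longlonglongrightarrow> coeff2 (snd (triangular 1 P 1 0)) i j" for i j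
  proof (cases "i = 0")
    case True
    then show ?thesis using inner[of j] unfolding snd_two_step by (simp add: triangular_def)
  next
    case False
    then show ?thesis using scale unfolding snd_two_step by (simp add: triangular_def)
  qed
  then show "coeff_tendsto (\<lambda>k. snd (two_step k)) (snd (triangular 1 P 1 0))"
    unfolding coeff_tendsto_def by blast
qed

end

unbundle no vec_syntax
unbundle fps_syntax

section \<open>Lagrange inversion and norms of power series\<close>

text \<open>By Lagrange inversion this is \<open>j\<close> times the coefficient of \<open>(X B)\<^sup>j\<close> in the expansion of \<open>C\<close> in
  powers of \<open>X B\<close>.\<close>

definition lagrange_coeff :: "complex fps \<Rightarrow> nat \<Rightarrow> complex fps \<Rightarrow> complex" where
  "lagrange_coeff B j C = (fps_deriv C * inverse B ^ j) $ (j - 1)"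

lemma lagrange_coeff_linear:
  "lagrange_coeff B j (C - C') = lagrange_coeff B j C - lagrange_coeff B j C'"
  "lagrange_coeff B j (fps_const c * C) = c * lagrange_coeff B j C"
  "lagrange_coeff B j (sum f I) = (\<Sum>i\<in>I. lagrange_coeff B j (f i))"
  by (simp_all add: lagrange_coeff_def left_diff_distrib fps_deriv_sum sum_distrib_right
      fps_sum_nth mult.assoc)

lemma inverse_mult_cancel: "B $ 0 = 1 \<Longrightarrow> B * inverse B = 1" for B :: "complex fps"
  using inverse_mult_eq_1'[of B] by simp

text \<open>With \<open>Z = X B\<close> the left side is the residue of
  \<open>i Z^(i - 1 - j) Z'\<close>. For \<open>i < j\<close> this is a multiple of the derivative
  of \<open>Z^(i - j)\<close>, which has no residue; for \<open>i = j\<close> it is the logarithmic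
  derivative. The proof stays within power series by comparing with the derivative of
  \<open>W^k\<close>, where \<open>W\<close> is the inverse of \<open>B\<close> and
  \<open>k = j - i\<close>.\<close>

lemma lagrange_coeff_power:
  assumes B: "B $ 0 = 1" and "i \<ge> 1" "j \<ge> 1"
  shows "lagrange_coeff B j ((fps_X * B) ^ i) = (if i = j then of_nat j else 0)"
proof -
  define W where "W = inverse B"
  have BW: "B * W = 1" using inverse_mult_cancel[OF B] by (simp add: W_def)
  have W0: "W $ 0 = 1" using B by (simp add: W_def)
  have BWp: "B ^ k * W ^ k = 1" for k by (simp add: BW flip: power_mult_distrib)
  have *: "fps_deriv ((fps_X * B) ^ i) * W ^ j =
      fps_X ^ (i - 1) * (of_nat i * (B + fps_X * fps_deriv B) * (B ^ (i - 1) * W ^ j))"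
  proof -
    obtain i' where "i = Suc i'" using \<open>i \<ge> 1\<close> by (cases i) auto
    then show ?thesis unfolding fps_deriv_power'
      by (simp add: power_mult_distrib mult.assoc mult.left_commute del: of_nat_Suc)
  qed
  have lag: "lagrange_coeff B j ((fps_X * B) ^ i) =
      (if j < i then 0 else (of_nat i * (B + fps_X * fps_deriv B) * (B ^ (i - 1) * W ^ j)) $ (j - i))"
    unfolding lagrange_coeff_def W_def[symmetric] * fps_X_power_mult_nth using assms by auto
  consider "i > j" | "i = j" | "i < j" by linarith
  then show ?thesis
  proof cases
    case 1
    then show ?thesis unfolding lag by simp
  next
    case 2
    then show ?thesis unfolding lag using assms W0 by (simp add: fps_mult_nth_0 fps_power_zeroth)
  next
    case 3
    define k where "k = j - i"
    have k: "k \<ge> 1" "j = i - 1 + (k + 1)" using 3 assms by (auto simp: k_def)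
    have "B ^ (i - 1) * W ^ j = W ^ (k + 1)"
      unfolding k(2) power_add using BWp[of "i - 1"] by (simp add: mult.assoc[symmetric])
    then have "(B + fps_X * fps_deriv B) * (B ^ (i - 1) * W ^ j) =
        (B * W) * W ^ k + fps_X * (fps_deriv B * W ^ (k + 1))"
      by (simp only: distrib_right mult.assoc power_add power_one_right mult.commute[of "W ^ k" W])
    then have split: "((B + fps_X * fps_deriv B) * (B ^ (i - 1) * W ^ j)) $ k =
        (W ^ k) $ k + (fps_deriv B * W ^ (k + 1)) $ (k - 1)"
      using k(1) unfolding BW by simp
    have "fps_deriv (W ^ k) = - (of_nat k * (fps_deriv B * (W ^ 2 * W ^ (k - 1))))"
      unfolding fps_deriv_power' using B by (simp add: W_def fps_inverse_deriv mult.assoc)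
    moreover have "W ^ 2 * W ^ (k - 1) = W ^ (k + 1)"
      unfolding power_add[symmetric] using k(1) by (intro arg_cong[of _ _ "\<lambda>n. W ^ n"]) simp
    ultimately have "fps_deriv (W ^ k) = - (of_nat k * (fps_deriv B * W ^ (k + 1)))"
      by (simp only:)
    then have "fps_deriv (W ^ k) $ (k - 1) = - (of_nat k * (fps_deriv B * W ^ (k + 1)) $ (k - 1))"
      by (simp only: fps_neg_nth fps_mult_of_nat_nth)
    then have "of_nat k * (fps_deriv B * W ^ (k + 1)) $ (k - 1) = - (of_nat k * (W ^ k) $ k)"
      using k(1) by simp
    then have "of_nat k * ((W ^ k) $ k + (fps_deriv B * W ^ (k + 1)) $ (k - 1)) = 0"
      unfolding distrib_left by (simp only: add.right_inverse)
    then have "((B + fps_X * fps_deriv B) * (B ^ (i - 1) * W ^ j)) $ k = 0"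
      using k(1) unfolding split by (simp only: mult_eq_0_iff of_nat_eq_0_iff) linarith
    then show ?thesis unfolding lag k_def[symmetric] using 3
      by (simp add: mult.assoc)
  qed
qed

lemma lagrange_coeff_leading:
  assumes "B $ 0 = 1" "k \<ge> 1" "\<And>i. i < k \<Longrightarrow> G $ i = 0"
  shows "lagrange_coeff B k G = of_nat k * G $ k"
proof -
  have "lagrange_coeff B k G = (\<Sum>i=0..k - 1. of_nat (i + 1) * G $ (i + 1) * (inverse B ^ k) $ (k -
      1 - i))"
    by (simp add: lagrange_coeff_def fps_mult_nth)
  also have "\<dots> = (\<Sum>i=0..k - 1. if i = k - 1 then of_nat k * G $ k else 0)"
    using assms by (intro sum.cong refl) (auto simp: fps_power_zeroth less_diff_conv)
  also have "\<dots> = of_nat k * G $ k" by simp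
  finally show ?thesis .
qed

text \<open>\<open>E\<close> is the expansion of \<open>C\<close> in powers of \<open>X B\<close>,
  cut off after \<open>d\<close>. As the next terms vanish, the first omitted one is number
  \<open>N\<close>, and by \<open>lagrange_coeff_leading\<close> the lowest coefficient of
  \<open>C - E\<close> can be read off from it. For polynomial \<open>B\<close>, \<open>E\<close> is
  \<open>D(A(t))\<close> with \<open>A = t B\<close>.\<close>

lemma lagrange_expansion:
  assumes B: "B $ 0 = 1" and C: "C $ 0 = 0" and "d < N"
    and zero: "\<And>j. d < j \<Longrightarrow> j < N \<Longrightarrow> lagrange_coeff B j C = 0"
  defines "E \<equiv> \<Sum>j=1..d. fps_const (lagrange_coeff B j C / of_nat j) * (fps_X * B) ^ j"
  shows "\<And>k. k < N \<Longrightarrow> E $ k = C $ k"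
    and "E $ N = C $ N - lagrange_coeff B N C / of_nat N"
proof -
  have lagE: "lagrange_coeff B j E = (if j \<le> d then lagrange_coeff B j C else 0)" if "j \<ge> 1" for j
  proof -
    have "lagrange_coeff B j E = (\<Sum>i=1..d. if i = j then lagrange_coeff B j C else 0)"
      unfolding E_def lagrange_coeff_linear using that
      by (intro sum.cong refl) (auto simp: lagrange_coeff_power[OF B])
    then show ?thesis using that by simp
  qed
  have *: "(C - E) $ k = 0" if "k < N" for k
    using that
  proof (induction k rule: less_induct)
    case (less k)
    show ?case
    proof (cases "k = 0")
      case True
      then show ?thesis by (simp add: C E_def fps_sum_nth fps_power_zeroth power_0_left)
    next
      case False
      then have "lagrange_coeff B k (C - E) = of_nat k * (C - E) $ k"
        using less by (intro lagrange_coeff_leading[OF B]) auto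
      moreover have "lagrange_coeff B k (C - E) = 0"
        using less(2) lagE[of k] zero[of k] False by (auto simp: lagrange_coeff_linear)
      ultimately show ?thesis using False by simp
    qed
  qed
  then show "E $ k = C $ k" if "k < N" for k using that by fastforce
  have "lagrange_coeff B N (C - E) = of_nat N * (C - E) $ N"
    using * \<open>d < N\<close> by (intro lagrange_coeff_leading[OF B]) auto
  then have "lagrange_coeff B N C = of_nat N * (C $ N - E $ N)"
    using lagE[of N] \<open>d < N\<close> by (simp add: lagrange_coeff_linear)
  then show "E $ N = C $ N - lagrange_coeff B N C / of_nat N"
    using \<open>d < N\<close> by simp
qed

section \<open>The l1 norm modulo \<open>X^(K + 1)\<close> and estimates for negative powers\<close>

definition fps_norm :: "nat \<Rightarrow> complex fps \<Rightarrow> real" where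
  "fps_norm K f = (\<Sum>k\<le>K. norm (f $ k))"

lemma fps_norm_nonneg [simp]: "0 \<le> fps_norm K f"
  by (simp add: fps_norm_def sum_nonneg)

lemma norm_nth_le_fps_norm: "k \<le> K \<Longrightarrow> norm (f $ k) \<le> fps_norm K f"
  unfolding fps_norm_def by (rule member_le_sum) auto

lemma fps_norm_add: "fps_norm K (f + g) \<le> fps_norm K f + fps_norm K g"
  unfolding fps_norm_def by (simp flip: sum.distrib) (intro sum_mono norm_triangle_ineq)

lemma fps_norm_minus [simp]: "fps_norm K (- f) = fps_norm K f"
  by (simp add: fps_norm_def)

lemma fps_norm_diff: "fps_norm K (f - g) \<le> fps_norm K f + fps_norm K g"
  using fps_norm_add[of K f "- g"] by simp

lemma fps_norm_one [simp]: "fps_norm K 1 = 1"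
  by (simp add: fps_norm_def if_distrib cong: if_cong)

lemma fps_norm_sum: "fps_norm K (sum f I) \<le> (\<Sum>i\<in>I. fps_norm K (f i))"
proof (induction I rule: infinite_finite_induct)
  case (insert x F)
  then show ?case using fps_norm_add[of K "f x" "sum f F"] by simp
qed (simp_all add: fps_norm_def)

lemma fps_norm_const_X_power: "fps_norm K (fps_const c * fps_X ^ i) \<le> norm c"
proof -
  have "fps_norm K (fps_const c * fps_X ^ i) = (\<Sum>k\<le>K. if k = i then norm c else 0)"
    unfolding fps_norm_def by (intro sum.cong refl) (simp add: fps_X_power_nth)
  then show ?thesis by simp
qed

lemma fps_norm_mult: "fps_norm K (f * g) \<le> fps_norm K f * fps_norm K g"
proof -
  have "fps_norm K (f * g) \<le> (\<Sum>k\<le>K. \<Sum>i\<le>k. norm (f $ i) * norm (g $ (k - i)))"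
    unfolding fps_norm_def fps_mult_nth atLeast0AtMost
    by (intro sum_mono order_trans[OF norm_sum]) (simp add: norm_mult)
  also have "\<dots> = (\<Sum>(i, j)\<in>{(i, j). i + j \<le> K}. norm (f $ i) * norm (g $ j))"
    by (simp add: sum.triangle_reindex_eq)
  also have "\<dots> \<le> (\<Sum>(i, j)\<in>{..K} \<times> {..K}. norm (f $ i) * norm (g $ j))"
    by (intro sum_mono2) auto
  also have "\<dots> = fps_norm K f * fps_norm K g"
    by (simp add: fps_norm_def sum_product sum.cartesian_product)
  finally show ?thesis .
qed

lemma fps_norm_mult_le:
  "fps_norm K f \<le> a \<Longrightarrow> fps_norm K g \<le> b \<Longrightarrow> fps_norm K (f * g) \<le> a * b"
  by (rule order_trans[OF fps_norm_mult mult_mono]) (auto intro: order_trans[OF fps_norm_nonneg])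

lemma fps_norm_power_le: "fps_norm K f \<le> a \<Longrightarrow> fps_norm K (f ^ m) \<le> a ^ m"
  by (induction m) (auto intro: fps_norm_mult_le)

text \<open>Taking norms in \<open>B^-1 = 1 - (B - 1) B^-1\<close> bounds the norm of
  \<open>B^-1\<close> by 1 plus \<open>s\<close> times itself, which can be solved since truncated
  norms are finite.\<close>

lemma fps_norm_inverse_le:
  assumes "B $ 0 = 1" "fps_norm K (B - 1) \<le> s" "s < 1"
  shows "fps_norm K (inverse B) \<le> 1 / (1 - s)"
proof -
  have "inverse B = 1 - (B - 1) * inverse B"
    using inverse_mult_cancel[OF assms(1)] by (simp add: algebra_simps)
  then have "fps_norm K (inverse B) \<le> 1 + fps_norm K ((B - 1) * inverse B)"
    using fps_norm_diff[of K 1 "(B - 1) * inverse B"] by simp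
  also have "\<dots> \<le> 1 + s * fps_norm K (inverse B)"
    using fps_norm_mult_le[OF assms(2) order_refl] by simp
  finally show ?thesis using assms(3) by (simp add: field_simps)
qed

text \<open>The induction steps of the two estimates below, with \<open>V\<close>, \<open>W\<close>
  the inverses of \<open>U\<close>, \<open>B\<close>, with \<open>\<delta> = U - B\<close>,
  \<open>P = V^m\<close>, \<open>Q = W^m\<close> and \<open>c = m\<close>.\<close>

lemma power_diff_identity:
  fixes V W :: "'a :: comm_ring_1"
  assumes "V - W = - (\<delta> * V * W)"
  shows "V * P - W * Q = V * (P - Q) - \<delta> * (V * (W * Q))"
    and "V * P - W * Q + (1 + c) * \<delta> * (W * (W * Q)) =
      V * (P - Q + c * \<delta> * (W * Q)) + (1 + c) * (\<delta> ^ 2 * (V * (W * (W * Q))))"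
proof -
  have V: "(V - W) * Q + \<delta> * V * W * Q = 0" for Q
    unfolding assms by (simp add: algebra_simps)
  have "V * P - W * Q - (V * (P - Q) - \<delta> * (V * (W * Q))) = (V - W) * Q + \<delta> * V * W * Q"
    by (simp add: algebra_simps)
  then show "V * P - W * Q = V * (P - Q) - \<delta> * (V * (W * Q))"
    unfolding V by simp
  have "V * P - W * Q + (1 + c) * \<delta> * (W * (W * Q)) -
      (V * (P - Q + c * \<delta> * (W * Q)) + (1 + c) * (\<delta> ^ 2 * (V * (W * (W * Q))))) =
    ((V - W) * Q + \<delta> * V * W * Q) -
      ((V - W) * ((1 + c) * \<delta> * W * Q) + \<delta> * V * W * ((1 + c) * \<delta> * W * Q))"
    by (simp add: algebra_simps power2_eq_square)
  then show "V * P - W * Q + (1 + c) * \<delta> * (W * (W * Q)) =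
      V * (P - Q + c * \<delta> * (W * Q)) + (1 + c) * (\<delta> ^ 2 * (V * (W * (W * Q))))"
    unfolding V by simp
qed

context
  fixes B U :: "complex fps" and K :: nat and l x :: real
  assumes B: "B $ 0 = 1" and U: "U $ 0 = 1"
    and inv: "fps_norm K (inverse B) \<le> l" "fps_norm K (inverse U) \<le> l"
    and x: "fps_norm K (U - B) \<le> x"
begin


lemma inverse_diff: "inverse U - inverse B = - ((U - B) * inverse U * inverse B)"
  using inverse_mult_cancel[OF B] inverse_mult_cancel[OF U] by algebra

lemma fps_norm_inverse_power_diff:
  "fps_norm K (inverse U ^ m - inverse B ^ m) \<le> of_nat m * l ^ (m + 1) * x"
proof (induction m)
  case (Suc m)
  have "inverse U ^ Suc m - inverse B ^ Suc m =
      inverse U * (inverse U ^ m - inverse B ^ m) - (U - B) * (inverse U * inverse B ^ Suc m)"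
    using power_diff_identity(1)[OF inverse_diff] by simp
  also have "fps_norm K \<dots> \<le> l * (of_nat m * l ^ (m + 1) * x) + x * (l * l ^ Suc m)"
    by (intro order_trans[OF fps_norm_diff] add_mono fps_norm_mult_le fps_norm_power_le inv x Suc)
  finally show ?case by (simp add: algebra_simps)
qed (simp add: fps_norm_def)

text \<open>Taylor expansion of \<open>B^-m\<close> to first order. Each step of the induction adds
  one term quadratic in \<open>U - B\<close>, with weight \<open>m + 1\<close>; these weights sum to
  the second Taylor coefficient of \<open>z^-m\<close> at 1.\<close>

lemma fps_norm_inverse_power_taylor:
  "fps_norm K (inverse U ^ m - inverse B ^ m + of_nat m * (U - B) * inverse B ^ (m + 1)) \<le>
    of_nat (m * (m + 1)) / 2 * l ^ (m + 2) * x ^ 2"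
proof (induction m)
  case (Suc m)
  have "inverse U ^ Suc m - inverse B ^ Suc m + of_nat (Suc m) * (U - B) * inverse B ^ (Suc m + 1) =
      inverse U * (inverse U ^ m - inverse B ^ m + of_nat m * (U - B) * inverse B ^ (m + 1)) +
      of_nat (Suc m) * ((U - B) ^ 2 * (inverse U * inverse B ^ (m + 2)))"
    using power_diff_identity(2)[OF inverse_diff, of "inverse U ^ m" "inverse B ^ m" "of_nat m"]
    by (simp add: mult.assoc)
  also have "fps_norm K \<dots> \<le> l * (of_nat (m * (m + 1)) / 2 * l ^ (m + 2) * x ^ 2) +
      of_nat (Suc m) * (x ^ 2 * (l * l ^ (m + 2)))"
  proof -
    have "fps_norm K (of_nat (Suc m)) \<le> of_nat (Suc m)"
      using fps_norm_const_X_power[of K "of_nat (Suc m)" 0]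
      unfolding fps_of_nat norm_of_nat by simp
    then show ?thesis
      by (intro order_trans[OF fps_norm_add] add_mono fps_norm_mult_le fps_norm_power_le inv x Suc)
  qed
  also have "\<dots> = of_nat (Suc m * (Suc m + 1)) / 2 * l ^ (Suc m + 2) * x ^ 2"
    by (simp add: field_simps)
  finally show ?case .
qed (simp add: fps_norm_def)

end

text \<open>The residual of \<open>G\<close> in the differential equation satisfied by \<open>B\<^sup>-\<^sup>m\<close> controls the derivative of
  \<open>G B\<^sup>m\<close>, hence its distance from \<open>1\<close>.\<close>

lemma fps_norm_inverse_power_approx:
  assumes B: "B $ 0 = 1" "fps_norm K (B - 1) \<le> s" "s < 1" and "m \<ge> 1"
    and G: "G $ 0 = 1"
    and res: "\<And>k. 1 \<le> k \<Longrightarrow> k \<le> K \<Longrightarrow>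
      norm ((B * (fps_X * fps_deriv G) + of_nat m * (fps_X * fps_deriv B) * G) $ k) \<le> of_nat k * \<eta>"
    and "\<eta> \<ge> 0"
  shows "fps_norm K (G - inverse B ^ m) \<le> of_nat K * \<eta> * ((1 + s) / (1 - s)) ^ m"
proof -
  have s: "0 \<le> s" using fps_norm_nonneg B(2) by (rule order_trans)
  define \<rho> where "\<rho> = B * (fps_X * fps_deriv G) + of_nat m * (fps_X * fps_deriv B) * G"
  define E where "E = G * B ^ m"
  have ode: "fps_X * fps_deriv E = B ^ (m - 1) * \<rho>"
  proof -
    obtain m' where m': "m = Suc m'" using \<open>m \<ge> 1\<close> by (cases m) auto
    show ?thesis unfolding E_def \<rho>_def m' fps_deriv_mult fps_deriv_power'
      by (simp add: algebra_simps)
  qed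
  \<comment> \<open>The factor \<open>k\<close> from differentiation cancels the factor
    \<open>k\<close> allowed in \<open>res\<close>.\<close>
  have E: "of_nat k * E $ k = (B ^ (m - 1) * \<rho>) $ k" for k
    unfolding ode[symmetric] by (simp add: fps_mult_fps_X_deriv_shift)
  have normB: "fps_norm K (B ^ j) \<le> (1 + s) ^ j" for j
    using fps_norm_add[of K 1 "B - 1"] B(2) by (intro fps_norm_power_le) simp
  have \<rho>: "norm (\<rho> $ k) \<le> of_nat k * \<eta>" if "k \<le> K" for k
    using that res[of k] by (cases "k = 0") (auto simp: \<rho>_def)
  have "norm ((E - 1) $ k) \<le> (if k = 0 then 0 else \<eta> * (1 + s) ^ m)" if "k \<le> K" for k
  proof (cases "k = 0")
    case True
    then show ?thesis by (simp add: E_def G B fps_power_zeroth)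
  next
    case False
    have "of_nat k * norm (E $ k) = norm ((B ^ (m - 1) * \<rho>) $ k)"
      unfolding E[symmetric] by (simp add: norm_mult)
    also have "\<dots> \<le> (\<Sum>i\<le>k. norm ((B ^ (m - 1)) $ i) * norm (\<rho> $ (k - i)))"
      unfolding fps_mult_nth atLeast0AtMost by (rule order_trans[OF norm_sum]) (simp add: norm_mult)
    also have "\<dots> \<le> (\<Sum>i\<le>k. norm ((B ^ (m - 1)) $ i) * (of_nat k * \<eta>))"
      using that \<open>\<eta> \<ge> 0\<close>
      by (intro sum_mono mult_left_mono order_trans[OF \<rho>] mult_right_mono) auto
    also have "\<dots> = fps_norm k (B ^ (m - 1)) * (of_nat k * \<eta>)"
      by (simp add: fps_norm_def sum_distrib_right)
    also have "\<dots> \<le> (1 + s) ^ m * (of_nat k * \<eta>)"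
    proof (intro mult_right_mono)
      have "fps_norm k (B ^ (m - 1)) \<le> fps_norm K (B ^ (m - 1))"
        unfolding fps_norm_def using that by (intro sum_mono2) auto
      also have "\<dots> \<le> (1 + s) ^ (m - 1)" by (rule normB)
      also have "\<dots> \<le> (1 + s) ^ m" using s by (intro power_increasing) auto
      finally show "fps_norm k (B ^ (m - 1)) \<le> (1 + s) ^ m" .
    qed (use \<open>\<eta> \<ge> 0\<close> in simp)
    finally have "norm (E $ k) \<le> \<eta> * (1 + s) ^ m" using False by (simp add: mult_ac)
    then show ?thesis using False by simp
  qed
  then have "fps_norm K (E - 1) \<le> (\<Sum>k\<le>K. if k = 0 then 0 else \<eta> * (1 + s) ^ m)"
    unfolding fps_norm_def by (intro sum_mono) auto
  also have "\<dots> = of_nat K * (\<eta> * (1 + s) ^ m)"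
    by (simp add: sum.atMost_shift)
  finally have E1: "fps_norm K (E - 1) \<le> of_nat K * (\<eta> * (1 + s) ^ m)" .
  have "B ^ m * inverse B ^ m = 1"
    using inverse_mult_cancel[OF B(1)] by (simp flip: power_mult_distrib)
  then have "G - inverse B ^ m = (E - 1) * inverse B ^ m"
    by (simp add: E_def algebra_simps)
  then have "fps_norm K (G - inverse B ^ m) \<le> of_nat K * (\<eta> * (1 + s) ^ m) * (1 / (1 - s)) ^ m"
    using fps_norm_mult_le[OF E1 fps_norm_power_le[OF fps_norm_inverse_le[OF B]]] by simp
  then show ?thesis by (simp add: power_divide)
qed

section \<open>Solving the inversion equations\<close>

text \<open>The filter is arbitrary because the same rules serve for continuity of the Newton map on
  the polydisc and for limits of sequences.\<close>

definition fps_tendsto :: "('a \<Rightarrow> complex fps) \<Rightarrow> complex fps \<Rightarrow> 'a filter \<Rightarrow> bool" where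
  "fps_tendsto F G net \<longleftrightarrow> (\<forall>k. ((\<lambda>x. F x $ k) \<longlongrightarrow> G $ k) net)"

lemma fps_tendsto_nth: "fps_tendsto F G net \<Longrightarrow> ((\<lambda>x. F x $ k) \<longlongrightarrow> G $ k) net"
  by (simp add: fps_tendsto_def)

lemma fps_tendsto_const: "fps_tendsto (\<lambda>x. G) G net"
  by (simp add: fps_tendsto_def)

lemma fps_tendsto_fps_const: "(f \<longlongrightarrow> c) net \<Longrightarrow> fps_tendsto (\<lambda>x. fps_const (f x)) (fps_const c) net"
  by (simp add: fps_tendsto_def)

lemma fps_tendsto_add:
  "fps_tendsto F G net \<Longrightarrow> fps_tendsto F' G' net \<Longrightarrow> fps_tendsto (\<lambda>x. F x + F' x) (G + G') net"
  by (auto simp: fps_tendsto_def intro: tendsto_add)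

lemma fps_tendsto_sum:
  "(\<And>i. i \<in> I \<Longrightarrow> fps_tendsto (\<lambda>x. F i x) (G i) net) \<Longrightarrow>
    fps_tendsto (\<lambda>x. \<Sum>i\<in>I. F i x) (\<Sum>i\<in>I. G i) net"
  by (auto simp: fps_tendsto_def fps_sum_nth intro!: tendsto_sum)

lemma fps_tendsto_mult:
  "fps_tendsto F G net \<Longrightarrow> fps_tendsto F' G' net \<Longrightarrow> fps_tendsto (\<lambda>x. F x * F' x) (G * G') net"
  by (auto simp: fps_tendsto_def fps_mult_nth intro!: tendsto_sum tendsto_mult)

lemma fps_tendsto_power: "fps_tendsto F G net \<Longrightarrow> fps_tendsto (\<lambda>x. F x ^ m) (G ^ m) net"
  by (induction m) (auto intro: fps_tendsto_const fps_tendsto_mult)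

lemma fps_tendsto_deriv: "fps_tendsto F G net \<Longrightarrow> fps_tendsto (\<lambda>x. fps_deriv (F x)) (fps_deriv G) net"
  by (auto simp: fps_tendsto_def intro!: tendsto_mult)

lemma fps_tendsto_inverse:
  assumes "fps_tendsto F G net" "\<And>x. F x $ 0 = 1" "G $ 0 = 1"
  shows "fps_tendsto (\<lambda>x. inverse (F x)) (inverse G) net"
proof -
  have rec: "inverse H $ k = (if k = 0 then 1 else - (\<Sum>i=1..k. H $ i * inverse H $ (k - i)))"
    if "H $ 0 = 1" for H :: "complex fps" and k
  proof (cases "k = 0")
    case False
    have "0 = (H * inverse H) $ k" using inverse_mult_cancel[OF that] False by simp
    also have "\<dots> = inverse H $ k + (\<Sum>i=1..k. H $ i * inverse H $ (k - i))"
      by (simp add: fps_mult_nth sum.atLeast_Suc_atMost that)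
    finally show ?thesis using False by (simp add: eq_neg_iff_add_eq_0)
  qed (use that in simp)
  have "((\<lambda>x. inverse (F x) $ k) \<longlongrightarrow> inverse G $ k) net" for k
  proof (induction k rule: less_induct)
    case (less k)
    show ?case
      unfolding rec[of _ k, OF assms(2)] rec[of _ k, OF assms(3)]
      using less by (auto intro!: tendsto_minus tendsto_sum tendsto_mult fps_tendsto_nth[OF assms(1)])
  qed
  then show ?thesis by (simp add: fps_tendsto_def)
qed

lemma fps_tendsto_lagrange_coeff:
  assumes "fps_tendsto F G net" "\<And>x. F x $ 0 = 1" "G $ 0 = 1" "fps_tendsto C C' net"
  shows "((\<lambda>x. lagrange_coeff (F x) j (C x)) \<longlongrightarrow> lagrange_coeff G j C') net"
  unfolding lagrange_coeff_def
  by (intro fps_tendsto_nth fps_tendsto_mult fps_tendsto_deriv fps_tendsto_power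
      fps_tendsto_inverse assms)

text \<open>\<open>base\<close> is an approximate solution of the \<open>n\<close> equations
  \<open>[t\<^sup>j\<^sup>-\<^sup>1] B\<^sup>-\<^sup>j = 0\<close>, \<open>d < j < N\<close>; the coefficients \<open>1, \<dots>, n\<close> may be perturbed, and \<open>M\<close> is an
  approximate inverse of the Jacobian matrix.\<close>

locale approximate_solution =
  fixes \<iota> :: "'n :: finite \<Rightarrow> nat" and n d N :: nat and base :: "complex fps"
    and M :: "'n \<Rightarrow> 'n \<Rightarrow> complex" and r s l :: real
  assumes bij: "bij_betw \<iota> UNIV {1..n}"
    and N: "N = d + n + 1" and d: "d \<ge> 2" and n: "n \<ge> 1"
    and base: "base $ 0 = 1" and base_norm: "\<And>K. fps_norm K (base - 1) \<le> s"
    and r: "r > 0" and small: "s + of_nat n * r < 1" and l: "l = 1 / (1 - (s + of_nat n * r))"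
    and row: "\<And>i. (\<Sum>k\<in>UNIV. norm (M i k) * norm ((inverse base ^ (d + \<iota> k)) $ (d + \<iota> k - 1))) +
      r * (\<Sum>i'\<in>UNIV. norm ((if i = i' then 1 else 0) + (\<Sum>k\<in>UNIV. M i k *
        (of_nat (d + \<iota> k) * (fps_X ^ \<iota> i' * inverse base ^ (d + \<iota> k + 1)) $ (d + \<iota> k - 1))))) +
      (\<Sum>k\<in>UNIV. norm (M i k)) * (of_nat (N ^ 2) / 2 * l ^ (N + 1) * (of_nat n * r) ^ 2) < r"
    and nonzero: "\<And>m. m \<in> {d, N} \<Longrightarrow>
      norm ((inverse base ^ m) $ (m - 1)) > of_nat N * l ^ (N + 1) * (of_nat n * r)"
begin

section \<open>The Newton map on a polydisc around the approximate solution\<close>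

definition pert :: "complex ^ 'n \<Rightarrow> complex fps" where
  "pert x = (\<Sum>k\<in>UNIV. fps_const (vec_nth x k) * fps_X ^ \<iota> k)"

definition series :: "complex ^ 'n \<Rightarrow> complex fps" where
  "series x = base + pert x"

definition polydisc :: "(complex ^ 'n) set" where
  "polydisc = {x. \<forall>k. norm (vec_nth x k) \<le> r}"

lemma iota: "\<iota> k \<in> {1..n}"
  using bij by (auto simp: bij_betw_def)

lemma card_n: "card (UNIV :: 'n set) = n"
  using bij_betw_same_card[OF bij] by simp

lemma s_nonneg: "s \<ge> 0"
  using order_trans[OF fps_norm_nonneg base_norm[of 0]] .

lemma l_ge_1: "l \<ge> 1"
  unfolding l using s_nonneg r small by (simp add: field_simps)

lemma l_power_le: "m \<le> m' \<Longrightarrow> l ^ m \<le> l ^ m'"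
  using l_ge_1 by (rule power_increasing[rotated])

lemma pert_0: "pert x $ 0 = 0"
proof -
  have "(fps_X ^ \<iota> k :: complex fps) $ 0 = 0" for k
    using iota[of k] by (simp add: fps_X_power_nth)
  then show ?thesis by (simp add: pert_def fps_sum_nth)
qed

lemma series_0 [simp]: "series x $ 0 = 1"
  by (simp add: series_def base pert_0)

lemma fps_norm_pert: "x \<in> polydisc \<Longrightarrow> fps_norm K (pert x) \<le> of_nat n * r"
proof -
  assume x: "x \<in> polydisc"
  have "fps_norm K (pert x) \<le> (\<Sum>k\<in>UNIV. norm (vec_nth x k))"
    unfolding pert_def by (rule order_trans[OF fps_norm_sum sum_mono]) (rule fps_norm_const_X_power)
  also have "\<dots> \<le> (\<Sum>k::'n\<in>UNIV. r)" using x by (intro sum_mono) (simp add: polydisc_def)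
  finally show ?thesis by (simp add: card_n)
qed

lemma fps_norm_inverse_series: "x \<in> polydisc \<Longrightarrow> fps_norm K (inverse (series x)) \<le> l"
proof -
  assume x: "x \<in> polydisc"
  have "fps_norm K (series x - 1) \<le> s + of_nat n * r"
    using fps_norm_add[of K "base - 1" "pert x"] base_norm[of K] fps_norm_pert[OF x, of K]
    by (simp add: series_def algebra_simps)
  then show ?thesis unfolding l using small by (intro fps_norm_inverse_le) auto
qed

lemma fps_norm_inverse_base: "fps_norm K (inverse base) \<le> l"
  using fps_norm_inverse_series[of 0 K] r by (simp add: polydisc_def series_def pert_def)

lemma series_tendsto:
  assumes "(f \<longlongrightarrow> x) net" shows "fps_tendsto (\<lambda>y. series (f y)) (series x) net"
  unfolding series_def pert_def
  by (intro fps_tendsto_add fps_tendsto_const fps_tendsto_sum fps_tendsto_mult fps_tendsto_fps_const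
      tendsto_vec_nth assms)

text \<open>The case \<open>m = d\<close> yields the leading coefficient of \<open>D\<close>, the
  case \<open>m = N\<close> the number \<open>lead\<close>. The hypothesis \<open>nonzero\<close>
  exceeds the largest possible variation of these coefficients over the polydisc.\<close>

lemma nonzero_polydisc:
  assumes "m \<in> {d, N}" "x \<in> polydisc"
  shows "(inverse (series x) ^ m) $ (m - 1) \<noteq> 0"
proof
  assume *: "(inverse (series x) ^ m) $ (m - 1) = 0"
  have "norm ((inverse base ^ m) $ (m - 1)) = norm ((inverse (series x) ^ m - inverse base ^ m) $
      (m - 1))"
    unfolding fps_sub_nth * by simp
  also have "\<dots> \<le> fps_norm (m - 1) (inverse (series x) ^ m - inverse base ^ m)"
    by (rule norm_nth_le_fps_norm) simp
  also have "\<dots> \<le> of_nat m * l ^ (m + 1) * (of_nat n * r)"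
    using fps_norm_pert[OF assms(2)]
    by (intro fps_norm_inverse_power_diff base series_0 fps_norm_inverse_base
        fps_norm_inverse_series[OF assms(2)]) (simp add: series_def)
  also have "\<dots> \<le> of_nat N * l ^ (N + 1) * (of_nat n * r)"
    using assms(1) N r l_ge_1 by (intro mult_right_mono mult_mono l_power_le) auto
  finally show False using nonzero[OF assms(1)] by simp
qed

text \<open>The three summands of \<open>row\<close> bound the value at \<open>base\<close>, the
  linear part and the quadratic remainder of the Newton map. Passing to one \<open>q < r\<close> for
  all rows leaves the margin \<open>r - q\<close> for the terms in \<open>h\<close>.\<close>

lemma newton_row:
  obtains q where "q < r"
    "\<And>x i. x \<in> polydisc \<Longrightarrow>
      norm (vec_nth x i - (\<Sum>k\<in>UNIV. M i k * (inverse (series x) ^ (d + \<iota> k)) $ (d + \<iota> k - 1))) \<le> q"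
proof -
  \<comment> \<open>The derivative of \<open>B^-j\<close> is \<open>-j B^-(j+1)\<close>, so the
    Jacobian is \<open>-J\<close>. This is why \<open>M\<close> is an approximate inverse when
    \<open>1 + M J\<close>, not \<open>1 - M J\<close>, is small.\<close>
  define J where "J k i' = of_nat (d + \<iota> k) * (fps_X ^ \<iota> i' * inverse base ^ (d + \<iota> k + 1)) $ (d +
      \<iota> k - 1)" for k i'
  define F where "F k = (inverse base ^ (d + \<iota> k)) $ (d + \<iota> k - 1)" for k
  define c where "c = of_nat (N ^ 2) / 2 * l ^ (N + 1) * (of_nat n * r) ^ 2"
  define b where "b i = (\<Sum>k\<in>UNIV. norm (M i k) * norm (F k)) +
      r * (\<Sum>i'\<in>UNIV. norm ((if i = i' then 1 else 0) + (\<Sum>k\<in>UNIV. M i k * J k i'))) +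
      (\<Sum>k\<in>UNIV. norm (M i k)) * c" for i
  have bound: "norm (vec_nth x i - (\<Sum>k\<in>UNIV. M i k * (inverse (series x) ^ (d + \<iota> k)) $ (d + \<iota> k -
      1))) \<le> b i"
    (is "norm ?V \<le> _")
    if x: "x \<in> polydisc" for x i
  proof -
    define R where "R k = (inverse (series x) ^ (d + \<iota> k)) $ (d + \<iota> k - 1) - F k +
      (\<Sum>i'\<in>UNIV. vec_nth x i' * J k i')" for k
    have R: "norm (R k) \<le> c" for k
    proof -
      define j where "j = d + \<iota> k"
      have j: "j + 1 \<le> N" "j \<ge> 1" using iota[of k] d by (auto simp: N j_def)
      have eq: "R k = (inverse (series x) ^ j - inverse base ^ j +
          of_nat j * (series x - base) * inverse base ^ (j + 1)) $ (j - 1)"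
      proof -
        have "((series x - base) * inverse base ^ (j + 1)) $ (j - 1) =
            (\<Sum>i'\<in>UNIV. vec_nth x i' * (fps_X ^ \<iota> i' * inverse base ^ (j + 1)) $ (j - 1))"
          by (simp add: series_def pert_def sum_distrib_right fps_sum_nth mult.assoc del: power_Suc)
        then show ?thesis
          unfolding R_def F_def J_def j_def[symmetric] fps_add_nth fps_sub_nth mult.assoc
              fps_mult_of_nat_nth
          by (simp add: sum_distrib_left mult.left_commute)
      qed
      have "norm (R k) \<le> fps_norm (j - 1) (inverse (series x) ^ j - inverse base ^ j +
          of_nat j * (series x - base) * inverse base ^ (j + 1))"
        unfolding eq by (rule norm_nth_le_fps_norm) simp
      also have "\<dots> \<le> of_nat (j * (j + 1)) / 2 * l ^ (j + 2) * (of_nat n * r) ^ 2"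
        using fps_norm_pert[OF x]
        by (intro fps_norm_inverse_power_taylor base series_0 fps_norm_inverse_base
            fps_norm_inverse_series[OF x]) (simp add: series_def)
      also have "\<dots> \<le> c"
      proof -
        have "j * (j + 1) \<le> N ^ 2" 
          unfolding power2_eq_square using j by (intro mult_mono) auto
        then have "real (j * (j + 1)) \<le> real (N ^ 2)" by (rule of_nat_mono)
        then show ?thesis
          unfolding c_def using r l_ge_1 j by (intro mult_right_mono mult_mono l_power_le) auto
      qed
      finally show ?thesis .
    qed
    have tri: "norm (a - b - c) \<le> norm a + norm b + norm c" for a b c :: complex
      using norm_triangle_ineq4[of "a - b" c] norm_triangle_ineq4[of a b] by linarith
    have "?V =
        vec_nth x i - (\<Sum>k\<in>UNIV. M i k * (F k + R k - (\<Sum>i'\<in>UNIV. vec_nth x i' * J k i')))"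
      by (simp add: R_def)
    also have "\<dots> = (\<Sum>i'\<in>UNIV. vec_nth x i' * ((if i = i' then 1 else 0) + (\<Sum>k\<in>UNIV. M i k * J k i')))
        - (\<Sum>k\<in>UNIV. M i k * F k) - (\<Sum>k\<in>UNIV. M i k * R k)"
    proof -
      have "(\<Sum>k\<in>UNIV. \<Sum>i'\<in>UNIV. M i k * (vec_nth x i' * J k i')) =
          (\<Sum>i'\<in>UNIV. vec_nth x i' * (\<Sum>k\<in>UNIV. M i k * J k i'))"
        by (subst sum.swap) (simp add: sum_distrib_left mult.left_commute)
      moreover have "(\<Sum>i'\<in>UNIV. vec_nth x i' * (if i = i' then 1 else 0)) = vec_nth x i"
      proof -
        have "vec_nth x i' * (if i = i' then 1 else 0) = (if i = i' then vec_nth x i' else 0)" for i'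
          by simp
        then show ?thesis by simp
      qed
      ultimately show ?thesis
        unfolding distrib_left right_diff_distrib sum.distrib sum_subtractf
        by (simp add: sum_distrib_left)
    qed
    finally have eq: "?V = (\<Sum>i'\<in>UNIV. vec_nth x i' * ((if i = i' then 1 else 0) + (\<Sum>k\<in>UNIV. M i k
        * J k i')))
        - (\<Sum>k\<in>UNIV. M i k * F k) - (\<Sum>k\<in>UNIV. M i k * R k)" .

    have "norm ?V \<le> norm (\<Sum>i'\<in>UNIV. vec_nth x i' * ((if i = i' then 1 else 0) + (\<Sum>k\<in>UNIV. M i k *
        J k i'))) +
        norm (\<Sum>k\<in>UNIV. M i k * F k) + norm (\<Sum>k\<in>UNIV. M i k * R k)"
      unfolding eq by (rule tri)
    also have "\<dots> \<le> (\<Sum>i'\<in>UNIV. r * norm ((if i = i' then 1 else 0) + (\<Sum>k\<in>UNIV. M i k * J k i'))) +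
        (\<Sum>k\<in>UNIV. norm (M i k) * norm (F k)) + (\<Sum>k\<in>UNIV. norm (M i k) * c)"
    proof (intro add_mono)
      show "norm (\<Sum>i'\<in>UNIV. vec_nth x i' * ((if i = i' then 1 else 0) + (\<Sum>k\<in>UNIV. M i k * J k i'))) \<le>
          (\<Sum>i'\<in>UNIV. r * norm ((if i = i' then 1 else 0) + (\<Sum>k\<in>UNIV. M i k * J k i')))"
        using x unfolding polydisc_def
        by (intro sum_norm_le) (simp only: norm_mult, simp add: mult_right_mono)
      show "norm (\<Sum>k\<in>UNIV. M i k * F k) \<le> (\<Sum>k\<in>UNIV. norm (M i k) * norm (F k))"
        by (intro sum_norm_le) (simp add: norm_mult)
      show "norm (\<Sum>k\<in>UNIV. M i k * R k) \<le> (\<Sum>k\<in>UNIV. norm (M i k) * c)"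
        by (intro sum_norm_le) (simp add: norm_mult mult_left_mono R)
    qed
    also have "\<dots> = b i"
      by (simp add: b_def sum_distrib_left sum_distrib_right)
    finally show ?thesis .
  qed
  have "Max (range b) < r"
    using row unfolding b_def F_def J_def c_def by (subst Max_less_iff) auto
  moreover have "b i \<le> Max (range b)" for i by (rule Max_ge) auto
  ultimately show ?thesis using that bound order_trans by blast
qed

text \<open>A fixed point of the Newton map only says that \<open>M\<close> kills the vector of
  equations. By \<open>row\<close> the row sums of \<open>1 + M J\<close> are below 1, so a vector
  killed by \<open>M J\<close> has largest entry 0. Hence \<open>M J\<close>, and with it the square
  matrix \<open>M\<close>, is invertible.\<close>

lemma M_injective:
  assumes "\<And>i. (\<Sum>k\<in>UNIV. M i k * y k) = 0" shows "y k = 0"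
proof -
  define J where "J k i' = of_nat (d + \<iota> k) * (fps_X ^ \<iota> i' * inverse base ^ (d + \<iota> k + 1)) $ (d +
      \<iota> k - 1)" for k i'
  define A :: "complex ^ 'n ^ 'n" where "A = vec_lambda (\<lambda>i. vec_lambda (M i))"
  define A' :: "complex ^ 'n ^ 'n" where "A' = vec_lambda (\<lambda>k. vec_lambda (J k))"
  have rows: "(\<Sum>i'\<in>UNIV. norm ((if i = i' then 1 else 0) + (\<Sum>k\<in>UNIV. M i k * J k i'))) < 1" (is
      "?s i < 1") for i
  proof -
    have "0 \<le> (\<Sum>k\<in>UNIV. norm (M i k) * norm ((inverse base ^ (d + \<iota> k)) $ (d + \<iota> k - 1)))"
      "0 \<le> (\<Sum>k\<in>UNIV. norm (M i k)) * (of_nat (N ^ 2) / 2 * l ^ (N + 1) * (of_nat n * r) ^ 2)"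
      using l_ge_1 r by (auto intro!: sum_nonneg mult_nonneg_nonneg)
    then have "r * ?s i < r * 1" using row[of i] unfolding J_def by linarith
    then show ?thesis using r by (simp only: mult_less_cancel_left_pos)
  qed
  have AA: "vec_nth ((A ** A') *v v) i = (\<Sum>i'\<in>UNIV. (\<Sum>k\<in>UNIV. M i k * J k i') * vec_nth v i')" for v i
    by (simp add: A_def A'_def matrix_matrix_mult_def matrix_vector_mult_def)
  have "inj ((*v) (A ** A'))"
  proof (rule injI)
    fix v w :: "complex ^ 'n" assume eq: "(A ** A') *v v = (A ** A') *v w"
    define z where "z = v - w"
    have "(A ** A') *v z = 0" using eq by (simp add: z_def matrix_vector_mult_diff_distrib)
    define m where "m = Max (range (\<lambda>i. norm (vec_nth z i)))"
    have m: "norm (vec_nth z i) \<le> m" for i unfolding m_def by (rule Max_ge) auto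
    have "m \<in> range (\<lambda>i. norm (vec_nth z i))" unfolding m_def by (rule Max_in) auto
    then obtain i where i: "m = norm (vec_nth z i)" by blast
    have "vec_nth z i = (\<Sum>i'\<in>UNIV. ((if i = i' then 1 else 0) + (\<Sum>k\<in>UNIV. M i k * J k i')) *
        vec_nth z i')"
      using AA[of z i] \<open>(A ** A') *v z = 0\<close>
      by (simp add: distrib_right sum.distrib if_distrib[of "\<lambda>x. x * _"] cong: if_cong)
    then have "m \<le> (\<Sum>i'\<in>UNIV. norm ((if i = i' then 1 else 0) + (\<Sum>k\<in>UNIV. M i k * J k i')) * m)"
      unfolding i by (metis (no_types, lifting) i m mult_left_mono norm_ge_zero norm_mult sum_norm_le)
    then have "m * 1 \<le> m * ?s i" by (simp only: sum_distrib_left mult.commute[of m] mult_1_left)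
    moreover have "m \<ge> 0" unfolding i by simp
    ultimately have "m = 0"
      using rows[of i] mult_le_cancel_left_pos[of m 1 "?s i"] by linarith
    then have "z = 0" using m by (simp add: vec_eq_iff)
    then show "v = w" by (simp add: z_def)
  qed
  then obtain Q where "Q ** (A ** A') = mat 1"
    using matrix_left_invertible_injective by blast
  then have "(A ** A') ** Q = mat 1" by (simp add: matrix_left_right_inverse)
  then have "(A' ** Q) ** A = mat 1"
    unfolding matrix_mul_assoc[symmetric, of A A' Q] by (simp only: matrix_left_right_inverse[of A])
  moreover have "A *v vec_lambda y = 0"
    using assms by (simp add: A_def matrix_vector_mult_def vec_eq_iff)
  ultimately have "vec_lambda y = (0 :: complex ^ 'n)"
    by (metis matrix_vector_mul_assoc matrix_vector_mul_lid matrix_vector_mult_0_right)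
  then show ?thesis by (simp add: vec_eq_iff)
qed

text \<open>The coefficient at \<open>t^N\<close> that \<open>lagrange_expansion\<close> gives for
  \<open>C = X\<close>: minus the first omitted term of the expansion of \<open>t\<close> in powers
  of \<open>t B\<close>.\<close>

definition lead :: "complex ^ 'n \<Rightarrow> complex" where
  "lead x = - ((inverse (series x) ^ N) $ (N - 1)) / of_nat N"

text \<open>The series that \<open>D(A(t))\<close> has to match below \<open>t\<^sup>N\<close>. Its coefficient at \<open>t\<^sup>N\<close> is \<open>0\<close>, so that the
  coefficient of \<open>D(A(t))\<close> there tends to \<open>lead\<close> as \<open>h\<close> tends to \<open>0\<close>.\<close>

definition target :: "(nat \<Rightarrow> complex) \<Rightarrow> complex \<Rightarrow> complex ^ 'n \<Rightarrow> complex fps" where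
  "target \<rho> h x = fps_X + (\<Sum>k\<in>{2..<N}. fps_const (lead x * \<rho> k * h ^ (N - k)) * fps_X ^ k)"

lemma lead_tendsto: "(f \<longlongrightarrow> x) net \<Longrightarrow> ((\<lambda>y. lead (f y)) \<longlongrightarrow> lead x) net"
  unfolding lead_def
  by (intro tendsto_divide tendsto_minus tendsto_const fps_tendsto_nth fps_tendsto_power
      fps_tendsto_inverse series_tendsto series_0) (use N in \<open>simp_all only: of_nat_eq_0_iff\<close>)

lemma target_tendsto:
  assumes "(f \<longlongrightarrow> x) net" "(h \<longlongrightarrow> h0) net"
  shows "fps_tendsto (\<lambda>y. target \<rho> (h y) (f y)) (target \<rho> h0 x) net"
  unfolding target_def
  by (intro fps_tendsto_add fps_tendsto_const fps_tendsto_sum fps_tendsto_mult fps_tendsto_fps_const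
      tendsto_mult tendsto_const tendsto_power lead_tendsto assms)

lemma lagrange_target_tendsto:
  assumes "(f \<longlongrightarrow> x) net" "(h \<longlongrightarrow> h0) net"
  shows "((\<lambda>y. lagrange_coeff (series (f y)) j (target \<rho> (h y) (f y))) \<longlongrightarrow>
    lagrange_coeff (series x) j (target \<rho> h0 x)) net"
  by (intro fps_tendsto_lagrange_coeff series_tendsto target_tendsto series_0 assms)

lemma target_zero: "target \<rho> 0 x = fps_X"
  by (simp add: target_def power_0_left)

lemma lagrange_coeff_X: "lagrange_coeff B j fps_X = (inverse B ^ j) $ (j - 1)"
  by (simp add: lagrange_coeff_def)

text \<open>Every correction in \<open>target\<close> carries \<open>h^(N - k)\<close> with
  \<open>k < N\<close>, hence at least one factor \<open>h\<close>; the other factors are bounded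
  uniformly on the polydisc by powers of \<open>l\<close>.\<close>

lemma lagrange_target_bound:
  obtains c where "\<And>h x j. x \<in> polydisc \<Longrightarrow> norm h \<le> 1 \<Longrightarrow> 1 \<le> j \<Longrightarrow> j \<le> N \<Longrightarrow>
    norm (lagrange_coeff (series x) j (target \<rho> h x) - (inverse (series x) ^ j) $ (j - 1)) \<le> norm h * c"
proof -
  define c where "c = (\<Sum>k\<in>{2..<N}. l ^ N * norm (\<rho> k) * (of_nat k * l ^ N))"
  have "norm (lagrange_coeff (series x) j (target \<rho> h x) - (inverse (series x) ^ j) $ (j - 1)) \<le>
      norm h * c"
    if x: "x \<in> polydisc" and h: "norm h \<le> 1" and j: "1 \<le> j" "j \<le> N" for h x j
  proof -
    have W: "norm ((inverse (series x) ^ m) $ i) \<le> l ^ m" for m i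
      using norm_nth_le_fps_norm[of i i] fps_norm_power_le[OF fps_norm_inverse_series[OF x]] order_trans
      by blast
    have lead: "norm (lead x) \<le> l ^ N"
    proof -
      have "norm (lead x) \<le> norm ((inverse (series x) ^ N) $ (N - 1))"
        unfolding lead_def norm_divide norm_minus_cancel norm_of_nat
        using N divide_left_mono[of 1 "real N" "norm ((inverse (series x) ^ N) $ (N - 1))"] by simp
      then show ?thesis using W order_trans by blast
    qed
    have X: "norm (lagrange_coeff (series x) j (fps_X ^ k)) \<le> of_nat k * l ^ N" if "k \<ge> 1" for k
    proof -
      have "lagrange_coeff (series x) j (fps_X ^ k) =
          of_nat k * (fps_X ^ (k - 1) * inverse (series x) ^ j) $ (j - 1)"
        unfolding lagrange_coeff_def fps_deriv_power' by (simp add: mult.assoc)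
      also have "norm \<dots> \<le> of_nat k * l ^ j"
        unfolding norm_mult norm_of_nat fps_X_power_mult_nth
        using W l_ge_1 by (intro mult_left_mono) auto
      also have "\<dots> \<le> of_nat k * l ^ N" using j by (intro mult_left_mono l_power_le) auto
      finally show ?thesis .
    qed
    have "lagrange_coeff (series x) j (target \<rho> h x) - (inverse (series x) ^ j) $ (j - 1) =
        (\<Sum>k\<in>{2..<N}. lead x * \<rho> k * h ^ (N - k) * lagrange_coeff (series x) j (fps_X ^ k))"
    proof -
      have "target \<rho> h x - fps_X =
          (\<Sum>k\<in>{2..<N}. fps_const (lead x * \<rho> k * h ^ (N - k)) * fps_X ^ k)"
        by (simp add: target_def)
      then show ?thesis
        unfolding lagrange_coeff_X[symmetric] lagrange_coeff_linear(1)[symmetric]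
        by (simp only: lagrange_coeff_linear)
    qed
    also have "norm \<dots> \<le> (\<Sum>k\<in>{2..<N}. l ^ N * norm (\<rho> k) * norm h * (of_nat k * l ^ N))"
    proof (rule sum_norm_le)
      fix k assume k: "k \<in> {2..<N}"
      have "norm h ^ (N - k) \<le> norm h ^ 1" using k h by (intro power_decreasing) auto
      then show "norm (lead x * \<rho> k * h ^ (N - k) * lagrange_coeff (series x) j (fps_X ^ k)) \<le>
          l ^ N * norm (\<rho> k) * norm h * (of_nat k * l ^ N)"
        unfolding norm_mult norm_power using lead X[of k] k l_ge_1
        by (intro mult_mono mult_nonneg_nonneg) auto
    qed
    also have "\<dots> = norm h * c" by (simp add: c_def sum_distrib_left mult_ac)
    finally show ?thesis .
  qed
  then show ?thesis using that by blast
qed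

lemma polydisc_compact: "compact polydisc"
proof -
  have eq: "polydisc = (\<Inter>k. (\<lambda>x. vec_nth x k) -` cball 0 r)"
    by (auto simp: polydisc_def)
  have "closed polydisc"
    unfolding eq
    by (intro closed_INT ballI continuous_closed_vimage closed_cball linear_continuous_at
        bounded_linear_vec_nth)
  moreover have "bounded polydisc"
  proof (rule boundedI)
    fix x assume "x \<in> polydisc"
    then have "(\<Sum>k\<in>UNIV. norm (vec_nth x k)) \<le> (\<Sum>k::'n\<in>UNIV. r)"
      unfolding polydisc_def by (intro sum_mono) auto
    moreover have "norm x \<le> (\<Sum>k\<in>UNIV. norm (vec_nth x k))"
      unfolding norm_vec_def by (rule L2_set_le_sum) simp
    ultimately show "norm x \<le> (\<Sum>k::'n\<in>UNIV. r)" by simp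
  qed
  ultimately show ?thesis by (simp add: compact_eq_bounded_closed)
qed

lemma polydisc_convex: "convex polydisc"
proof -
  have eq: "polydisc = (\<Inter>k. (\<lambda>x. vec_nth x k) -` cball 0 r)"
    by (auto simp: polydisc_def)
  show ?thesis
    unfolding eq by (intro convex_INT convex_linear_vimage convex_cball)
      (auto intro: bounded_linear.linear bounded_linear_vec_nth)
qed

text \<open>For small \<open>h\<close> the Newton map preserves the polydisc, so Brouwer's theorem applies.\<close>

lemma deformed_solution:
  obtains \<epsilon> where "\<epsilon> > 0" "\<And>h. norm h < \<epsilon> \<Longrightarrow> \<exists>x\<in>polydisc. \<forall>j. d < j \<and> j < N \<longrightarrow>
    lagrange_coeff (series x) j (target \<rho> h x) = 0"
proof -
  obtain q where q: "q < r" "\<And>x i. x \<in> polydisc \<Longrightarrow>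
      norm (vec_nth x i - (\<Sum>k\<in>UNIV. M i k * (inverse (series x) ^ (d + \<iota> k)) $ (d + \<iota> k - 1))) \<le> q"
    using newton_row by blast
  obtain c where c: "\<And>h x j. x \<in> polydisc \<Longrightarrow> norm h \<le> 1 \<Longrightarrow> 1 \<le> j \<Longrightarrow> j \<le> N \<Longrightarrow>
    norm (lagrange_coeff (series x) j (target \<rho> h x) - (inverse (series x) ^ j) $ (j - 1)) \<le> norm h * c"
    using lagrange_target_bound by blast
  define m where "m = (\<Sum>i\<in>UNIV. \<Sum>k\<in>UNIV. norm (M i k))"
  have m: "(\<Sum>k\<in>UNIV. norm (M i k)) \<le> m" for i
    unfolding m_def by (rule member_le_sum) (auto intro: sum_nonneg)
  have "m \<ge> 0" by (simp add: m_def sum_nonneg)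
  \<comment> \<open>The minimum with 1 meets the condition on \<open>h\<close> in the bound
    \<open>c\<close>; the quotient makes the total change of a row at most the margin
    \<open>r - q\<close>. The absolute value and the \<open>+ 1\<close> keep the denominator
    positive.\<close>
  define \<epsilon> where "\<epsilon> = min 1 ((r - q) / (m * \<bar>c\<bar> + 1))"
  have "m * \<bar>c\<bar> + 1 > 0" using \<open>m \<ge> 0\<close> by (simp add: add_nonneg_pos)
  then have "\<epsilon> > 0" using q(1) by (simp add: \<epsilon>_def)
  moreover have "\<exists>x\<in>polydisc. \<forall>j. d < j \<and> j < N \<longrightarrow> lagrange_coeff (series x) j (target \<rho> h x) = 0"
    if h: "norm h < \<epsilon>" for h
  proof -
    define G where "G x = (\<lambda>k. lagrange_coeff (series x) (d + \<iota> k) (target \<rho> h x))" for x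
    define T :: "complex ^ 'n \<Rightarrow> complex ^ 'n" where
      "T x = vec_lambda (\<lambda>i. vec_nth x i - (\<Sum>k\<in>UNIV. M i k * G x k))" for x
    have "continuous_on polydisc T"
      unfolding T_def G_def continuous_on_def
      by (intro ballI tendsto_vec_lambda tendsto_diff tendsto_sum tendsto_mult tendsto_const
          lagrange_target_tendsto tendsto_vec_nth tendsto_ident_at)
    moreover have "T x \<in> polydisc" if x: "x \<in> polydisc" for x
      unfolding polydisc_def mem_Collect_eq
    proof
      fix i
      define F where "F k = (inverse (series x) ^ (d + \<iota> k)) $ (d + \<iota> k - 1)" for k
      have "norm (G x k - F k) \<le> norm h * \<bar>c\<bar>" for k
      proof -
        have "norm (G x k - F k) \<le> norm h * c"
          unfolding G_def F_def using c[OF x] h iota[of k] d by (auto simp: \<epsilon>_def N)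
        also have "\<dots> \<le> norm h * \<bar>c\<bar>" by (intro mult_left_mono) auto
        finally show ?thesis .
      qed
      then have "norm (\<Sum>k\<in>UNIV. M i k * (G x k - F k)) \<le> (\<Sum>k\<in>UNIV. norm (M i k) * (norm h * \<bar>c\<bar>))"
        by (intro sum_norm_le) (simp add: norm_mult mult_left_mono)
      also have "\<dots> \<le> m * (norm h * \<bar>c\<bar>)"
        unfolding sum_distrib_right[symmetric] using m by (intro mult_right_mono) auto
      also have "\<dots> \<le> norm h * (m * \<bar>c\<bar> + 1)" by (simp add: algebra_simps)
      also have "\<dots> \<le> r - q"
        using h \<open>m * \<bar>c\<bar> + 1 > 0\<close> by (simp add: \<epsilon>_def pos_less_divide_eq)
      finally have pert: "norm (\<Sum>k\<in>UNIV. M i k * (G x k - F k)) \<le> r - q" .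
      have "vec_nth (T x) i = (vec_nth x i - (\<Sum>k\<in>UNIV. M i k * F k)) - (\<Sum>k\<in>UNIV. M i k * (G x k - F k))"
        by (simp add: T_def right_diff_distrib sum_subtractf)
      then have "norm (vec_nth (T x) i) \<le> q + (r - q)"
        by (simp only: order_trans[OF norm_triangle_ineq4 add_mono[OF q(2)[OF x, of i, folded
            F_def] pert]])
      then show "norm (vec_nth (T x) i) \<le> r" by simp
    qed
    moreover have "0 \<in> polydisc" using r by (simp add: polydisc_def)
    ultimately obtain x where x: "x \<in> polydisc" "T x = x"
      using brouwer[OF polydisc_compact polydisc_convex, of T] by blast
    have "(\<Sum>k\<in>UNIV. M i k * G x k) = 0" for i
    proof -
      have "vec_nth (T x) i = vec_nth x i" using x(2) by simp
      then show ?thesis by (simp add: T_def)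
    qed
    then have G: "G x k = 0" for k by (rule M_injective)
    have "lagrange_coeff (series x) j (target \<rho> h x) = 0" if "d < j" "j < N" for j
    proof -
      have "j - d \<in> {1..n}" using that by (auto simp: N)
      then obtain k where "\<iota> k = j - d" using bij unfolding bij_betw_def by (metis imageE)
      then show ?thesis using G[of k] that by (simp add: G_def)
    qed
    then show ?thesis using x(1) by blast
  qed
  ultimately show ?thesis using that by blast
qed

text \<open>Brouwer's theorem gives no continuous choice of the solution as \<open>h\<close> varies,
  so convergence is obtained by passing to a subsequence in the compact polydisc.\<close>

lemma deformed_sequence:
  obtains h :: "nat \<Rightarrow> complex" and x x0 where "h \<longlonglongrightarrow> 0" "\<And>k. h k \<noteq> 0" "x \<longlonglongrightarrow> x0" "x0 \<in> polydisc"
    "\<And>k. x k \<in> polydisc"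
    "\<And>k j. d < j \<Longrightarrow> j < N \<Longrightarrow> lagrange_coeff (series (x k)) j (target \<rho> (h k) (x k)) = 0"
proof -
  obtain \<epsilon> where \<epsilon>: "\<epsilon> > 0" "\<And>h. norm h < \<epsilon> \<Longrightarrow> \<exists>x\<in>polydisc. \<forall>j. d < j \<and> j < N \<longrightarrow>
      lagrange_coeff (series x) j (target \<rho> h x) = 0"
    using deformed_solution by blast
  \<comment> \<open>The shift by 2 makes already the first term strictly smaller than
    \<open>\<epsilon>\<close>.\<close>
  define h :: "nat \<Rightarrow> complex" where "h k = of_real (\<epsilon> / of_nat (k + 2))" for k
  have "(\<lambda>k. \<epsilon> / real (k + 2)) \<longlonglongrightarrow> 0"
    by (rule real_tendsto_divide_at_top[OF tendsto_const filterlim_compose[OF filterlim_real_sequentially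
        filterlim_add_const_nat_at_top]])
  then have "h \<longlonglongrightarrow> of_real 0" unfolding h_def by (intro tendsto_of_real)
  moreover have "norm (h k) < \<epsilon>" "h k \<noteq> 0" for k
  proof -
    have "0 < \<epsilon> / real (k + 2)" using \<epsilon>(1) by simp
    moreover have "\<epsilon> / real (k + 2) < \<epsilon> / 1"
      using \<epsilon>(1) by (intro divide_strict_left_mono) auto
    ultimately show "norm (h k) < \<epsilon>" "h k \<noteq> 0"
      unfolding h_def norm_of_real of_real_eq_0_iff by linarith+
  qed
  ultimately have h: "h \<longlonglongrightarrow> 0" "\<And>k. norm (h k) < \<epsilon>" "\<And>k. h k \<noteq> 0" by auto
  have "\<forall>k. \<exists>x. x \<in> polydisc \<and> (\<forall>j. d < j \<and> j < N \<longrightarrow> lagrange_coeff (series x) j (target \<rho> (h k) x) = 0)"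
    using \<epsilon>(2) h(2) by blast
  then obtain x where x: "\<And>k. x k \<in> polydisc"
    "\<And>k j. d < j \<and> j < N \<longrightarrow> lagrange_coeff (series (x k)) j (target \<rho> (h k) (x k)) = 0"
    by metis
  obtain x0 \<phi> where \<phi>: "x0 \<in> polydisc" "strict_mono \<phi>" "(x \<circ> \<phi>) \<longlonglongrightarrow> x0"
    using polydisc_compact x(1) unfolding compact_def by metis
  have "(h \<circ> \<phi>) \<longlonglongrightarrow> 0" using h(1) \<phi>(2) by (rule LIMSEQ_subseq_LIMSEQ)
  then show ?thesis
    using that[of "h \<circ> \<phi>" "x \<circ> \<phi>" x0] h(3) \<phi> x by simp
qed

end

section \<open>From solutions of the equations to approximating automorphisms\<close>

lemma fps_of_poly_pcompose_eq:
  fixes D B :: "complex poly"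
  assumes "degree D \<le> d" "coeff D 0 = 0"
  shows "fps_of_poly (pcompose D (pCons 0 B)) =
    (\<Sum>j=1..d. fps_const (coeff D j) * (fps_X * fps_of_poly B) ^ j)"
proof -
  have "pcompose D (pCons 0 B) = (\<Sum>j\<le>d. smult (coeff D j) (pCons 0 B ^ j))"
    unfolding pcompose_eq_sum using assms(1)
    by (intro sum.mono_neutral_left) (auto simp: coeff_eq_0)
  also have "\<dots> = (\<Sum>j=1..d. smult (coeff D j) (pCons 0 B ^ j))"
    using assms(2) by (simp add: sum.atMost_shift sum.atLeast1_atMost_eq lessThan_Suc_atMost)
  finally show ?thesis
    by (simp add: fps_of_poly_sum fps_of_poly_smult fps_of_poly_power fps_of_poly_pCons mult.commute)
qed

context approximate_solution
begin

lemma polydegree_closure: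
  assumes base_poly: "base = fps_of_poly b" "degree b = n + 1"
  shows "Aut2_polydegree [N] \<subseteq> Aut2_topology closure_of Aut2_polydegree [d, n + 2]"
proof
  fix \<theta> assume *: "\<theta> \<in> Aut2_polydegree [N]"
  have "N \<ge> 2" using d by (simp add: N)
  then obtain \<alpha> \<beta> P where \<alpha>\<beta>: "\<alpha> \<in> Affine" "\<beta> \<in> Affine" and P: "degree P = N" "coeff P 0 = 0"
      "coeff P 1 = 0"
    and \<theta>: "\<theta> = comp2 \<alpha> (comp2 (triangular 1 P 1 0) \<beta>)"
    using polydegree_one_normal_form[OF *] by metis
  define p where "p = coeff P N"
  have "p \<noteq> 0" unfolding p_def P(1)[symmetric] using P(1) \<open>N \<ge> 2\<close> by auto
  \<comment> \<open>Only ratios to the top coefficient \<open>p\<close> enter the equations. As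
    \<open>g\<close> will be \<open>lead / p\<close>, the corrections \<open>lead * \<rho> k\<close>
    in \<open>target\<close> are exactly \<open>g\<close> times the coefficients of
    \<open>P\<close>.\<close>
  define \<rho> where "\<rho> k = coeff P k / p" for k
  obtain h0 x1 x0 where seq: "h0 \<longlonglongrightarrow> 0" "\<And>k. h0 k \<noteq> 0" "x1 \<longlonglongrightarrow> x0" "x0 \<in> polydisc" "\<And>k. x1 k \<in> polydisc"
    "\<And>k j. d < j \<Longrightarrow> j < N \<Longrightarrow> lagrange_coeff (series (x1 k)) j (target \<rho> (h0 k) (x1 k)) = 0"
    using deformed_sequence by blast
  have lead_d: "lagrange_coeff (series x0) d (target \<rho> 0 x0) \<noteq> 0"
    using nonzero_polydisc[OF _ seq(4), of d] by (simp add: target_zero lagrange_coeff_X)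
  have "(\<lambda>k. lagrange_coeff (series (x1 k)) d (target \<rho> (h0 k) (x1 k))) \<longlonglongrightarrow>
      lagrange_coeff (series x0) d (target \<rho> 0 x0)"
    by (intro lagrange_target_tendsto seq)
  then have "eventually (\<lambda>k. lagrange_coeff (series (x1 k)) d (target \<rho> (h0 k) (x1 k)) \<noteq> 0) sequentially"
    using lead_d by (rule tendsto_imp_eventually_ne)
  \<comment> \<open>Dropping the first \<open>K\<close> terms makes the coefficient of
    \<open>D\<close> at \<open>d\<close> nonzero throughout, so that its degree is exactly
    \<open>d\<close>.\<close>
  then obtain K where K: "\<And>k. k \<ge> K \<Longrightarrow> lagrange_coeff (series (x1 k)) d (target \<rho> (h0 k) (x1 k)) \<noteq> 0"
    by (auto simp: eventually_sequentially)
  define h where "h k = h0 (k + K)" for k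
  define x where "x k = x1 (k + K)" for k
  define C where "C k = target \<rho> (h k) (x k)" for k
  have h: "h \<longlonglongrightarrow> 0" "\<And>k. h k \<noteq> 0" and x: "x \<longlonglongrightarrow> x0" "\<And>k. x k \<in> polydisc"
    and lag: "\<And>k j. d < j \<Longrightarrow> j < N \<Longrightarrow> lagrange_coeff (series (x k)) j (C k) = 0"
    and lag_d: "\<And>k. lagrange_coeff (series (x k)) d (C k) \<noteq> 0"
    using seq K LIMSEQ_ignore_initial_segment[OF seq(1), of K] LIMSEQ_ignore_initial_segment[OF
        seq(3), of K]
    by (simp_all add: h_def[abs_def] x_def[abs_def] C_def)
  have lag_tendsto: "(\<lambda>k. lagrange_coeff (series (x k)) j (C k)) \<longlonglongrightarrow> lagrange_coeff (series x0) j
      fps_X" for j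
    using lagrange_target_tendsto[OF x(1) h(1), of j \<rho>] by (simp add: C_def target_zero)
  define B where "B y = b + (\<Sum>k\<in>UNIV. monom (vec_nth y k) (\<iota> k))" for y :: "complex ^ 'n"
  have B: "fps_of_poly (B y) = series y" for y
    unfolding B_def series_def pert_def unfolding base_poly(1)
    by (simp add: fps_of_poly_add fps_of_poly_sum fps_of_poly_monom)
  \<comment> \<open>The perturbation reaches only degrees up to \<open>n\<close>; the coefficient of
    degree \<open>n + 1\<close> is that of \<open>b\<close>, so \<open>A = t B\<close> has degree
    exactly \<open>n + 2\<close>.\<close>
  have degB: "degree (B y) = n + 1" for y
  proof -
    have "degree (\<Sum>k\<in>UNIV. monom (vec_nth y k) (\<iota> k)) \<le> n"
      using iota by (intro degree_sum_le) (auto intro: order_trans[OF degree_monom_le])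
    then show ?thesis unfolding B_def using base_poly(2) by (subst degree_add_eq_left) auto
  qed
  define A where "A k = pCons 0 (B (x k))" for k
  \<comment> \<open>These are the coefficients of the truncated expansion in
    \<open>lagrange_expansion\<close>, so \<open>D(A(t))\<close> agrees with \<open>C k\<close>
    below \<open>t^N\<close>.\<close>
  define D where "D k = (\<Sum>j=1..d. monom (lagrange_coeff (series (x k)) j (C k) / of_nat j) j)" for k
  define D0 where "D0 = (\<Sum>j=1..d. monom (lagrange_coeff (series x0) j fps_X / of_nat j) j)"
  have coeffD: "coeff (D k) j = (if 1 \<le> j \<and> j \<le> d then lagrange_coeff (series (x k)) j (C k) /
      of_nat j else 0)" for k j
    by (simp add: D_def coeff_sum)
  have coeffD0: "coeff D0 j = (if 1 \<le> j \<and> j \<le> d then lagrange_coeff (series x0) j fps_X / of_nat j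
      else 0)" for j
    by (simp add: D0_def coeff_sum)
  have degD_le: "degree (D k) \<le> d" for k
    by (rule degree_le) (simp add: coeffD)
  have degD: "degree (D k) = d" for k
  proof (rule antisym[OF degD_le le_degree])
    show "coeff (D k) d \<noteq> 0" using lag_d d by (simp add: coeffD)
  qed
  have DA: "fps_of_poly (pcompose (D k) (A k)) =
      (\<Sum>j=1..d. fps_const (lagrange_coeff (series (x k)) j (C k) / of_nat j) * (fps_X * series (x
          k)) ^ j)" for k
    unfolding A_def by (subst fps_of_poly_pcompose_eq[OF degD_le]) (auto simp: coeffD B)
  have C0: "C k $ 0 = 0" for k
    by (simp add: C_def target_def fps_sum_nth fps_X_power_nth)
  have Ck: "C k $ i = (if i = 1 then 1 else 0) + (if 2 \<le> i \<and> i < N then lead (x k) * \<rho> i * h k ^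
      (N - i) else 0)" for k i
  proof -
    have "(\<Sum>j\<in>{2..<N}. (fps_const (lead (x k) * \<rho> j * h k ^ (N - j)) * fps_X ^ j) $ i) =
        (\<Sum>j\<in>{2..<N}. if i = j then lead (x k) * \<rho> i * h k ^ (N - i) else 0)"
      by (intro sum.cong refl) (simp add: fps_X_power_nth)
    then show ?thesis by (simp add: C_def target_def fps_sum_nth)
  qed
  have "d < N" by (simp add: N)
  have expansion: "coeff (pcompose (D k) (A k)) i = C k $ i" if "i < N" for k i
    unfolding fps_of_poly_nth[symmetric] DA
    by (rule lagrange_expansion(1)) (use C0 \<open>d < N\<close> lag that in auto)
  have expansion_N: "coeff (pcompose (D k) (A k)) N = C k $ N - lagrange_coeff (series (x k)) N (C
      k) / of_nat N" for k
    unfolding fps_of_poly_nth[symmetric] DA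
    by (rule lagrange_expansion(2)) (use C0 \<open>d < N\<close> lag in auto)
  define g where "g k = lead (x k) / p" for k
  have lead_nz: "lead y \<noteq> 0" if "y \<in> polydisc" for y
    using nonzero_polydisc[OF _ that, of N] \<open>N \<ge> 2\<close> by (simp add: lead_def)
  interpret two_step_sequence d "n + 2" N P "pCons 0 (B x0)" D0 "lead x0 / p" h g A D
  proof
    show "2 \<le> d" "2 \<le> n + 2" "2 \<le> N" using d by (simp_all add: N)
    show "degree (A k) = n + 2" for k using degB[of "x k"] by (auto simp: A_def)
    show "degree (D k) = d" for k by (rule degD)
    show "(\<lambda>k. coeff (A k) i) \<longlonglongrightarrow> coeff (pCons 0 (B x0)) i" for i
    proof (cases i)
      case (Suc i')
      have "(\<lambda>k. coeff (B (x k)) i') \<longlonglongrightarrow> coeff (B x0) i'"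
        using fps_tendsto_nth[OF series_tendsto[OF x(1)], of i'] by (simp flip: B)
      then show ?thesis by (simp add: A_def Suc)
    qed (simp add: A_def)
    show "coeff (A k) 0 = 0" for k by (simp add: A_def)
    have "coeff (B x0) 0 = 1" using series_0[of x0] by (simp flip: B)
    then show "coeff (pCons 0 (B x0)) 1 = 1" by simp
    show "(\<lambda>k. coeff (D k) i) \<longlonglongrightarrow> coeff D0 i" for i
      unfolding coeffD coeffD0 using lag_tendsto by (auto intro!: tendsto_divide)
    show "coeff D0 1 = 1" using d by (simp add: coeffD0 lagrange_coeff_X)
    show "h \<longlonglongrightarrow> 0" "\<And>k. h k \<noteq> 0" by (fact h)+
    show "g \<longlonglongrightarrow> lead x0 / p"
      unfolding g_def using \<open>p \<noteq> 0\<close> by (intro tendsto_divide lead_tendsto x tendsto_const) 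
    show "lead x0 / p \<noteq> 0" "\<And>k. g k \<noteq> 0"
      using lead_nz seq(4) x(2) \<open>p \<noteq> 0\<close> by (auto simp: g_def)
    show "coeff (pcompose (D k) (A k)) i = (if i = 1 then 1 else 0) + g k * coeff P i * h k ^ (N - i)"
      if "i < N" for k i
    proof -
      have "coeff (pcompose (D k) (A k)) i = C k $ i"
        using that by (rule expansion)
      moreover have "i = 0 \<or> i = 1 \<or> 2 \<le> i" by linarith
      ultimately show ?thesis
        using that P(2,3) \<open>p \<noteq> 0\<close> unfolding Ck by (auto simp: g_def \<rho>_def)
    qed
    have "coeff (pcompose (D k) (A k)) N = - lagrange_coeff (series (x k)) N (C k) / of_nat N" for k
      using \<open>N \<ge> 2\<close> by (simp add: expansion_N Ck)
    moreover have "(\<lambda>k. - lagrange_coeff (series (x k)) N (C k) / of_nat N / g k) \<longlonglongrightarrow>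
        - lagrange_coeff (series x0) N fps_X / of_nat N / (lead x0 / p)"
      by (intro tendsto_divide tendsto_minus lag_tendsto tendsto_const \<open>g \<longlonglongrightarrow> _\<close> \<open>lead x0 / p \<noteq> 0\<close>)
          (use \<open>N \<ge> 2\<close> in simp)
    moreover have "- lagrange_coeff (series x0) N fps_X / of_nat N / (lead x0 / p) = coeff P N"
      using lead_nz[OF seq(4)] \<open>N \<ge> 2\<close> by (simp add: lead_def lagrange_coeff_X p_def)
    ultimately show "(\<lambda>k. coeff (pcompose (D k) (A k)) N / g k) \<longlonglongrightarrow> coeff P N" by simp
    show "degree P = N" by (rule P)
  qed
  show "\<theta> \<in> Aut2_topology closure_of Aut2_polydegree [d, n + 2]"
  proof (rule closure_of_Aut2I)
    show "Aut2_tendsto (\<lambda>k. comp2 \<alpha> (comp2 (two_step k) \<beta>)) \<theta>"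
      unfolding \<theta> by (intro Aut2_tendsto_comp2 Aut2_tendsto_const two_step_tendsto)
    have aut: "\<alpha> \<in> Aut2" "\<beta> \<in> Aut2" using \<alpha>\<beta> by (auto simp: Affine_def)
    then show "\<theta> \<in> Aut2"
      unfolding \<theta> by (intro comp2_Aut2 triangular_Aut2) auto
    show "comp2 \<alpha> (comp2 (two_step k) \<beta>) \<in> Aut2" for k
      unfolding two_step_def using aut swap2_Affine step_scale_nz
      by (intro comp2_Aut2 triangular_Aut2) (auto simp: Affine_def)
    show "comp2 \<alpha> (comp2 (two_step k) \<beta>) \<in> Aut2_polydegree [d, n + 2]" for k
      using polydegree_two_I[OF \<alpha>\<beta>, of "- 1 / step_scale k" "step_scale k" "outer_poly k"
          "inner_poly k"] d
      by (simp add: two_step_def comp2_assoc step_scale_nz degree_inner_poly degree_outer_poly)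
  qed
qed

end

section \<open>Numerical certificates\<close>

text \<open>The part of the \<open>k\<close>-th coefficient of \<open>B t F' + m t B' F\<close> that
  involves lower coefficients of \<open>F\<close>: the term \<open>n t^i\<close> of \<open>B\<close>
  contributes \<open>n (k - i + i m)\<close> times the coefficient of degree \<open>k - i\<close>.
  As \<open>gs\<close> is in descending order, both lists are traversed in parallel.\<close>

fun conv_rec :: "int \<Rightarrow> int \<Rightarrow> int \<Rightarrow> int list \<Rightarrow> int list \<Rightarrow> int" where
  "conv_rec k m i [] gs = 0"
| "conv_rec k m i (n # ns) [] = 0"
| "conv_rec k m i (n # ns) (g # gs) = n * (k - i + i * m) * g + conv_rec k m (i + 1) ns gs"

text \<open>Fixed-point approximations of the coefficients of \<open>B\<^sup>-\<^sup>m\<close>, listed from degree \<open>k\<close> down to \<open>0\<close>. The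
  recurrence is the differential equation \<open>B t F' + m t B' F = 0\<close> of \<open>F = B\<^sup>-\<^sup>m\<close>.\<close>

definition approx_step :: "int list \<Rightarrow> int \<Rightarrow> int \<Rightarrow> int \<Rightarrow> int list \<Rightarrow> int list" where
  "approx_step ns T m k gs = (- conv_rec k m 1 ns gs div (k * T)) # gs"

fun approx_coeffs :: "int list \<Rightarrow> int \<Rightarrow> int \<Rightarrow> int \<Rightarrow> nat \<Rightarrow> int list" where
  "approx_coeffs ns T S m 0 = [S]"
| "approx_coeffs ns T S m (Suc k) = approx_step ns T m (int (Suc k)) (approx_coeffs ns T S m k)"

text \<open>In a table of coefficients in descending order, an index past the end stands for a
  negative degree, so the default 0 is the true value.\<close>

definition nth_or_0 :: "int list \<Rightarrow> nat \<Rightarrow> int" where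
  "nth_or_0 xs i = (if i < length xs then xs ! i else 0)"

definition dot :: "int list \<Rightarrow> int list \<Rightarrow> int" where
  "dot xs ys = sum_list (map2 (*) xs ys)"

text \<open>The inequality \<open>row\<close> multiplied by \<open>2 R^2 W S\<close>, for radius
  \<open>1 / R\<close>, matrix entries \<open>ms / W\<close> and tabulated coefficients divided by
  \<open>S\<close>. \<open>L\<close> stands for a bound of \<open>l^(N + 1)\<close>, and
  \<open>N * E\<close> for a bound of the error of a tabulated integer; in a Jacobian entry this
  error gets another factor of at most \<open>N\<close>.\<close>

definition row_check ::
  "int \<Rightarrow> int \<Rightarrow> int \<Rightarrow> int \<Rightarrow> int \<Rightarrow> int \<Rightarrow> int \<Rightarrow> int list \<Rightarrow> int list list \<Rightarrow> nat \<Rightarrow> int list \<Rightarrow> bool" where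
  "row_check n N S W R L E heads cols i ms \<longleftrightarrow>
    2 * R * (R * (dot (map abs ms) (map abs heads) + sum_list (map abs ms) * N * E) +
      sum_list (map2 (\<lambda>k col. \<bar>(if k = i then W * S else 0) + dot ms col\<bar>) [0..<length cols] cols) +
      n * N * N * E * sum_list (map abs ms)) +
    sum_list (map abs ms) * N * N * n * n * L * S < 2 * R * W * S"

text \<open>The tables belong to the exponents \<open>m = d, ..., N\<close>, each headed by degree
  \<open>m - 1\<close>. The outer two heads serve \<open>nonzero\<close>, the inner ones are the
  values of the equations. Equation \<open>j\<close> has its Jacobian row in the table for
  \<open>j + 1\<close>, hence the two tails. Column \<open>k\<close> belongs to the coefficient of
  degree \<open>k + 1\<close>, so it needs degree \<open>j - 1 - (k + 1)\<close>, which is position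
  \<open>k + 2\<close> after the head of degree \<open>j\<close>.\<close>

definition matrix_check ::
  "nat \<Rightarrow> nat \<Rightarrow> int list list \<Rightarrow> int \<Rightarrow> int \<Rightarrow> int \<Rightarrow> int \<Rightarrow> int \<Rightarrow> int list list \<Rightarrow> bool" where
  "matrix_check n d M S W R L E tables \<longleftrightarrow>
    R * (\<bar>hd (hd tables)\<bar> - int (d + n + 1) * E) > int (d + n + 1) * int n * L * S \<and>
    R * (\<bar>hd (last tables)\<bar> - int (d + n + 1) * E) > int (d + n + 1) * int n * L * S \<and>
    list_all (\<lambda>ms. length ms = n) M \<and>
    list_all2 (row_check (int n) (int (d + n + 1)) S W R L E (map hd (butlast (tl tables)))
      (map (\<lambda>k. map2 (\<lambda>j gs. int j * nth_or_0 gs (k + 2)) [d + 1..<d + n + 1] (tl (tl tables))) [0..<n]))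
      [0..<n] M"

text \<open>The inequality with \<open>p\<close> says \<open>s + n r <= 1 - p / 64\<close>. Hence
  \<open>l <= 64 / p\<close> and \<open>(1 + s) / (1 - s) <= (128 - p) / p\<close>; the integers
  passed for \<open>L\<close> and \<open>E\<close> are the powers of these with exponents
  \<open>d + e = N + 1\<close> and \<open>N\<close>, rounded up by the final
  \<open>+ 1\<close>.\<close>

fun certificate ::
  "nat \<times> nat \<times> int list \<times> int list list \<times> nat \<times> nat \<times> nat \<times> nat \<times> int \<Rightarrow> bool" where
  "certificate (d, e, ns, M, aT, aS, aW, aR, p) \<longleftrightarrow>
    length ns = e - 1 \<and> last ns \<noteq> 0 \<and> 2 \<le> d \<and> 3 \<le> e \<and> 0 < p \<and>
    64 * (sum_list (map abs ns) * 2 ^ aR + int (e - 2) * 2 ^ aT) \<le> (64 - p) * 2 ^ aT * 2 ^ aR \<and>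
    matrix_check (e - 2) d M (2 ^ aS) (2 ^ aW) (2 ^ aR)
      (64 ^ (d + e) div p ^ (d + e) + 1)
      ((128 - p) ^ (d + e - 1) div p ^ (d + e - 1) + 1)
      (map (\<lambda>m. approx_coeffs ns (2 ^ aT) (2 ^ aS) (int m) (m - 1)) [d..<d + e])"

section \<open>Soundness of the integer computation\<close>

lemma conv_rec_eq_sum:
  "conv_rec k m j ns gs =
    (\<Sum>i<min (length ns) (length gs). ns ! i * (k - (j + int i) + (j + int i) * m) * gs ! i)"
  by (induction k m j ns gs rule: conv_rec.induct)
     (simp_all add: sum.lessThan_Suc_shift add.assoc del: sum.lessThan_Suc)

lemma length_approx_coeffs [simp]: "length (approx_coeffs ns T S m k) = k + 1"
  by (induction k) (simp_all add: approx_step_def)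

lemma nth_approx_coeffs:
  "i \<le> k \<Longrightarrow> approx_coeffs ns T S m k ! i = hd (approx_coeffs ns T S m (k - i))"
proof (induction i arbitrary: k)
  case 0
  then show ?case by (metis length_approx_coeffs hd_conv_nth list.size(3) minus_nat.diff_0
      add_is_0 one_neq_zero)
next
  case (Suc i)
  then obtain k' where "k = Suc k'" by (cases k) auto
  then show ?case using Suc by (simp add: approx_step_def)
qed

text \<open>The recurrence is tested on the computed lower coefficients, so its defect is just the
  remainder of one integer division by \<open>k T\<close>.\<close>

lemma approx_coeffs_residual:
  fixes ns :: "int list" and T S m :: int and k :: nat
  assumes "T > 0" "k \<ge> 1"
  defines "g \<equiv> \<lambda>k. hd (approx_coeffs ns T S m k)"
  shows "\<bar>int k * T * g k + (\<Sum>i<min (length ns) k. ns ! i * (int k - (1 + int i) + (1 + int i) *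
      m) * g (k - 1 - i))\<bar>
    \<le> int k * T"
proof -
  obtain k' where k: "k = Suc k'" using assms(2) by (cases k) auto
  define c where "c = conv_rec (int k) m 1 ns (approx_coeffs ns T S m k')"
  have c: "c = (\<Sum>i<min (length ns) k. ns ! i * (int k - (1 + int i) + (1 + int i) * m) * g (k - 1 - i))"
    unfolding c_def conv_rec_eq_sum
    by (intro sum.cong) (auto simp: k g_def nth_approx_coeffs)
  have g: "g k = - c div (int k * T)"
    by (simp add: g_def k c_def approx_step_def)
  have pos: "int k * T > 0" using assms by simp
  have "- c = int k * T * g k + (- c) mod (int k * T)"
    unfolding g by simp
  moreover have "0 \<le> (- c) mod (int k * T)" "(- c) mod (int k * T) < int k * T"
    using pos by simp_all
  ultimately show ?thesis unfolding c[symmetric] by linarith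
qed

definition cert_base :: "int list \<Rightarrow> int \<Rightarrow> complex poly" where
  "cert_base ns T = 1 + (\<Sum>i<length ns. monom (of_int (ns ! i) / of_int T) (i + 1))"

lemma fps_cert_base:
  "fps_of_poly (cert_base ns T) =
    1 + (\<Sum>i<length ns. fps_const (of_int (ns ! i) / of_int T) * fps_X ^ (i + 1))"
  by (simp add: cert_base_def fps_of_poly_add fps_of_poly_sum fps_of_poly_monom)

lemma fps_cert_base_0: "fps_of_poly (cert_base ns T) $ 0 = 1"
  by (simp add: fps_cert_base fps_sum_nth)

lemma fps_norm_cert_base:
  assumes "T > 0"
  shows "fps_norm K (fps_of_poly (cert_base ns T) - 1) \<le> of_int (sum_list (map abs ns)) / of_int T"
proof -
  have "fps_norm K (fps_of_poly (cert_base ns T) - 1) \<le> (\<Sum>i<length ns. norm (of_int (ns ! i) /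
      of_int T :: complex))"
    unfolding fps_cert_base add_diff_cancel_left'
    by (intro order_trans[OF fps_norm_sum sum_mono] fps_norm_const_X_power)
  also have "\<dots> = of_int (sum_list (map abs ns)) / of_int T"
    using assms by (simp add: norm_divide sum_list_sum_nth atLeast0LessThan sum_divide_distrib)
  finally show ?thesis .
qed

lemma degree_cert_base:
  assumes "ns \<noteq> []" "last ns \<noteq> 0" "T > 0" shows "degree (cert_base ns T) = length ns"
proof (rule antisym)
  show "degree (cert_base ns T) \<le> length ns"
    unfolding cert_base_def
    by (intro degree_add_le degree_sum_le) (auto intro: order_trans[OF degree_monom_le])
  have "(\<Sum>i<length ns. coeff (monom (of_int (ns ! i) / of_int T :: complex) (i + 1)) (length ns)) =
      (\<Sum>i<length ns. if i = length ns - 1 then of_int (last ns) / of_int T else 0)"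
    using assms(1) by (intro sum.cong refl) (auto simp: last_conv_nth)
  also have "\<dots> = of_int (last ns) / of_int T" using assms(1) by (subst sum.delta) auto
  finally have "coeff (cert_base ns T) (length ns) \<noteq> 0"
    using assms by (simp add: cert_base_def coeff_sum)
  then show "length ns \<le> degree (cert_base ns T)" by (rule le_degree)
qed

text \<open>After division by \<open>T S\<close> the rounding defect is at most
  \<open>k / S\<close>, so \<open>fps_norm_inverse_power_approx\<close> applies with
  \<open>\<eta> = 1 / S\<close>. Accumulated rounding is thus controlled by the differential
  equation instead of coefficient by coefficient.\<close>

lemma approx_coeffs_error:
  assumes "T > 0" "S > 0" "m \<ge> 1" and s: "s < 1" "of_int (sum_list (map abs ns)) / of_int T \<le> s"
    and k: "k \<le> K"
  shows "norm (of_int (hd (approx_coeffs ns T S (int m) k)) / of_int S -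
      (inverse (fps_of_poly (cert_base ns T)) ^ m) $ k) \<le>
    of_nat K / of_int S * ((1 + s) / (1 - s)) ^ m"
proof -
  define B where "B = fps_of_poly (cert_base ns T)"
  define g where "g k = hd (approx_coeffs ns T S (int m) k)" for k
  define G :: "complex fps" where "G = Abs_fps (\<lambda>k. of_int (g k) / of_int S)"
  have ode: "(B * (fps_X * fps_deriv G) + of_nat m * (fps_X * fps_deriv B) * G) $ k =
      of_int (int k * T * g k + (\<Sum>i<min (length ns) k.
        ns ! i * (int k - (1 + int i) + (1 + int i) * int m) * g (k - 1 - i))) / (of_int T *
            of_int S)" for k
  proof -
    define \<beta> where "\<beta> i = (of_int (ns ! i) / of_int T :: complex)" for i
    have XB: "fps_X * fps_deriv B = (\<Sum>i<length ns. fps_const (of_nat (i + 1) * \<beta> i) * fps_X ^ (i + 1))"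
    proof -
      have "fps_X * fps_deriv (fps_const c * fps_X ^ (i + 1)) = fps_const (of_nat (i + 1) * c) *
          fps_X ^ (i + 1)"
        for c :: complex and i
        by (rule fps_ext) (simp add: fps_mult_fps_X_deriv_shift fps_X_power_nth del: power_Suc)
      then show ?thesis
        unfolding B_def fps_cert_base fps_deriv_add fps_deriv_sum \<beta>_def[symmetric]
        by (simp add: sum_distrib_left del: power_Suc fps_deriv_mult fps_deriv_power)
    qed
    have "(B * (fps_X * fps_deriv G) + of_nat m * (fps_X * fps_deriv B) * G) $ k =
        of_nat k * G $ k +
        (\<Sum>i<length ns. (fps_const (\<beta> i) * fps_X ^ (i + 1) * (fps_X * fps_deriv G)) $ k) +
        of_nat m * (\<Sum>i<length ns. (fps_const (of_nat (i + 1) * \<beta> i) * fps_X ^ (i + 1) * G) $ k)"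
      unfolding XB
      unfolding B_def fps_cert_base \<beta>_def[symmetric]
      by (simp add: distrib_right fps_sum_nth sum_distrib_right mult.assoc fps_mult_fps_X_deriv_shift
          del: power_Suc)
    also have "\<dots> = of_nat k * G $ k + (\<Sum>i<length ns. if i < k then
        \<beta> i * (of_nat (k - 1 - i) + of_nat (i + 1) * of_nat m) * G $ (k - 1 - i) else 0)"
    proof -
      have shift: "(fps_const c * fps_X ^ (i + 1) * H) $ k = (if i < k then c * H $ (k - 1 - i) else 0)"
        for c and H :: "complex fps" and i
        unfolding mult.assoc fps_mult_left_const_nth fps_X_power_mult_nth by auto
      show ?thesis
        unfolding shift sum_distrib_left add.assoc sum.distrib[symmetric]
        by (intro arg_cong2[of _ _ _ _ "(+)"] refl sum.cong)
           (simp add: fps_mult_fps_X_deriv_shift algebra_simps)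
    qed
    also have "(\<Sum>i<length ns. if i < k then
          \<beta> i * (of_nat (k - 1 - i) + of_nat (i + 1) * of_nat m) * G $ (k - 1 - i) else 0) =
        (\<Sum>i<min (length ns) k. \<beta> i * (of_nat (k - 1 - i) + of_nat (i + 1) * of_nat m) * G $ (k - 1 - i))"
      by (intro sum.mono_neutral_cong_right) auto
    also have "\<dots> = (\<Sum>i<min (length ns) k.
        of_int (ns ! i * (int k - (1 + int i) + (1 + int i) * int m) * g (k - 1 - i)) / (of_int T
            * of_int S))"
      by (intro sum.cong refl) (auto simp: \<beta>_def G_def of_nat_diff)
    also have "of_nat k * G $ k = of_int (int k * T * g k) / (of_int T * of_int S)"
      using assms(1) by (simp add: G_def)
    finally show ?thesis by (simp add: add_divide_distrib sum_divide_distrib)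
  qed
  have "norm ((G - inverse B ^ m) $ k) \<le> fps_norm K (G - inverse B ^ m)"
    using k by (rule norm_nth_le_fps_norm)
  also have "\<dots> \<le> of_nat K * (1 / of_int S) * ((1 + s) / (1 - s)) ^ m"
  proof (rule fps_norm_inverse_power_approx)
    show "B $ 0 = 1" unfolding B_def by (rule fps_cert_base_0)
    show "fps_norm K (B - 1) \<le> s"
      unfolding B_def using fps_norm_cert_base[OF assms(1)] s(2) by (rule order_trans)
    show "G $ 0 = 1" using assms(2) by (simp add: G_def g_def)
    show "norm ((B * (fps_X * fps_deriv G) + of_nat m * (fps_X * fps_deriv B) * G) $ k) \<le> of_nat k
        * (1 / of_int S)"
      if "1 \<le> k" for k
    proof -
      define z where "z = int k * T * g k + (\<Sum>i<min (length ns) k.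
        ns ! i * (int k - (1 + int i) + (1 + int i) * int m) * g (k - 1 - i))"
      have "\<bar>z\<bar> \<le> int k * T"
        unfolding z_def g_def using assms(1) that by (rule approx_coeffs_residual)
      then have "real_of_int \<bar>z\<bar> \<le> real_of_int (int k * T)" by (rule of_int_le_iff[THEN iffD2])
      then have "real_of_int \<bar>z\<bar> / (of_int T * of_int S) \<le> of_int (int k * T) / (of_int T * of_int S)"
        using assms(1,2) by (intro divide_right_mono) auto
      then show ?thesis
        unfolding ode z_def[symmetric] using assms(1,2) by (simp add: norm_divide norm_mult)
    qed
  qed (use s assms in auto)
  finally show ?thesis by (simp add: G_def g_def B_def)
qed

lemma int_le_div_plus_1: "0 < b \<Longrightarrow> real_of_int a / of_int b \<le> of_int (a div b + 1)"
  using real_of_int_div4[of a b] real_of_int_div3[of a b] by simp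

lemma dot_eq_sum: "length xs = n \<Longrightarrow> length ys = n \<Longrightarrow> dot xs ys = (\<Sum>i<n. xs ! i * ys ! i)"
  by (simp add: dot_def sum_list_sum_nth atLeast0LessThan)

lemma certificate_sound:
  assumes cert: "certificate (d, e, ns, M, aT, aS, aW, aR, p)" and card: "CARD('n) = e - 2"
  obtains \<iota> :: "'n :: finite \<Rightarrow> nat" and C r s l
  where "approximate_solution \<iota> (e - 2) d (d + e - 1) (fps_of_poly (cert_base ns (2 ^ aT))) C r s l"
proof -
  define n where "n = e - 2"
  define N where "N = d + e - 1"
  define T S W R :: int where "T = 2 ^ aT" and "S = 2 ^ aS" and "W = 2 ^ aW" and "R = 2 ^ aR"
  define L where "L = 64 ^ (N + 1) div p ^ (N + 1) + 1"
  define E where "E = (128 - p) ^ N div p ^ N + 1"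
  define tab where "tab m = approx_coeffs ns T S (int m) (m - 1)" for m
  have e: "3 \<le> e" "2 \<le> d" "0 < p" "last ns \<noteq> 0" "length ns = e - 1"
    using cert by simp_all
  then have nN: "e = n + 2" "N = d + n + 1" "n \<ge> 1" "d + e = N + 1"
    by (auto simp: n_def N_def)
  have pos: "T > 0" "S > 0" "W > 0" "R > 0" by (simp_all add: T_def S_def W_def R_def)
  have small: "64 * (sum_list (map abs ns) * R + int n * T) \<le> (64 - p) * T * R"
    and "matrix_check n d M S W R L E (map tab [d..<N + 1])"
    using cert unfolding certificate.simps n_def[symmetric] T_def[symmetric] S_def[symmetric]
      W_def[symmetric] R_def[symmetric] N_def[symmetric] tab_def[symmetric]
    unfolding nN(4) L_def[symmetric] E_def[symmetric]
    by blast+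
  then have check: "matrix_check n d M S W R L E (map tab [d..<d + n + 2])"
    using nN(2) by (simp only: add.assoc one_add_one)
  define s where "s = real_of_int (sum_list (map abs ns)) / of_int T"
  define r where "r = 1 / real_of_int R"
  define l where "l = 1 / (1 - (s + of_nat n * r))"
  have r: "r > 0" using pos by (simp add: r_def)
  have s0: "s \<ge> 0" using pos by (auto simp: s_def intro!: divide_nonneg_pos sum_list_nonneg)
  have sr: "s + of_nat n * r \<le> 1 - of_int p / 64"
  proof -
    have "64 * (of_int (sum_list (map abs ns)) * of_int R + real n * of_int T) \<le> (64 - of_int p) *
        of_int T * of_int R"
      using small by (simp only: of_int_le_iff[where 'a = real, symmetric]) simp
    then have "of_int (sum_list (map abs ns)) * of_int R + real n * of_int T \<le> (1 - of_int p / 64)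
        * (of_int T * of_int R)"
      by (simp add: field_simps)
    then have "(of_int (sum_list (map abs ns)) * of_int R + real n * of_int T) / (of_int T *
        of_int R) \<le> 1 - of_int p / 64"
      using pos by (simp only: pos_divide_le_eq mult_pos_pos of_int_0_less_iff)
    moreover have "s + of_nat n * r = (of_int (sum_list (map abs ns)) * of_int R + real n * of_int
        T) / (of_int T * of_int R)"
      using pos by (simp add: s_def r_def field_simps)
    ultimately show ?thesis by simp
  qed
  have p: "real_of_int p > 0" using e by simp
  have s1: "s \<le> 1 - of_int p / 64" using sr r by (smt (verit) mult_nonneg_nonneg of_nat_0_le_iff)
  have "s + of_nat n * r < 1" "s < 1" using sr s1 p by simp_all
  have lL: "l ^ (N + 1) \<le> of_int L"
  proof -
    have "l \<le> 1 / (of_int p / 64)"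
      unfolding l_def using sr p by (intro divide_left_mono) auto
    then have "l ^ (N + 1) \<le> (64 / of_int p) ^ (N + 1)"
      using \<open>s + of_nat n * r < 1\<close> by (intro power_mono) (auto simp: l_def)
    also have "\<dots> = of_int (64 ^ (N + 1)) / of_int (p ^ (N + 1))" by (simp add: power_divide)
    also have "\<dots> \<le> of_int L" unfolding L_def using e by (intro int_le_div_plus_1) simp
    finally show ?thesis .
  qed
  have sE: "((1 + s) / (1 - s)) ^ m \<le> of_int E" if "m \<le> N" for m
  proof -
    have "(1 + s) / (1 - s) \<le> ((128 - of_int p) / 64) / (of_int p / 64)"
      using s0 s1 p by (intro frac_le) auto
    also have "\<dots> = (128 - of_int p) / of_int p"
      using p by (simp add: field_simps)
    finally have le: "(1 + s) / (1 - s) \<le> (128 - of_int p) / of_int p" .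
    have "1 \<le> (1 + s) / (1 - s)" using s0 \<open>s < 1\<close> by simp
    then have "((1 + s) / (1 - s)) ^ m \<le> ((1 + s) / (1 - s)) ^ N"
      using that by (intro power_increasing)
    also have "\<dots> \<le> ((128 - of_int p) / of_int p) ^ N"
      using s0 \<open>s < 1\<close> le by (intro power_mono) auto
    also have "\<dots> = of_int ((128 - p) ^ N) / of_int (p ^ N)" by (simp add: power_divide)
    also have "\<dots> \<le> of_int E" unfolding E_def using e by (intro int_le_div_plus_1) simp
    finally show ?thesis .
  qed
  define base where "base = fps_of_poly (cert_base ns T)"
  define err where "err = of_nat N * of_int E / real_of_int S"
  have "E \<ge> 0" using sE[of 0] by simp
  then have err0: "err \<ge> 0" using pos by (simp add: err_def)
  have approx: "norm (of_int (hd (approx_coeffs ns T S (int m) k)) / of_int S - (inverse base ^ m)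
      $ k) \<le> err"
    if "1 \<le> m" "m \<le> N" "k \<le> m - 1" for m k
  proof -
    have "norm (of_int (hd (approx_coeffs ns T S (int m) k)) / of_int S - (inverse base ^ m) $ k) \<le>
        of_nat (m - 1) / of_int S * ((1 + s) / (1 - s)) ^ m"
      unfolding base_def using pos that \<open>s < 1\<close> by (intro approx_coeffs_error) (auto simp: s_def)
    also have "\<dots> \<le> of_nat N / of_int S * of_int E"
      using pos that sE[of m] s0 \<open>s < 1\<close> by (intro mult_mono divide_right_mono) auto
    finally show ?thesis by (simp add: err_def)
  qed
  have approx_hd: "norm (of_int (hd (tab m)) / of_int S - (inverse base ^ m) $ (m - 1)) \<le> err"
    if "1 \<le> m" "m \<le> N" for m
    unfolding tab_def using that by (intro approx) auto
  have approx_X: "norm (of_int (nth_or_0 (tab (j + 1)) (i + 1)) / of_int S - (fps_X ^ i * inverse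
      base ^ (j + 1)) $ (j - 1)) \<le> err"
    if "1 \<le> i" "1 \<le> j" "j + 1 \<le> N" for i j
  proof (cases "i \<le> j - 1")
    case True
    then have "nth_or_0 (tab (j + 1)) (i + 1) = hd (approx_coeffs ns T S (int (j + 1)) (j - 1 - i))"
      using that(2) by (simp add: nth_or_0_def tab_def nth_approx_coeffs)
    moreover have "(fps_X ^ i * inverse base ^ (j + 1)) $ (j - 1) = (inverse base ^ (j + 1)) $ (j
        - 1 - i)"
      using True unfolding fps_X_power_mult_nth by auto
    ultimately show ?thesis using approx[of "j + 1" "j - 1 - i"] that by simp
  next
    case False
    then have "nth_or_0 (tab (j + 1)) (i + 1) = 0" using that by (auto simp: nth_or_0_def tab_def)
    moreover have "(fps_X ^ i * inverse base ^ (j + 1)) $ (j - 1) = 0"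
      using False unfolding fps_X_power_mult_nth by auto
    ultimately show ?thesis using err0 by simp
  qed
  have nz: "of_nat N * l ^ (N + 1) * (of_nat n * r) < norm ((inverse base ^ m) $ (m - 1))"
    if m: "m \<in> {d, N}" for m
  proof -
    have "hd (map tab [d..<d + n + 2]) = tab d" "last (map tab [d..<d + n + 2]) = tab N"
      by (simp_all add: hd_map last_map nN(2) del: upt_Suc)
    then have "int N * int n * L * S < R * (\<bar>hd (tab m)\<bar> - int N * E)"
      using check m unfolding matrix_check_def nN(2)[symmetric] by auto
    then have "of_nat N * of_nat n * of_int L * of_int S < of_int R * (\<bar>of_int (hd (tab m))\<bar> -
        of_nat N * real_of_int E)"
      by (simp only: of_int_less_iff[where 'a = real, symmetric]) simp
    then have "of_nat N * of_int L * (of_nat n * r) < \<bar>of_int (hd (tab m))\<bar> / of_int S - err"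
      using pos by (simp add: r_def err_def field_simps)
    moreover have "of_nat N * l ^ (N + 1) * (of_nat n * r) \<le> of_nat N * of_int L * (of_nat n * r)"
      using lL r by (intro mult_right_mono mult_left_mono) auto
    moreover have "\<bar>of_int (hd (tab m))\<bar> / of_int S - err \<le> norm ((inverse base ^ m) $ (m - 1))"
    proof -
      have "1 \<le> m" "m \<le> N" using m e nN by auto
      then have "norm (of_int (hd (tab m)) / of_int S :: complex) \<le> norm ((inverse base ^ m) $ (m
          - 1)) + err"
        using approx_hd[of m] norm_triangle_ineq2[of "of_int (hd (tab m)) / of_int S" "(inverse
            base ^ m) $ (m - 1)"]
        by linarith
      then show ?thesis using pos by (simp add: norm_divide)
    qed
    ultimately show ?thesis by linarith
  qed
  \<comment> \<open>The lists are indexed from 0 but the perturbed coefficients from 1, because the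
    constant term of \<open>B\<close> stays 1; this is the shift \<open>\<kappa> k + 1\<close>
    below.\<close>
  obtain \<kappa> :: "'n \<Rightarrow> nat" where \<kappa>: "bij_betw \<kappa> UNIV {..<n}"
    using ex_bij_betw_finite_nat[of "UNIV :: 'n set"] card by (auto simp: n_def atLeast0LessThan)
  then have \<kappa>n: "\<kappa> k < n" for k by (auto simp: bij_betw_def)
  have \<kappa>_eq: "\<kappa> k = \<kappa> k' \<longleftrightarrow> k = k'" for k k' using \<kappa> by (auto simp: bij_betw_def inj_on_def)
  have reindex: "(\<Sum>k\<in>UNIV. f (\<kappa> k)) = (\<Sum>q<n. f q)" for f :: "nat \<Rightarrow> real"
    by (rule sum.reindex_bij_betw[OF \<kappa>])
  have reindex_c: "(\<Sum>k\<in>UNIV. f (\<kappa> k)) = (\<Sum>q<n. f q)" for f :: "nat \<Rightarrow> complex"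
    by (rule sum.reindex_bij_betw[OF \<kappa>])
  define C where "C i k = (of_int (M ! \<kappa> i ! \<kappa> k) / of_int W :: complex)" for i k
  show ?thesis
  proof (rule that)
    show "approximate_solution (\<lambda>k. \<kappa> k + 1) (e - 2) d (d + e - 1) (fps_of_poly (cert_base ns (2 ^
        aT))) C r s l"
      unfolding n_def[symmetric] N_def[symmetric] T_def[symmetric] base_def[symmetric]
    proof
      have "bij_betw Suc {..<n} {1..n}"
        by (rule bij_betw_byWitness[of _ "\<lambda>k. k - 1"]) auto
      from bij_betw_trans[OF \<kappa> this] show "bij_betw (\<lambda>k. \<kappa> k + 1) UNIV {1..n}"
        by (simp add: comp_def)
      show "N = d + n + 1" "2 \<le> d" "1 \<le> n" using nN e by auto
      show "base $ 0 = 1" unfolding base_def by (rule fps_cert_base_0)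
      show "fps_norm K (base - 1) \<le> s" for K
        unfolding base_def s_def by (rule fps_norm_cert_base[OF pos(1)])
      show "0 < r" "s + of_nat n * r < 1" "l = 1 / (1 - (s + of_nat n * r))"
        by (fact r, fact, fact l_def)
      show "of_nat N * l ^ (N + 1) * (of_nat n * r) < norm ((inverse base ^ m) $ (m - 1))"
        if "m \<in> {d, N}" for m using that by (rule nz)
      fix i :: 'n
      define ms where "ms = M ! \<kappa> i"
      define col where "col k = map (\<lambda>q. int (d + 1 + q) * nth_or_0 (tab (d + 2 + q)) (k + 2))
          [0..<n]" for k
      define heads where "heads = map (\<lambda>q. hd (tab (d + 1 + q))) [0..<n]"
      define ma where "ma = sum_list (map abs ms)"
      define A where "A = dot (map abs ms) (map abs heads)"
      define b where "b = (\<Sum>k<n. \<bar>(if k = \<kappa> i then W * S else 0) + dot ms (col k)\<bar>)"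
      have heads: "map hd (butlast (tl (map tab [d..<d + n + 2]))) = heads"
        unfolding heads_def by (rule nth_equalityI) (simp_all add: nth_butlast nth_tl del: upt_Suc)
      have cols: "map (\<lambda>k. map2 (\<lambda>j gs. int j * nth_or_0 gs (k + 2)) [d + 1..<d + n + 1]
          (tl (tl (map tab [d..<d + n + 2])))) [0..<n] = map col [0..<n]"
      proof (rule map_cong[OF refl])
        fix k
        show "map2 (\<lambda>j gs. int j * nth_or_0 gs (k + 2)) [d + 1..<d + n + 1] (tl (tl (map tab
            [d..<d + n + 2]))) = col k"
          unfolding col_def by (rule nth_equalityI) (simp_all add: nth_tl add.commute del: upt_Suc)
      qed
      have lens: "list_all (\<lambda>ms. length ms = n) M"
        and rows: "list_all2 (row_check (int n) (int N) S W R L E heads (map col [0..<n])) [0..<n] M"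
        using check unfolding matrix_check_def unfolding heads cols unfolding nN(2)[symmetric] by blast+
      have "length M = n" using list_all2_lengthD[OF rows] by simp
      then have "length ms = n" using lens \<kappa>n[of i] by (simp add: ms_def list_all_length)
      have row: "row_check (int n) (int N) S W R L E heads (map col [0..<n]) (\<kappa> i) ms"
        using list_all2_nthD[OF rows, of "\<kappa> i"] \<kappa>n[of i] by (simp add: ms_def)
      have "sum_list (map2 (\<lambda>k c. \<bar>(if k = \<kappa> i then W * S else 0) + dot ms c\<bar>) [0..<n] (map col
          [0..<n])) = b"
        by (simp add: b_def sum_list_sum_nth atLeast0LessThan)
      with row have ineq: "2 * R * (R * (A + ma * int N * E) + b + int n * int N * int N * E * ma) +
          ma * int N * int N * int n * int n * L * S < 2 * R * W * S"
        unfolding row_check_def A_def ma_def by simp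
      have ma: "ma = (\<Sum>q<n. \<bar>ms ! q\<bar>)"
        using \<open>length ms = n\<close> by (simp add: ma_def sum_list_sum_nth atLeast0LessThan)
      have A: "A = (\<Sum>q<n. \<bar>ms ! q\<bar> * \<bar>hd (tab (d + 1 + q))\<bar>)"
        using \<open>length ms = n\<close> unfolding A_def by (subst dot_eq_sum[of _ n]) (auto simp: heads_def)
      have normC: "norm (C i k) = \<bar>of_int (ms ! \<kappa> k)\<bar> / of_int W" for k
        using pos by (simp add: C_def ms_def norm_divide)
      have sumC: "(\<Sum>k\<in>UNIV. norm (C i k)) = of_int ma / of_int W"
        unfolding normC ma using reindex[of "\<lambda>q. \<bar>of_int (ms ! q)\<bar> / of_int W"]
        by (simp add: sum_divide_distrib)
      have t1: "(\<Sum>k\<in>UNIV. norm (C i k) * norm ((inverse base ^ (d + (\<kappa> k + 1))) $ (d + (\<kappa> k + 1) - 1))) \<le>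
          (of_int A + of_int ma * of_nat N * of_int E) / (of_int W * of_int S)"
      proof -
        have "norm ((inverse base ^ (d + (q + 1))) $ (d + (q + 1) - 1)) \<le> \<bar>of_int (hd (tab (d + 1
            + q)))\<bar> / of_int S + err"
          if "q < n" for q
        proof -
          have "norm ((inverse base ^ (d + (q + 1))) $ (d + (q + 1) - 1)) - norm (of_int (hd (tab
              (d + 1 + q))) / of_int S :: complex) \<le> err"
            using approx_hd[of "d + (q + 1)"] norm_triangle_ineq2[of "(inverse base ^ (d + (q +
                1))) $ (d + (q + 1) - 1)" "of_int (hd (tab (d + 1 + q))) / of_int S"] that nN
            by (simp add: norm_minus_commute add.commute add.left_commute)
          then show ?thesis using pos by (simp add: norm_divide)
        qed
        then have "(\<Sum>k\<in>UNIV. norm (C i k) * norm ((inverse base ^ (d + (\<kappa> k + 1))) $ (d + (\<kappa> k +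
            1) - 1))) \<le>
            (\<Sum>k\<in>UNIV. \<bar>of_int (ms ! \<kappa> k)\<bar> / of_int W * (\<bar>of_int (hd (tab (d + 1 + \<kappa> k)))\<bar> / of_int
                S + err))"
          unfolding normC using \<kappa>n pos by (intro sum_mono mult_left_mono) auto
        also have "\<dots> = (\<Sum>q<n. \<bar>of_int (ms ! q)\<bar> / of_int W * (\<bar>of_int (hd (tab (d + 1 + q)))\<bar> /
            of_int S + err))"
          by (rule reindex)
        also have "\<dots> = (of_int A + of_int ma * of_nat N * of_int E) / (of_int W * of_int S)"
          using pos unfolding A ma err_def
          by (simp add: sum_divide_distrib sum_distrib_right distrib_left sum.distrib
              add_divide_distrib mult.assoc)
        finally show ?thesis .
      qed
      have t2: "norm ((if i = i' then 1 else 0) + (\<Sum>k\<in>UNIV. C i k * (of_nat (d + (\<kappa> k + 1)) *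
          (fps_X ^ (\<kappa> i' + 1) * inverse base ^ (d + (\<kappa> k + 1) + 1)) $ (d + (\<kappa> k + 1) - 1)))) \<le>
          of_int \<bar>(if \<kappa> i' = \<kappa> i then W * S else 0) + dot ms (col (\<kappa> i'))\<bar> / (of_int W * of_int S) +
          of_int ma / of_int W * (of_nat N * err)" (is "norm ?z \<le> _") for i'
      proof -
        define X where "X q = (fps_X ^ (\<kappa> i' + 1) * inverse base ^ (d + (q + 1) + 1)) $ (d + (q +
            1) - 1)" for q
        define Y where "Y q = (of_int (nth_or_0 (tab (d + 2 + q)) (\<kappa> i' + 2)) / of_int S ::
            complex)" for q
        have XY: "norm (X q - Y q) \<le> err" if "q < n" for q
          using approx_X[of "\<kappa> i' + 1" "d + (q + 1)"] that nN
          by (simp add: X_def Y_def norm_minus_commute add.commute add.left_commute del: power_Suc)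
        have z: "?z = ((if i = i' then 1 else 0) + (\<Sum>k\<in>UNIV. C i k * (of_nat (d + (\<kappa> k + 1)) * Y
            (\<kappa> k)))) +
            (\<Sum>k\<in>UNIV. C i k * (of_nat (d + (\<kappa> k + 1)) * (X (\<kappa> k) - Y (\<kappa> k))))"
          unfolding X_def[symmetric] by (simp add: right_diff_distrib sum_subtractf)
        have main: "(if i = i' then 1 else 0) + (\<Sum>k\<in>UNIV. C i k * (of_nat (d + (\<kappa> k + 1)) * Y (\<kappa> k))) =
            of_int ((if \<kappa> i' = \<kappa> i then W * S else 0) + dot ms (col (\<kappa> i'))) / (of_int W * of_int S)"
        proof -
          have "(\<Sum>k\<in>UNIV. C i k * (of_nat (d + (\<kappa> k + 1)) * Y (\<kappa> k))) =
              (\<Sum>q<n. of_int (ms ! q) / of_int W * (of_nat (d + (q + 1)) * Y q))"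
            unfolding C_def ms_def[symmetric] by (rule reindex_c)
          also have "\<dots> = of_int (dot ms (col (\<kappa> i'))) / (of_int W * of_int S)"
            using \<open>length ms = n\<close>
            by (subst dot_eq_sum[of _ n]) (auto simp: col_def Y_def sum_divide_distrib intro!: sum.cong)
          finally show ?thesis using pos by (auto simp: \<kappa>_eq add_divide_distrib)
        qed
        have "norm ?z \<le> norm (of_int ((if \<kappa> i' = \<kappa> i then W * S else 0) + dot ms (col (\<kappa> i'))) /
            (of_int W * of_int S) :: complex) +
            norm (\<Sum>k\<in>UNIV. C i k * (of_nat (d + (\<kappa> k + 1)) * (X (\<kappa> k) - Y (\<kappa> k))))"
          unfolding z main by (rule norm_triangle_ineq)
        moreover have "norm (\<Sum>k\<in>UNIV. C i k * (of_nat (d + (\<kappa> k + 1)) * (X (\<kappa> k) - Y (\<kappa> k)))) \<le>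
            (\<Sum>k\<in>UNIV. norm (C i k) * (of_nat N * err))"
        proof (rule sum_norm_le)
          fix k
          have "norm (X (\<kappa> k) - Y (\<kappa> k)) \<le> err" by (rule XY[OF \<kappa>n])
          moreover have "d + (\<kappa> k + 1) \<le> N" using \<kappa>n[of k] nN by simp
          ultimately have "of_nat (d + (\<kappa> k + 1)) * norm (X (\<kappa> k) - Y (\<kappa> k)) \<le> of_nat N * err"
            using err0 by (intro mult_mono) (auto simp del: of_nat_add)
          then show "norm (C i k * (of_nat (d + (\<kappa> k + 1)) * (X (\<kappa> k) - Y (\<kappa> k)))) \<le> norm (C i k)
              * (of_nat N * err)"
            unfolding norm_mult norm_of_nat by (rule mult_left_mono) simp
        qed
        moreover have "(\<Sum>k\<in>UNIV. norm (C i k) * (of_nat N * err)) = of_int ma / of_int W * (of_nat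
            N * err)"
          by (simp only: sumC flip: sum_distrib_right)
        moreover have "norm (of_int ((if \<kappa> i' = \<kappa> i then W * S else 0) + dot ms (col (\<kappa> i'))) /
            (of_int W * of_int S) :: complex) =
            of_int \<bar>(if \<kappa> i' = \<kappa> i then W * S else 0) + dot ms (col (\<kappa> i'))\<bar> / (of_int W * of_int S)"
          using pos unfolding norm_divide norm_mult norm_of_int by simp
        ultimately show ?thesis by linarith
      qed
      have t3: "(\<Sum>i'\<in>UNIV. norm ((if i = i' then 1 else 0) + (\<Sum>k\<in>UNIV. C i k * (of_nat (d + (\<kappa> k + 1)) *
          (fps_X ^ (\<kappa> i' + 1) * inverse base ^ (d + (\<kappa> k + 1) + 1)) $ (d + (\<kappa> k + 1) - 1))))) \<le>
          of_int b / (of_int W * of_int S) + of_nat n * (of_int ma / of_int W * (of_nat N * err))"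
      proof -
        define f where "f k = real_of_int \<bar>(if k = \<kappa> i then W * S else 0) + dot ms (col k)\<bar> /
            (of_int W * of_int S) +
            of_int ma / of_int W * (of_nat N * err)" for k
        have "(\<Sum>i'\<in>UNIV. norm ((if i = i' then 1 else 0) + (\<Sum>k\<in>UNIV. C i k * (of_nat (d + (\<kappa> k + 1)) *
          (fps_X ^ (\<kappa> i' + 1) * inverse base ^ (d + (\<kappa> k + 1) + 1)) $ (d + (\<kappa> k + 1) - 1))))) \<le>
            (\<Sum>i'\<in>UNIV. f (\<kappa> i'))"
          unfolding f_def by (intro sum_mono t2)
        also have "\<dots> = (\<Sum>k<n. f k)" by (rule reindex)
        also have "\<dots> = of_int b / (of_int W * of_int S) + of_nat n * (of_int ma / of_int W *
            (of_nat N * err))"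
          unfolding f_def b_def sum.distrib by (simp add: sum_divide_distrib)
        finally show ?thesis .
      qed
      have "ma \<ge> 0" unfolding ma by (intro sum_nonneg) simp
      have t4: "(\<Sum>k\<in>UNIV. norm (C i k)) * (of_nat (N ^ 2) / 2 * l ^ (N + 1) * (of_nat n * r) ^ 2) \<le>
          of_int ma / of_int W * (of_nat (N ^ 2) / 2 * of_int L * (of_nat n * r) ^ 2)"
        unfolding sumC using lL \<open>ma \<ge> 0\<close> pos by (intro mult_left_mono mult_right_mono) auto
      have "(of_int A + of_int ma * of_nat N * of_int E) / (of_int W * of_int S) +
          r * (of_int b / (of_int W * of_int S) + of_nat n * (of_int ma / of_int W * (of_nat N * err))) +
          of_int ma / of_int W * (of_nat (N ^ 2) / 2 * of_int L * (of_nat n * r) ^ 2) =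
          of_int (2 * R * (R * (A + ma * int N * E) + b + int n * int N * int N * E * ma) +
            ma * int N * int N * int n * int n * L * S) / of_int (2 * R * R * W * S)"
        using pos by (simp add: r_def err_def field_simps power2_eq_square)
      also have "\<dots> < of_int (2 * R * W * S) / of_int (2 * R * R * W * S)"
      proof (rule divide_strict_right_mono)
        show "real_of_int (2 * R * (R * (A + ma * int N * E) + b + int n * int N * int N * E * ma) +
            ma * int N * int N * int n * int n * L * S) < of_int (2 * R * W * S)"
          using ineq by (rule of_int_less_iff[THEN iffD2])
        show "0 < real_of_int (2 * R * R * W * S)" using pos by simp
      qed
      also have "\<dots> = r" using pos by (simp add: r_def)
      finally have total: "(of_int A + of_int ma * of_nat N * of_int E) / (of_int W * of_int S) +
          r * (of_int b / (of_int W * of_int S) + of_nat n * (of_int ma / of_int W * (of_nat N * err))) +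
          of_int ma / of_int W * (of_nat (N ^ 2) / 2 * of_int L * (of_nat n * r) ^ 2) < r" .
      show "(\<Sum>k\<in>UNIV. norm (C i k) * norm ((inverse base ^ (d + (\<kappa> k + 1))) $ (d + (\<kappa> k + 1) - 1))) +
        r * (\<Sum>i'\<in>UNIV. norm ((if i = i' then 1 else 0) + (\<Sum>k\<in>UNIV. C i k *
          (of_nat (d + (\<kappa> k + 1)) * (fps_X ^ (\<kappa> i' + 1) * inverse base ^ (d + (\<kappa> k + 1) + 1)) $ (d
              + (\<kappa> k + 1) - 1))))) +
        (\<Sum>k\<in>UNIV. norm (C i k)) * (of_nat (N ^ 2) / 2 * l ^ (N + 1) * (of_nat n * r) ^ 2) < r"
        using t1 mult_left_mono[OF t3 less_imp_le[OF r]] t4 total by linarith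
    qed
  qed
qed

lemma certificate_closure:
  assumes "certificate (d, e, ns, M, aT, aS, aW, aR, p)" "CARD('n :: finite) = e - 2"
  shows "Aut2_polydegree [d + e - 1] \<subseteq> Aut2_topology closure_of Aut2_polydegree [d, e]"
proof -
  obtain \<iota> :: "'n \<Rightarrow> nat" and C r s l
    where "approximate_solution \<iota> (e - 2) d (d + e - 1) (fps_of_poly (cert_base ns (2 ^ aT))) C r s l"
    using certificate_sound[OF assms] by metis
  then interpret approximate_solution \<iota> "e - 2" d "d + e - 1" "fps_of_poly (cert_base ns (2 ^
      aT))" C r s l .
  have ns: "length ns = e - 1" "last ns \<noteq> 0" "3 \<le> e" using assms(1) by simp_all
  then have "degree (cert_base ns (2 ^ aT)) = length ns"
    by (intro degree_cert_base) auto
  then have "degree (cert_base ns (2 ^ aT)) = e - 2 + 1" using ns by simp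
  moreover have "e - 2 + 2 = e" using ns(3) by simp
  ultimately show ?thesis using polydegree_closure[OF refl] by (simp only:)
qed

lemma certificates_closure:
  assumes "list_all certificate cs" "map (\<lambda>(d, e, _). (d, e)) cs = map (\<lambda>d. (d, e)) [a..<b]"
    and "CARD('n :: finite) = e - 2" "a \<le> d" "d < b"
  shows "Aut2_polydegree [d + e - 1] \<subseteq> Aut2_topology closure_of Aut2_polydegree [d, e]"
proof -
  have "(d, e) \<in> set (map (\<lambda>(d, e, _). (d, e)) cs)"
    unfolding assms(2) using assms(4,5) by auto
  then obtain ns M aT aS aW aR p where "(d, e, ns, M, aT, aS, aW, aR, p) \<in> set cs" by auto
  then have "certificate (d, e, ns, M, aT, aS, aW, aR, p)"
    using assms(1) by (simp only: list_all_iff)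
  then show ?thesis using assms(3) by (rule certificate_closure)
qed

text \<open>
  A certificate \<open>(d, e, ns, M, aT, aS, aW, aR, p)\<close> describes the approximate solution with
  coefficients \<open>ns / 2^aT\<close>, the approximate inverse Jacobian \<open>M / 2^aW\<close> and a polydisc of radius
  \<open>1 / 2^aR\<close>; power series coefficients are computed with \<open>aS\<close> fractional bits, and \<open>1 - p / 64\<close>
  bounds the norm of \<open>B - 1\<close>. All entries were found by floating-point Newton iteration.
\<close>

definition certificates4 ::
  "(nat \<times> nat \<times> int list \<times> int list list \<times> nat \<times> nat \<times> nat \<times> nat \<times> int) list" where
  "certificates4 =
  [(2, 4, [25103, 9615, 4604], [[149, 116], [28, 89]], 17, 20, 8, 11, 44),
   (3, 4, [-8899, -5140, 4311], [[-248, 157], [56, -155]], 16, 20, 9, 10, 45),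
   (4, 4, [0, 0, 2294], [[244, 0], [0, 174]], 14, 14, 10, 8, 54),
   (5, 4, [-16443, 9955, -12924], [[-153, 56], [22, -106]], 17, 24, 9, 11, 44),
   (6, 4, [-11946, -8645, 13489], [[135, -48], [-19, 94]], 17, 22, 9, 11, 47),
   (7, 4, [0, 0, 2621], [[-222, 0], [0, -162]], 14, 16, 11, 8, 53),
   (8, 4, [22429, 15140, 30588], [[181, 46], [18, 130]], 18, 24, 10, 12, 47),
   (9, 4, [17810, -13757, -31348], [[-156, -39], [-16, -112]], 18, 24, 10, 12, 48),
   (10, 4, [0, 0, 5898], [[175, 0], [0, 129]], 15, 18, 12, 9, 52),
   (11, 4, [-34069, 24466, -67294], [[-208, 40], [16, -151]], 19, 26, 11, 13, 48),
   (12, 4, [29071, -23752, -73006], [[-139, -26], [-11, -101]], 19, 26, 11, 13, 48),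
   (13, 4, [0, 0, 13107], [[-239, 0], [0, -176]], 16, 20, 14, 10, 51),
   (14, 4, [28072, 21434, 76323], [[178, 27], [12, 130]], 19, 28, 12, 13, 48),
   (15, 4, [24545, -20772, -80512], [[-241, -35], [-16, -177]], 19, 28, 13, 13, 48),
   (16, 4, [0, 0, 13107], [[229, 0], [0, 169]], 16, 20, 15, 10, 51),
   (17, 4, [47693, 37960, 166005], [[-151, -19], [-9, -111]], 20, 30, 13, 14, 48),
   (18, 4, [42464, -36814, -172381], [[-208, -25], [-12, -153]], 20, 30, 14, 14, 48),
   (19, 4, [0, 0, 13107], [[-222, 0], [0, -165]], 16, 22, 16, 10, 51),
   (20, 4, [41434, 33980, 176244], [[128, 13], [6, 95]], 20, 30, 14, 14, 48),
   (21, 4, [-37408, -33005, 181246], [[-178, 18], [9, -131]], 20, 32, 15, 14, 48),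
   (22, 4, [0, 0, 28836], [[224, 0], [0, 167]], 17, 24, 18, 11, 49),
   (23, 4, [-73235, 61433, -368649], [[-217, 20], [10, -161]], 21, 32, 16, 15, 48),
   (24, 4, [-66849, -59773, 376695], [[152, -14], [-7, 113]], 21, 32, 16, 15, 48),
   (25, 4, [0, 0, 57672], [[-202, 0], [0, -150]], 18, 26, 19, 12, 49),
   (26, 4, [-65597, 56007, -381713], [[-184, 15], [7, -137]], 21, 34, 17, 15, 48),
   (27, 4, [60411, -54587, -388319], [[-130, -10], [-5, -96]], 21, 34, 17, 15, 48),
   (28, 4, [0, 0, 57672], [[184, 0], [0, 137]], 18, 28, 20, 12, 49),
   (29, 4, [-59395, 51438, -392484], [[-156, 11], [6, -116]], 21, 36, 18, 15, 48),
   (30, 4, [55101, -50213, -398002], [[-222, -16], [-8, -165]], 21, 36, 19, 15, 48),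
   (31, 4, [0, 0, 57672], [[-168, 0], [0, -125]], 18, 28, 21, 12, 49),
   (32, 4, [54261, 47543, 401513], [[133, 9], [4, 99]], 21, 36, 19, 15, 48),
   (33, 4, [-50648, -46478, 406190], [[-190, 12], [6, -141]], 21, 36, 20, 15, 48),
   (34, 4, [0, 0, 115343], [[154, 0], [0, 114]], 19, 30, 22, 13, 49),
   (35, 4, [99884, 88373, 818377], [[-227, -14], [-7, -169]], 22, 38, 21, 16, 48),
   (36, 4, [93720, -86508, -826405], [[-163, -10], [-5, -121]], 22, 38, 21, 16, 48),
   (37, 4, [0, 0, 115343], [[-141, 0], [0, -105]], 19, 32, 23, 13, 49),
   (38, 4, [92515, 82533, 831585], [[194, 11], [6, 144]], 22, 40, 22, 16, 48),
   (39, 4, [-87196, -80888, 838548], [[-140, 8], [4, -104]], 22, 40, 22, 16, 48),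
   (40, 4, [0, 0, 115343], [[131, 0], [0, 97]], 19, 32, 24, 13, 49),
   (41, 4, [86157, 77408, 843068], [[-166, -8], [-4, -123]], 22, 40, 23, 16, 48),
   (42, 4, [81521, -75948, -849164], [[-239, -12], [-6, -178]], 22, 40, 24, 16, 48),
   (43, 4, [0, 0, 115343], [[-242, 0], [0, -180]], 19, 34, 26, 13, 49),
   (44, 4, [80615, 72877, 853141], [[142, 7], [4, 106]], 22, 42, 24, 16, 48),
   (45, 4, [76538, -71572, -858522], [[-205, -10], [-5, -153]], 22, 42, 25, 16, 48),
   (46, 4, [0, 0, 125829], [[243, 0], [0, 181]], 19, 36, 29, 13, 48),
   (47, 4, [151484, 137684, 1724098], [[-243, -11], [-6, -181]], 23, 44, 26, 17, 48),
   (48, 4, [144258, -135340, -1733668], [[-177, -8], [-4, -132]], 23, 44, 26, 17, 48),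
   (49, 4, [0, 0, 125829], [[-207, 0], [0, -155]], 19, 36, 30, 13, 48)]"

text \<open>Zeros in the tables reflect symmetry. If \<open>e - 1\<close> divides
  \<open>d - 1\<close>, then \<open>B = 1 + c t^(e-1)\<close> is an exact solution: the exponents in
  \<open>B^-j\<close> are multiples of \<open>e - 1\<close>, while the degrees
  \<open>d, ..., d + e - 3\<close> in question are not. For \<open>e = 5\<close> and
  \<open>d = 3\<close> modulo 4 an even \<open>B\<close> is used, which settles two of the three
  equations by parity.\<close>

definition certificates5 ::
  "(nat \<times> nat \<times> int list \<times> int list list \<times> nat \<times> nat \<times> nat \<times> nat \<times> int) list" where
  "certificates5 =
  [(2, 5, [-96690, 35663, -16443, 8491], [[-174, 202, -146], [43, -149, 108], [-10, 39, -74]], 19,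
      24, 8, 13, 44),
   (3, 5, [0, 15484, 0, 5488], [[135, 0, 109], [0, 72, 0], [16, 0, 64]], 17, 20, 8, 11, 53),
   (4, 5, [-28428, -8712, -10302, 10230], [[-144, 72, 44], [25, -116, 61], [6, 29, -73]], 18, 26,
       8, 12, 49),
   (5, 5, [0, 0, 0, 3277], [[244, 0, 0], [0, 183, 0], [0, 0, 142]], 15, 16, 10, 9, 57),
   (6, 5, [-101162, 48117, -35235, 46173], [[144, -74, 46], [-20, 115, -48], [6, -21, 81]], 20,
       26, 8, 14, 49),
   (7, 5, [0, -24516, 0, 22670], [[230, 0, -85], [0, 160, 0], [-22, 0, 131]], 18, 22, 10, 12, 52),
   (8, 5, [-36175, -15617, -19104, 33961], [[176, -59, -30], [-19, 139, -47], [-6, -23, 102]], 19,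
       26, 9, 13, 51),
   (9, 5, [0, 0, 0, 7864], [[-215, 0, 0], [0, -166, 0], [0, 0, -130]], 16, 18, 11, 10, 56),
   (10, 5, [144705, 79867, 73245, 163557], [[236, 72, 39], [23, 186, 49], [8, 26, 140]], 21, 28,
       10, 15, 49),
   (11, 5, [0, 18876, 0, 28310], [[203, 0, 49], [0, 151, 0], [15, 0, 121]], 18, 24, 11, 12, 52),
   (12, 5, [-54963, -27501, -34917, 92333], [[-159, 38, 18], [13, -126, 29], [5, 16, -96]], 20,
       28, 10, 14, 51),
   (13, 5, [0, 0, 0, 18350], [[157, 0, 0], [0, 122, 0], [0, 0, 96]], 17, 20, 12, 11, 54),
   (14, 5, [111854, 66326, 68105, 215088], [[-175, -38, -19], [-14, -138, -27], [-5, -16, -106]],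
       21, 32, 11, 15, 49),
   (15, 5, [0, 30560, 0, 63812], [[-176, 0, -31], [0, -134, 0], [-10, 0, -108]], 19, 26, 12, 13, 52),
   (16, 5, [88822, -48102, 62432, 220075], [[-135, -25, 11], [-9, -107, -19], [3, -11, -83]], 21,
       30, 11, 15, 51),
   (17, 5, [0, 0, 0, 20972], [[-190, 0, 0], [0, -149, 0], [0, 0, -118]], 17, 22, 14, 11, 53),
   (18, 5, [-88107, 52783, -56207, 222333], [[-217, 37, -18], [13, -171, 27], [-5, 15, -133]], 21,
       32, 12, 15, 51),
   (19, 5, [0, -27234, 0, 77624], [[-177, 0, 23], [0, -136, 0], [9, 0, -109]], 19, 28, 14, 13, 51)]"

definition certificates6 ::
  "(nat \<times> nat \<times> int list \<times> int list list \<times> nat \<times> nat \<times> nat \<times> nat \<times> int) list" where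
  "certificates6 =
  [(2, 6, [-364567, 126752, -55086, 26813, -13984], [[-196, 282, -325, 222], [51, -196, 226,
      -155], [-15, 64, -147, 101], [4, -16, 44, -65]], 21, 30, 8, 15, 46),
   (3, 6, [-83364, -72510, 31458, 10247, -12135], [[-205, 103, 235, -238], [28, -142, 10, 124],
       [15, 11, -108, 56], [-6, 13, 27, -76]], 20, 26, 8, 14, 51),
   (4, 6, [-77855, 57461, 39162, -14206, 21031], [[176, -74, 105, 93], [-20, 136, -86, 92], [14,
       -33, 98, -39], [4, 16, -23, 72]], 20, 26, 8, 14, 51),
   (5, 6, [97662, -26653, 15055, -23701, -25672], [[-168, -84, 27, -46], [-26, -140, -62, 31], [5,
       -29, -115, -58], [-2, 4, -32, -74]], 20, 26, 8, 14, 52),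
   (6, 6, [0, 0, 0, 0, 5243], [[229, 0, 0, 0], [0, 178, 0, 0], [0, 0, 142, 0], [0, 0, 0, 116]],
       16, 18, 10, 10, 58),
   (7, 6, [28530, -155504, 108828, -19537, -65089], [[-154, 0, 90, -79], [-4, -112, -17, 74], [14,
       -11, -80, -17], [-6, 17, -10, -66]], 21, 28, 8, 15, 52),
   (8, 6, [96413, -120845, -74804, 34524, 92845], [[207, 54, -82, -68], [16, 162, 27, -54], [-13,
       11, 128, 32], [-7, -15, 19, 102]], 21, 30, 9, 15, 51),
   (9, 6, [92743, 96379, -82094, -37136, -111078], [[-160, -37, -50, 34], [-11, -127, -37, -40],
       [-10, -18, -100, -22], [4, -12, -14, -80]], 21, 30, 9, 15, 51),
   (10, 6, [125002, -48962, 35686, -56288, -111549], [[-159, -52, 20, -19], [-16, -131, -39, 18],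
       [4, -18, -107, -34], [-3, 5, -21, -81]], 21, 30, 9, 15, 52),
   (11, 6, [0, 0, 0, 0, 13107], [[-188, 0, 0, 0], [0, -150, 0, 0], [0, 0, -122, 0], [0, 0, 0,
       -100]], 17, 20, 11, 11, 57),
   (12, 6, [-250689, 129332, -99431, 105819, -253590], [[-242, 78, -49, 30], [23, -200, 62, -32],
       [-9, 29, -163, 44], [4, -11, 28, -127]], 22, 32, 10, 16, 51)]"

text \<open>The tables of power series coefficients grow with \<open>d\<close>, so the list is
  evaluated in portions, with fewer certificates per portion for large \<open>d\<close>.\<close>

lemma certificates4_1: "list_all certificate (take 28 certificates4)"
  by code_simp

lemma certificates4_2: "list_all certificate (take 10 (drop 28 certificates4))"
  by code_simp

lemma certificates4_3: "list_all certificate (take 5 (drop 38 certificates4))"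
  by code_simp

lemma certificates4_4: "list_all certificate (drop 43 certificates4)"
  by code_simp

lemma certificates5: "list_all certificate certificates5"
  by code_simp

lemma certificates6: "list_all certificate certificates6"
  by code_simp

lemma certificates4: "list_all certificate certificates4"
proof -
  have "certificates4 = take 28 certificates4 @ take 10 (drop 28 certificates4) @
      take 5 (drop 38 certificates4) @ drop 43 certificates4"
    by (simp add: certificates4_def)
  then show ?thesis
    using certificates4_1 certificates4_2 certificates4_3 certificates4_4 by (metis list_all_append)
qed

theorem theorem13:
  fixes d :: nat
  shows
    "(2 \<le> d \<and> d < 50 \<longrightarrow>
       Aut2_polydegree [d + 3] \<subseteq> Aut2_topology closure_of Aut2_polydegree [d, 4]) \<and>
     (2 \<le> d \<and> d < 20 \<longrightarrow>
       Aut2_polydegree [d + 4] \<subseteq> Aut2_topology closure_of Aut2_polydegree [d, 5]) \<and>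
     (2 \<le> d \<and> d \<le> 12 \<longrightarrow>
       Aut2_polydegree [d + 5] \<subseteq> Aut2_topology closure_of Aut2_polydegree [d, 6])"
proof (intro conjI impI)
  have tables: "map (\<lambda>(d, e, _). (d, e)) certificates4 = map (\<lambda>d. (d, 4)) [2..<50]"
    "map (\<lambda>(d, e, _). (d, e)) certificates5 = map (\<lambda>d. (d, 5)) [2..<20]"
    "map (\<lambda>(d, e, _). (d, e)) certificates6 = map (\<lambda>d. (d, 6)) [2..<13]"
    by code_simp+
  \<comment> \<open>The numeral types 2, 3 and 4 index the \<open>e - 2\<close> perturbed
    coefficients, so that Brouwer's theorem applies in a concrete space of vectors.\<close>
  show "Aut2_polydegree [d + 3] \<subseteq> Aut2_topology closure_of Aut2_polydegree [d, 4]"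
    if "2 \<le> d \<and> d < 50"
    using certificates_closure[where 'n = 2, OF certificates4 tables(1), of d] that by (simp add:
        add.commute)
  show "Aut2_polydegree [d + 4] \<subseteq> Aut2_topology closure_of Aut2_polydegree [d, 5]"
    if "2 \<le> d \<and> d < 20"
    using certificates_closure[where 'n = 3, OF certificates5 tables(2), of d] that by (simp add:
        add.commute)
  show "Aut2_polydegree [d + 5] \<subseteq> Aut2_topology closure_of Aut2_polydegree [d, 6]"
    if "2 \<le> d \<and> d \<le> 12"
    using certificates_closure[where 'n = 4, OF certificates6 tables(3), of d] that by (simp add:
        add.commute)
qed

end
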